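(* There exists a one parameter family of representations $\rho_t:\mathrm{PSL}_2(\mathbb{R})\to\mathrm{Isom}(\mathbb{H}^{\infty})$, where $t\in(0,1)$, with the following properties: 1. The action $\rho_t$ is non-elementary and has no nontrivial closed totally geodesic invariant subspace. 2. There exists a $\rho_t$-equivariant harmonic map $f_t:\Delta\to\mathbb{H}^{\infty}$ whose image is a minimal surface with curvature $\frac{-2}{t(t+1)}$.
   Context: Let $\mathscr{H}$ be a separable infinite dimensional real Hilbert space, $u\in\mathscr{H}$ a unit vector, and $B(v_1+t_1u,v_2+t_2u)=t_1t_2-\langle v_1,v_2\rangle$ for $v_i\perp u$, $t_i\in\mathbb{R}$. Then $\mathbb{H}^{\infty}=\{v\in\mathscr{H}: B(v,v)=1,\ B(v,u)>0\}$ with distance $\cosh d(x,y)=B(x,y)$ and the corresponding Riemannian metric of constant curvature $-1$; $\partial\mathbb{H}^\infty$ is its boundary at infinity and $\mathrm{Isom}(\mathbb{H}^{\infty})$ its isometry group. A closed totally geodesic subspace is a nonempty intersection of $\mathbb{H}^\infty$ with a closed linear subspace of $\mathscr{H}$; it is nontrivial if different from $\mathbb{H}^{\infty}$. An isometric action on $\mathbb{H}^{\infty}$ is elementary if it fixes (i.e. leaves invariant) a geodesic in $\mathbb{H}^{\infty}$ or fixes a point in $\mathbb{H}^{\infty}\cup\partial\mathbb{H}^{\infty}$; non-elementary otherwise. $\Delta$ is the unit disc in $\mathbb{C}$ with its hyperbolic metric, on which $\mathrm{PSL}_2(\mathbb{R})$ acts by conjugating the homographic action on the upper half plane by $z\mapsto\frac{z-i}{z+i}$.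 A smooth map $f:M\to N$ between Riemannian manifolds ($N$ possibly modelled on a Hilbert space) is harmonic if its tension field $\tau(f)=\sum_i\nabla df(e_i,e_i)$ vanishes, where $(e_i)$ is a local orthonormal frame of $TM$ and $\nabla$ is the connection on $T^*M\otimes f^*TN$ induced by the Levi-Civita connections. *)

theory Defs
  imports "HOL-Analysis.Analysis" "HOL-Algebra.Coset" "HOL-Algebra.Bij"
begin

section \<open>The hyperboloid model\<close>

text \<open>
  The ambient Hilbert space is a type \<open>'h\<close> of sort \<open>{real_inner, complete_space}\<close> and
  \<open>u\<close> is a unit vector. The orthogonal decomposition of a vector is
  \<open>x = (x - (x \<bullet> u) u) + (x \<bullet> u) u\<close>.
\<close>

definition infinite_dimensional :: "'h::real_vector set \<Rightarrow> bool" where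
  "infinite_dimensional V \<longleftrightarrow> \<not> (\<exists>S. finite S \<and> V \<subseteq> span S)"

definition lor :: "'h::real_inner \<Rightarrow> 'h \<Rightarrow> 'h \<Rightarrow> real" where
  "lor u x y = (x \<bullet> u) * (y \<bullet> u) - (x - (x \<bullet> u) *\<^sub>R u) \<bullet> (y - (y \<bullet> u) *\<^sub>R u)"

definition hinf :: "'h::real_inner \<Rightarrow> 'h set" where
  "hinf u = {v. lor u v v = 1 \<and> lor u v u > 0}"

definition hdist :: "'h::real_inner \<Rightarrow> 'h \<Rightarrow> 'h \<Rightarrow> real" where
  "hdist u x y = arcosh (lor u x y)"

definition isom_group :: "'h::real_inner \<Rightarrow> ('h \<Rightarrow> 'h) monoid" where
  "isom_group u = (BijGroup (hinf u))
     \<lparr>carrier := {\<phi> \<in> Bij (hinf u). \<forall>x\<in>hinf u. \<forall>y\<in>hinf u. hdist u (\<phi> x) (\<phi> y) = hdist u x y}\<rparr>"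

definition closed_totally_geodesic :: "'h::real_inner \<Rightarrow> 'h set \<Rightarrow> bool" where
  "closed_totally_geodesic u T \<longleftrightarrow>
     T \<noteq> {} \<and> (\<exists>W. subspace W \<and> closed W \<and> T = hinf u \<inter> W)"


section \<open>Geodesics, boundary at infinity, elementary actions\<close>

definition geodesic_line :: "'h::real_inner \<Rightarrow> 'h set \<Rightarrow> bool" where
  "geodesic_line u L \<longleftrightarrow>
     (\<exists>\<gamma> :: real \<Rightarrow> 'h. range \<gamma> = L \<and> L \<subseteq> hinf u \<and> (\<forall>s t. hdist u (\<gamma> s) (\<gamma> t) = \<bar>s - t\<bar>))"

definition geodesic_ray :: "'h::real_inner \<Rightarrow> (real \<Rightarrow> 'h) \<Rightarrow> bool" where
  "geodesic_ray u r \<longleftrightarrow>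
     (\<forall>s\<ge>0. r s \<in> hinf u) \<and> (\<forall>s\<ge>0. \<forall>t\<ge>0. hdist u (r s) (r t) = \<bar>s - t\<bar>)"

definition asymptotic :: "'h::real_inner \<Rightarrow> ((real \<Rightarrow> 'h) \<times> (real \<Rightarrow> 'h)) set" where
  "asymptotic u = {(r, r'). geodesic_ray u r \<and> geodesic_ray u r' \<and>
                            (\<exists>C. \<forall>s\<ge>0. hdist u (r s) (r' s) \<le> C)}"

definition boundary_at_infinity :: "'h::real_inner \<Rightarrow> (real \<Rightarrow> 'h) set set" where
  "boundary_at_infinity u = Collect (geodesic_ray u) // asymptotic u"

text \<open>
  The relational image passes from the rays \<open>\<phi> \<circ> r\<close> back to a full asymptoty class; this is
  needed because rays are functions on all of \<open>real\<close>, with arbitrary values at negative reals.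
\<close>

definition boundary_map ::
  "'h::real_inner \<Rightarrow> ('h \<Rightarrow> 'h) \<Rightarrow> (real \<Rightarrow> 'h) set \<Rightarrow> (real \<Rightarrow> 'h) set" where
  "boundary_map u \<phi> \<xi> = asymptotic u `` ((\<lambda>r. \<phi> \<circ> r) ` \<xi>)"

definition elementary ::
  "'h::real_inner \<Rightarrow> ('g, 'm) monoid_scheme \<Rightarrow> ('g \<Rightarrow> 'h \<Rightarrow> 'h) \<Rightarrow> bool" where
  "elementary u G \<rho> \<longleftrightarrow>
     (\<exists>L. geodesic_line u L \<and> (\<forall>g\<in>carrier G. \<rho> g ` L = L)) \<or>
     (\<exists>x\<in>hinf u. \<forall>g\<in>carrier G. \<rho> g x = x) \<or>
     (\<exists>\<xi>\<in>boundary_at_infinity u. \<forall>g\<in>carrier G. boundary_map u (\<rho> g) \<xi> = \<xi>)"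


section \<open>The group PSL(2,R) and its action on the disc\<close>

definition SL2R :: "(real^2^2) monoid" where
  "SL2R = \<lparr>carrier = {A. det A = 1}, mult = (\<lambda>A B. A ** B), one = mat 1\<rparr>"

definition PSL2R :: "(real^2^2) set monoid" where
  "PSL2R = SL2R Mod {mat 1, - mat 1}"

definition homography :: "real^2^2 \<Rightarrow> complex \<Rightarrow> complex" where
  "homography A z =
     (of_real (A$1$1) * z + of_real (A$1$2)) / (of_real (A$2$1) * z + of_real (A$2$2))"

definition cayley :: "complex \<Rightarrow> complex" where
  "cayley z = (z - \<i>) / (z + \<i>)"

abbreviation unit_disc :: "complex set" where
  "unit_disc \<equiv> ball 0 1"

definition disc_action :: "real^2^2 \<Rightarrow> complex \<Rightarrow> complex" where
  "disc_action A w = cayley (homography A (inv_into {z. 0 < Im z} cayley w))"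

text \<open>
  Elements of \<open>PSL2R\<close> are cosets \<open>{A, -A}\<close>, and both representatives act in the same way.
\<close>

definition equivariant :: "((real^2^2) set \<Rightarrow> 'h \<Rightarrow> 'h) \<Rightarrow> (complex \<Rightarrow> 'h) \<Rightarrow> bool" where
  "equivariant \<rho> f \<longleftrightarrow>
     (\<forall>g\<in>carrier PSL2R. \<forall>A\<in>g. \<forall>z\<in>unit_disc. f (disc_action A z) = \<rho> g (f z))"


section \<open>Riemannian metrics on open subsets of a Euclidean space\<close>

primrec Ck_on :: "nat \<Rightarrow> ('m::euclidean_space \<Rightarrow> 'n::real_normed_vector) \<Rightarrow> 'm set \<Rightarrow> bool" where
  "Ck_on 0 f U \<longleftrightarrow> continuous_on U f"
| "Ck_on (Suc k) f U \<longleftrightarrow>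
     (\<forall>x\<in>U. f differentiable (at x)) \<and> (\<forall>v. Ck_on k (\<lambda>x. frechet_derivative f (at x) v) U)"

definition smooth_on :: "('m::euclidean_space \<Rightarrow> 'n::real_normed_vector) \<Rightarrow> 'm set \<Rightarrow> bool" where
  "smooth_on f U \<longleftrightarrow> (\<forall>k. Ck_on k f U)"

text \<open>\<open>g x v w\<close> is the scalar product of the tangent vectors \<open>v\<close> and \<open>w\<close> at the point \<open>x\<close>.\<close>

type_synonym 'm metric_tensor = "'m \<Rightarrow> 'm \<Rightarrow> 'm \<Rightarrow> real"

text \<open>
  \<open>christoffel g x v w\<close> is the Levi-Civita derivative at \<open>x\<close>, in the direction \<open>v\<close>, of the
  constant vector field \<open>w\<close>. It is given by the Koszul formula, in which all brackets vanish
  because the fields are constant.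
\<close>

definition christoffel :: "'m::euclidean_space metric_tensor \<Rightarrow> 'm \<Rightarrow> 'm \<Rightarrow> 'm \<Rightarrow> 'm" where
  "christoffel g x v w = (THE c. \<forall>z. 2 * g x c z =
       frechet_derivative (\<lambda>y. g y w z) (at x) v
     + frechet_derivative (\<lambda>y. g y v z) (at x) w
     - frechet_derivative (\<lambda>y. g y v w) (at x) z)"

text \<open>\<open>curvature_tensor g x v w z\<close> is \<open>\<nabla>\<^sub>v \<nabla>\<^sub>w z - \<nabla>\<^sub>w \<nabla>\<^sub>v z\<close> for constant vector fields.\<close>

definition curvature_tensor ::
  "'m::euclidean_space metric_tensor \<Rightarrow> 'm \<Rightarrow> 'm \<Rightarrow> 'm \<Rightarrow> 'm \<Rightarrow> 'm" where
  "curvature_tensor g x v w z =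
     (frechet_derivative (\<lambda>y. christoffel g y w z) (at x) v
        + christoffel g x v (christoffel g x w z))
   - (frechet_derivative (\<lambda>y. christoffel g y v z) (at x) w
        + christoffel g x w (christoffel g x v z))"

definition sectional_curvature ::
  "'m::euclidean_space metric_tensor \<Rightarrow> 'm \<Rightarrow> 'm \<Rightarrow> 'm \<Rightarrow> real" where
  "sectional_curvature g x v w =
     g x (curvature_tensor g x v w w) v / (g x v v * g x w w - (g x v w)\<^sup>2)"

definition gauss_curvature :: "complex metric_tensor \<Rightarrow> complex \<Rightarrow> real" where
  "gauss_curvature g z = sectional_curvature g z 1 \<i>"

definition orthonormal_frame_at :: "'m::euclidean_space metric_tensor \<Rightarrow> 'm \<Rightarrow> 'm set \<Rightarrow> bool" where
  "orthonormal_frame_at g x E \<longleftrightarrow>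
     finite E \<and> card E = DIM('m) \<and>
     (\<forall>e\<in>E. \<forall>e'\<in>E. g x e e' = (if e = e' then 1 else 0))"

definition metric_trace ::
  "'m::euclidean_space metric_tensor \<Rightarrow> 'm \<Rightarrow> ('m \<Rightarrow> 'm \<Rightarrow> 'n::real_vector) \<Rightarrow> 'n" where
  "metric_trace g x Q = (\<Sum>e\<in>(SOME E. orthonormal_frame_at g x E). Q e e)"

definition disc_metric :: "complex metric_tensor" where
  "disc_metric z v w = 4 * (v \<bullet> w) / (1 - (norm z)\<^sup>2)\<^sup>2"


section \<open>Maps into the hyperboloid\<close>

text \<open>
  The Riemannian metric of \<open>hinf u\<close> is \<open>- lor u\<close> on the tangent space
  \<open>{v. lor u x v = 0}\<close> at \<open>x\<close>. Maps into \<open>hinf u\<close> are smooth iff they are smooth as maps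
  into the ambient space.
\<close>

definition hmetric :: "'h::real_inner \<Rightarrow> 'h \<Rightarrow> 'h \<Rightarrow> real" where
  "hmetric u v w = - lor u v w"

text \<open>
  \<open>pullback_conn u f V x v\<close> is the derivative at \<open>x\<close>, in the direction \<open>v\<close>, of a vector field
  \<open>V\<close> along \<open>f\<close>, for the connection induced by the Levi-Civita connection of \<open>hinf u\<close>. The
  latter is the flat derivative of the ambient space followed by the \<open>lor u\<close>-orthogonal
  projection onto the tangent space; the lemmas below show that this is tangent to \<open>hinf u\<close>,
  metric and torsion-free.
\<close>

definition pullback_conn ::
  "'h::real_inner \<Rightarrow> ('m::real_normed_vector \<Rightarrow> 'h) \<Rightarrow> ('m \<Rightarrow> 'h) \<Rightarrow> 'm \<Rightarrow> 'm \<Rightarrow> 'h" where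
  "pullback_conn u f V x v =
     frechet_derivative V (at x) v - lor u (f x) (frechet_derivative V (at x) v) *\<^sub>R f x"

lemma bounded_bilinear_lor: "bounded_bilinear (lor u)"
proof -
  have b: "bounded_linear (\<lambda>x. x - (x \<bullet> u) *\<^sub>R u)"
    by (intro bounded_linear_sub bounded_linear_ident
        bounded_linear_compose[OF bounded_linear_scaleR_left bounded_linear_inner_left])
  have 1: "bounded_bilinear (\<lambda>x y. (x \<bullet> u) * (y \<bullet> u))"
    using bounded_bilinear.comp[OF bounded_bilinear_mult bounded_linear_inner_left
        bounded_linear_inner_left] .
  have 2: "bounded_bilinear (\<lambda>x y. (x - (x \<bullet> u) *\<^sub>R u) \<bullet> (y - (y \<bullet> u) *\<^sub>R u))"
    using bounded_bilinear.comp[OF bounded_bilinear_inner b b] .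
  interpret f: bounded_bilinear "\<lambda>x y. (x \<bullet> u) * (y \<bullet> u)" by (rule 1)
  interpret g: bounded_bilinear "\<lambda>x y. (x - (x \<bullet> u) *\<^sub>R u) \<bullet> (y - (y \<bullet> u) *\<^sub>R u)" by (rule 2)
  obtain K where K: "\<And>a b. norm ((a \<bullet> u) * (b \<bullet> u)) \<le> norm a * norm b * K"
    using f.bounded by blast
  obtain L where L: "\<And>a b. norm ((a - (a \<bullet> u) *\<^sub>R u) \<bullet> (b - (b \<bullet> u) *\<^sub>R u)) \<le> norm a * norm b * L"
    using g.bounded by blast
  show ?thesis
  proof
    show "\<exists>K. \<forall>a b. norm (lor u a b) \<le> norm a * norm b * K"
    proof (intro exI allI)
      fix a b
      show "norm (lor u a b) \<le> norm a * norm b * (K + L)"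
        unfolding lor_def distrib_left
        by (rule order_trans[OF norm_triangle_ineq4 add_mono[OF K L]])
    qed
  qed (simp_all add: lor_def algebra_simps inner_simps)
qed

lemma lor_commute: "lor u x y = lor u y x"
  by (simp add: lor_def inner_commute mult.commute)

lemma pullback_conn_tangent:
  assumes "f x \<in> hinf u"
  shows "lor u (f x) (pullback_conn u f V x v) = 0"
proof -
  interpret bounded_bilinear "lor u" by (rule bounded_bilinear_lor)
  show ?thesis using assms by (simp add: pullback_conn_def diff_right scaleR_right hinf_def)
qed

lemma pullback_conn_metric:
  assumes V: "V differentiable (at x)" and W: "W differentiable (at x)"
    and tV: "lor u (f x) (V x) = 0" and tW: "lor u (f x) (W x) = 0"
  shows "frechet_derivative (\<lambda>y. hmetric u (V y) (W y)) (at x) v =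
         hmetric u (pullback_conn u f V x v) (W x) + hmetric u (V x) (pullback_conn u f W x v)"
proof -
  interpret bounded_bilinear "lor u" by (rule bounded_bilinear_lor)
  have "((\<lambda>y. hmetric u (V y) (W y)) has_derivative
        (\<lambda>h. - (lor u (V x) (frechet_derivative W (at x) h)
              + lor u (frechet_derivative V (at x) h) (W x)))) (at x)"
    unfolding hmetric_def
    by (intro has_derivative_minus FDERIV) (use V W frechet_derivative_works in blast)+
  from frechet_derivative_at[OF this, symmetric] show ?thesis
    using tV tW
    by (simp add: hmetric_def pullback_conn_def diff_left diff_right scaleR_left scaleR_right
        lor_commute[of u "V x" "f x"])
qed

text \<open>
  Here \<open>X\<close> and \<open>Y\<close> are local extensions to the ambient space of vector fields tangent to
  \<open>hinf u\<close>, and the right-hand side is their Lie bracket.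
\<close>

lemma pullback_conn_torsion_free:
  assumes X: "X differentiable (at p)" and Y: "Y differentiable (at p)"
    and tX: "\<forall>\<^sub>F q in nhds p. lor u q (X q) = 0" and tY: "\<forall>\<^sub>F q in nhds p. lor u q (Y q) = 0"
  shows "pullback_conn u (\<lambda>q. q) Y p (X p) - pullback_conn u (\<lambda>q. q) X p (Y p) =
         frechet_derivative Y (at p) (X p) - frechet_derivative X (at p) (Y p)"
proof -
  interpret bounded_bilinear "lor u" by (rule bounded_bilinear_lor)
  have key: "lor u p (frechet_derivative Z (at p) h) = - lor u h (Z p)"
    if Z: "Z differentiable (at p)" and t: "\<forall>\<^sub>F q in nhds p. lor u q (Z q) = 0" for Z h
  proof -
    have 1: "((\<lambda>q. lor u q (Z q)) has_derivative
          (\<lambda>h. lor u p (frechet_derivative Z (at p) h) + lor u h (Z p))) (at p)"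
      by (intro FDERIV has_derivative_ident) (use Z frechet_derivative_works in blast)
    obtain S where S: "open S" "p \<in> S" "\<And>q. q \<in> S \<Longrightarrow> lor u q (Z q) = 0"
      using t unfolding eventually_nhds by blast
    have "((\<lambda>q. lor u q (Z q)) has_derivative (\<lambda>h. 0)) (at p)"
      by (rule has_derivative_transform_within_open[OF has_derivative_const S(1,2)])
         (simp add: S(3))
    from has_derivative_unique[OF 1 this] show ?thesis
      by (metis add_eq_0_iff2)
  qed
  show ?thesis
    by (simp add: pullback_conn_def key[OF X tX] key[OF Y tY] lor_commute[of u "Y p" "X p"])
qed

text \<open>
  \<open>nabla_df u g f x v w\<close> is \<open>\<nabla>df(v,w)\<close>, computed by extending \<open>w\<close> to a constant vector field.
\<close>

definition nabla_df ::
  "'h::real_inner \<Rightarrow> 'm::euclidean_space metric_tensor \<Rightarrow> ('m \<Rightarrow> 'h) \<Rightarrow> 'm \<Rightarrow> 'm \<Rightarrow> 'm \<Rightarrow> 'h" where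
  "nabla_df u g f x v w =
     pullback_conn u f (\<lambda>y. frechet_derivative f (at y) w) x v
   - frechet_derivative f (at x) (christoffel g x v w)"

definition tension_field ::
  "'h::real_inner \<Rightarrow> 'm::euclidean_space metric_tensor \<Rightarrow> ('m \<Rightarrow> 'h) \<Rightarrow> 'm \<Rightarrow> 'h" where
  "tension_field u g f x = metric_trace g x (nabla_df u g f x)"

definition harmonic_map ::
  "'h::real_inner \<Rightarrow> 'm::euclidean_space metric_tensor \<Rightarrow> 'm set \<Rightarrow> ('m \<Rightarrow> 'h) \<Rightarrow> bool" where
  "harmonic_map u g U f \<longleftrightarrow>
     f ` U \<subseteq> hinf u \<and> smooth_on f U \<and> (\<forall>x\<in>U. tension_field u g f x = 0)"


section \<open>Minimal surfaces\<close>

definition induced_metric ::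
  "'h::real_inner \<Rightarrow> ('m::euclidean_space \<Rightarrow> 'h) \<Rightarrow> 'm metric_tensor" where
  "induced_metric u \<phi> x v w =
     hmetric u (frechet_derivative \<phi> (at x) v) (frechet_derivative \<phi> (at x) w)"

text \<open>
  \<open>normal_part u \<phi> x a\<close> is the component of \<open>a\<close> normal to the image of the immersion \<open>\<phi>\<close> at
  \<open>\<phi> x\<close>; the vector \<open>c\<close> is the preimage of the tangential component.
\<close>

definition normal_part ::
  "'h::real_inner \<Rightarrow> ('m::euclidean_space \<Rightarrow> 'h) \<Rightarrow> 'm \<Rightarrow> 'h \<Rightarrow> 'h" where
  "normal_part u \<phi> x a =
     a - frechet_derivative \<phi> (at x)
           (THE c. \<forall>z. induced_metric u \<phi> x c z = hmetric u a (frechet_derivative \<phi> (at x) z))"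

definition second_fundamental_form ::
  "'h::real_inner \<Rightarrow> ('m::euclidean_space \<Rightarrow> 'h) \<Rightarrow> 'm \<Rightarrow> 'm \<Rightarrow> 'm \<Rightarrow> 'h" where
  "second_fundamental_form u \<phi> x v w =
     normal_part u \<phi> x (pullback_conn u \<phi> (\<lambda>y. frechet_derivative \<phi> (at y) w) x v)"

definition mean_curvature ::
  "'h::real_inner \<Rightarrow> ('m::euclidean_space \<Rightarrow> 'h) \<Rightarrow> 'm \<Rightarrow> 'h" where
  "mean_curvature u \<phi> x =
     (1 / real DIM('m)) *\<^sub>R
       metric_trace (induced_metric u \<phi>) x (second_fundamental_form u \<phi> x)"

definition surface_parametrization ::
  "'h::real_inner \<Rightarrow> 'h set \<Rightarrow> complex set \<Rightarrow> (complex \<Rightarrow> 'h) \<Rightarrow> bool" where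
  "surface_parametrization u S U \<phi> \<longleftrightarrow>
     open U \<and> smooth_on \<phi> U \<and> (\<forall>z\<in>U. inj (frechet_derivative \<phi> (at z))) \<and>
     openin (top_of_set S) (\<phi> ` U) \<and> (\<exists>\<psi>. homeomorphism U (\<phi> ` U) \<phi> \<psi>)"

definition minimal_surface_of_curvature :: "'h::real_inner \<Rightarrow> real \<Rightarrow> 'h set \<Rightarrow> bool" where
  "minimal_surface_of_curvature u \<kappa> S \<longleftrightarrow>
     S \<subseteq> hinf u \<and>
     (\<forall>p\<in>S. \<exists>U \<phi>. surface_parametrization u S U \<phi> \<and> p \<in> \<phi> ` U \<and>
        (\<forall>z\<in>U. mean_curvature u \<phi> z = 0 \<and> gauss_curvature (induced_metric u \<phi>) z = \<kappa>))"

end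

theory Submission
  imports Defs
begin

text \<open>
  Let \<open>s = 1 + t\<close>. The powers \<open>P(z, \<zeta>)\<^sup>s\<close> of the Poisson kernel
  \<open>P(z, \<zeta>) = (1 - |z|\<^sup>2) / |1 - z cnj \<zeta>|\<^sup>2\<close> span a space of functions of \<open>\<zeta>\<close> on the unit circle on
  which \<open>PSL(2,R)\<close> acts by a spherical principal series representation, the orbit of the constant
  function being the set of all these powers. The representation preserves a quadratic form that is
  diagonal in the Fourier basis: its value on the Fourier modes \<open>n\<close> and \<open>- n\<close> is
  \<open>lam n = (\<Prod>k<n. (k - t) / (k + 1 + t))\<close>. For \<open>0 < t < 1\<close> the factor with \<open>k = 0\<close> is the only
  negative one, so the form is positive on constants and negative on all other modes: it has the
  signature of the hyperboloid model. This is the one parameter family of representations, and the map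
  sending \<open>z\<close> to \<open>P(z, \<cdot>)\<^sup>s\<close> is the equivariant map. As a function of \<open>z\<close>, \<open>P(z, \<zeta>)\<^sup>s\<close> is an
  eigenfunction of the hyperbolic Laplacian with eigenvalue \<open>s (s - 1) = t (t + 1)\<close>, and everything about
  the surface follows from this.

  The circle does not appear in the proof. The map \<open>F\<close> is given by the Fourier coefficients \<open>c n z\<close> of
  \<open>P(z, \<cdot>)\<^sup>s\<close>, rescaled by the square roots of \<open>|lam n|\<close> and placed in an orthonormal basis \<open>e\<close> of the
  Hilbert space with \<open>e 0 = u\<close>. The coefficients satisfy a first order system in \<open>z\<close> with shifts of \<open>n\<close>
  (\<open>c_wirtinger\<close>), and two facts are read off from it. Applied twice, it gives the Laplace equation
  \<open>laplace_F\<close>. Along the vector field \<open>1 - z\<^sup>2\<close> generating the translations of the disc it gives a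
  telescoping sum, which shows that the kernel \<open>lor u (F z) (F w)\<close> is invariant under translations
  (\<open>lor_translate\<close>); invariance under rotations is clear, and together they generate the group
  (\<open>lor_mob\<close>).

  An invariant kernel yields the representation: the values of \<open>F\<close> span a dense subspace
  (\<open>dense_F\<close>), and a permutation of these values that preserves \<open>lor u\<close> extends to a bounded
  operator (\<open>lorentz_extension\<close>). Averaging over rotations projects onto the line of \<open>u\<close>
  (\<open>avg_tendsto\<close>), so a closed invariant subspace that meets the hyperboloid contains \<open>u\<close>, hence its
  orbit, which is the image of \<open>F\<close>, hence everything. This is irreducibility, and it also excludes
  invariant geodesics, which lie in planes. A fixed point, or the null direction of a fixed boundary point,
  would be a rotation invariant vector and therefore a multiple of \<open>u\<close>, which is absurd in both cases.

  Since \<open>F\<close> takes values in the hyperboloid, the eigenvalue equation says that the Laplacian of \<open>F\<close> is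
  normal to the hyperboloid, which is harmonicity. An element of order four in the stabilizer of
  \<open>z\<close> rotates the tangent plane by a right angle and is realised by an isometry, so \<open>F\<close> is
  conformal; the eigenvalue determines the factor, and the induced metric is \<open>t (t + 1) / 2\<close> times the
  hyperbolic metric. A conformal harmonic map of a surface is minimal, and scaling the metric of
  curvature \<open>-1\<close> gives the curvature \<open>- 2 / (t (t + 1))\<close>.
\<close>

section \<open>Orthonormal sequences and closed spans\<close>

lemma inner_projection_orthonormal:
  assumes "finite E" "\<And>x. x \<in> E \<Longrightarrow> norm x = 1" "pairwise orthogonal E" "e \<in> E"
  shows "(a - (\<Sum>b\<in>E. (a \<bullet> b) *\<^sub>R b)) \<bullet> e = 0"
proof -
  have "(\<Sum>b\<in>E. (a \<bullet> b) *\<^sub>R b) \<bullet> e = (\<Sum>b\<in>E. if b = e then a \<bullet> e else 0)"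
    unfolding inner_sum_left
  proof (rule sum.cong)
    fix b assume "b \<in> E"
    then show "(a \<bullet> b) *\<^sub>R b \<bullet> e = (if b = e then a \<bullet> e else 0)"
      using assms(2)[OF assms(4)] assms(3,4)
      by (auto simp: pairwise_def orthogonal_def dot_square_norm)
  qed simp
  then show ?thesis using assms(1,4) by (simp add: inner_diff_left)
qed

lemma orthonormal_extend:
  assumes E: "finite E" "\<And>x. x \<in> E \<Longrightarrow> norm x = 1" "pairwise orthogonal E" and z: "z \<notin> span E"
  obtains y where "norm y = 1" "\<And>x. x \<in> E \<Longrightarrow> orthogonal x y" "z \<in> span (insert y E)"
proof -
  define p where "p = (\<Sum>b\<in>E. (z \<bullet> b) *\<^sub>R b)"
  define w where "w = z - p"
  have p: "p \<in> span E" unfolding p_def by (intro span_sum span_scale span_base)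
  have w0: "w \<noteq> 0" using p z unfolding w_def by auto
  show thesis
  proof (rule that[of "w /\<^sub>R norm w"])
    show "norm (w /\<^sub>R norm w) = 1" using w0 by simp
    show "orthogonal x (w /\<^sub>R norm w)" if "x \<in> E" for x
      using inner_projection_orthonormal[OF E that, of z]
      by (simp add: orthogonal_def w_def p_def inner_commute)
    have "w \<in> span (insert (w /\<^sub>R norm w) E)"
      using span_scale[OF span_base[of "w /\<^sub>R norm w" "insert (w /\<^sub>R norm w) E"], of "norm w"] w0
      by simp
    moreover have "p \<in> span (insert (w /\<^sub>R norm w) E)"
      using p span_mono[of E "insert (w /\<^sub>R norm w) E"] by blast
    ultimately have "w + p \<in> span (insert (w /\<^sub>R norm w) E)" by (rule span_add)
    then show "z \<in> span (insert (w /\<^sub>R norm w) E)" by (simp add: w_def)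
  qed
qed

text \<open>
  Gram-Schmidt along a dense sequence \<open>d\<close>. At each step a vector outside the current span is orthonormalised:
  the next \<open>d n\<close> if it is new, and otherwise an arbitrary one, which exists because the dimension is
  infinite. So no step stalls, and \<open>d n\<close> lies in the span after step \<open>n\<close>.
\<close>

lemma orthonormal_sequence_exists:
  fixes u :: "'h::real_inner"
  assumes sep: "separable_space (euclidean :: 'h topology)"
    and inf: "infinite_dimensional (UNIV :: 'h set)"
    and u: "norm u = 1"
  obtains e :: "nat \<Rightarrow> 'h" where "e 0 = u" "\<And>i j. e i \<bullet> e j = (if i = j then 1 else 0)"
    "closure (span (range e)) = UNIV"
proof -
  obtain C where C: "countable C" "closure C = (UNIV :: 'h set)"
    using sep unfolding separable_space_def by (auto simp: euclidean_closure_of)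
  have "C \<noteq> {}" using C(2) by auto
  define d where "d = from_nat_into C"
  have d: "range d = C" using range_from_nat_into[OF \<open>C \<noteq> {}\<close> C(1)] by (simp add: d_def)
  define ok where "ok E \<longleftrightarrow> finite E \<and> (\<forall>x\<in>E. norm x = 1) \<and> pairwise orthogonal E" for E :: "'h set"
  have step: "\<exists>y. ok (insert y E) \<and> norm y = 1 \<and> (\<forall>x\<in>E. orthogonal x y) \<and> d n \<in> span (insert y E)"
    if "ok E" for E n
  proof -
    have E: "finite E" "\<And>x. x \<in> E \<Longrightarrow> norm x = 1" "pairwise orthogonal E"
      using that by (auto simp: ok_def)
    obtain z where z: "z \<notin> span E" "d n \<in> span E \<or> z = d n"
      using inf E(1) unfolding infinite_dimensional_def by blast
    obtain y where y: "norm y = 1" "\<And>x. x \<in> E \<Longrightarrow> orthogonal x y" "z \<in> span (insert y E)"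
      using orthonormal_extend[OF E z(1)] by metis
    have "d n \<in> span (insert y E)" using z(2) y(3) span_mono[of E "insert y E"] by blast
    moreover have "ok (insert y E)"
      using E y(1,2) by (auto simp: ok_def pairwise_insert orthogonal_commute)
    ultimately show ?thesis using y by blast
  qed
  have "\<exists>f. \<forall>n::nat. (case f n of (E, y) \<Rightarrow> ok E \<and> y \<in> E \<and> (n = 0 \<longrightarrow> E = {u} \<and> y = u)) \<and>
      (case f n of (E, y) \<Rightarrow> case f (Suc n) of (E', y') \<Rightarrow> E' = insert y' E \<and> norm y' = 1 \<and>
          (\<forall>x\<in>E. orthogonal x y') \<and> d n \<in> span E')"
  proof (rule dependent_nat_choice)
    show "\<exists>x. case x of (E, y) \<Rightarrow> ok E \<and> y \<in> E \<and> (0 = (0::nat) \<longrightarrow> E = {u} \<and> y = u)"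
      by (rule exI[of _ "({u}, u)"]) (simp add: ok_def u)
    fix x :: "'h set \<times> 'h" and n :: nat
    assume "case x of (E, y) \<Rightarrow> ok E \<and> y \<in> E \<and> (n = 0 \<longrightarrow> E = {u} \<and> y = u)"
    then obtain E y where x: "x = (E, y)" "ok E" by (auto split: prod.splits)
    from step[OF x(2), of n] obtain y' where "ok (insert y' E)" "norm y' = 1"
      "\<forall>x\<in>E. orthogonal x y'" "d n \<in> span (insert y' E)" by blast
    then show "\<exists>y. (case y of (E, y) \<Rightarrow> ok E \<and> y \<in> E \<and> (Suc n = 0 \<longrightarrow> E = {u} \<and> y = u)) \<and>
        (case x of (E, ya) \<Rightarrow> case y of (E', y') \<Rightarrow> E' = insert y' E \<and> norm y' = 1 \<and>
          (\<forall>x\<in>E. orthogonal x y') \<and> d n \<in> span E')"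
      by (intro exI[of _ "(insert y' E, y')"]) (simp add: x)
  qed
  then obtain f where f: "\<forall>n. (case f n of (E, y) \<Rightarrow> ok E \<and> y \<in> E \<and> (n = 0 \<longrightarrow> E = {u} \<and> y = u)) \<and>
      (case f n of (E, y) \<Rightarrow> case f (Suc n) of (E', y') \<Rightarrow> E' = insert y' E \<and> norm y' = 1 \<and>
          (\<forall>x\<in>E. orthogonal x y') \<and> d n \<in> span E')" ..
  define e where "e n = snd (f n)" for n
  define A where "A n = fst (f n)" for n
  have A0: "A 0 = {u}" "e 0 = u" using f[rule_format, of 0] by (auto simp: A_def e_def split: prod.splits)
  have AS: "A (Suc n) = insert (e (Suc n)) (A n)" "norm (e (Suc n)) = 1"
      "\<And>x. x \<in> A n \<Longrightarrow> orthogonal x (e (Suc n))" "d n \<in> span (A (Suc n))" for n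
    using f[rule_format, of n] by (auto simp: A_def e_def split: prod.splits)
  have Ae: "A n = e ` {..n}" for n
    by (induction n) (simp_all add: A0 AS(1) atMost_Suc)
  have n1: "e i \<bullet> e i = 1" for i
    using AS(2)[of "i - 1"] A0(2) u by (cases i) (simp_all add: dot_square_norm)
  have lt: "e i \<bullet> e j = 0" if "i < j" for i j
  proof -
    from that have k: "j = Suc (j - 1)" by simp
    have "e i \<in> A (j - 1)" using that by (auto simp: Ae)
    then have "orthogonal (e i) (e (Suc (j - 1)))" by (rule AS(3))
    then show ?thesis using k by (simp add: orthogonal_def)
  qed
  have "C \<subseteq> span (range e)"
  proof
    fix c assume "c \<in> C"
    then obtain n where "c = d n" using d by blast
    then have "c \<in> span (e ` {..Suc n})" using AS(4)[of n] by (simp add: Ae)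
    then show "c \<in> span (range e)" using span_mono[of "e ` {..Suc n}" "range e"] by blast
  qed
  then have "closure (span (range e)) = UNIV" using closure_mono C(2) by blast
  moreover have "e i \<bullet> e j = (if i = j then 1 else 0)" for i j
    using n1[of i] lt[of i j] lt[of j i] by (cases i j rule: linorder_cases) (auto simp: inner_commute)
  ultimately show thesis using that A0(2) by blast
qed

text \<open>
  The span is the zero set of the continuous map \<open>x \<mapsto> x - proj x\<close>, for the orthogonal projection given by
  an orthonormal basis of it.
\<close>

lemma span_finite_closed:
  fixes S :: "'h::real_inner set"
  assumes "finite S"
  shows "closed (span S)"
proof -
  have "\<exists>E. finite E \<and> (\<forall>x\<in>E. norm x = 1) \<and> pairwise orthogonal E \<and> span E = span S"
    using assms
  proof (induction S)
    case empty
    show ?case by (rule exI[of _ "{}"]) (simp add: pairwise_def)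
  next
    case (insert a S)
    then obtain E where E: "finite E" "\<And>x. x \<in> E \<Longrightarrow> norm x = 1" "pairwise orthogonal E" "span E = span S"
      by blast
    show ?case
    proof (cases "a \<in> span E")
      case True
      then have "span E = span (insert a S)" using E(4) by (metis span_redundant)
      then show ?thesis using E(1-3) by blast
    next
      case False
      obtain y where y: "norm y = 1" "\<And>x. x \<in> E \<Longrightarrow> orthogonal x y" "a \<in> span (insert y E)"
        using orthonormal_extend[OF E(1-3) False] by metis
      have "y \<in> span (insert a E)" using in_span_insert[OF y(3) False] .
      then have "span (insert y E) \<subseteq> span (insert a E)" "span (insert a E) \<subseteq> span (insert y E)"
        using y(3) span_superset[of "insert y E"] span_superset[of "insert a E"]
        by (intro span_minimal subspace_span; blast)+
      then have "span (insert y E) = span (insert a E)" by (rule equalityI)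
      also have "\<dots> = span (insert a S)" using E(4) by (simp add: span_insert)
      finally have "span (insert y E) = span (insert a S)" .
      moreover have "pairwise orthogonal (insert y E)"
        using E(3) y(2) by (simp add: pairwise_insert orthogonal_commute)
      ultimately show ?thesis using E(1,2) y(1) by (metis finite_insert insertE)
    qed
  qed
  then obtain E where E: "finite E" "\<And>x. x \<in> E \<Longrightarrow> norm x = 1" "pairwise orthogonal E" "span E = span S"
    by blast
  have "span E = {x. x - (\<Sum>b\<in>E. (x \<bullet> b) *\<^sub>R b) = 0}"
  proof (rule equalityI; rule subsetI)
    fix x assume x: "x \<in> span E"
    define w where "w = x - (\<Sum>b\<in>E. (x \<bullet> b) *\<^sub>R b)"
    have "w \<in> span E" unfolding w_def by (intro span_diff[OF x] span_sum span_scale span_base)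
    moreover have "orthogonal w y" if "y \<in> E" for y
      using inner_projection_orthonormal[OF E(1-3) that, of x] by (simp add: w_def orthogonal_def)
    ultimately have "orthogonal w w" using orthogonal_to_span by blast
    then show "x \<in> {x. x - (\<Sum>b\<in>E. (x \<bullet> b) *\<^sub>R b) = 0}" by (simp add: w_def orthogonal_def)
  next
    fix x assume "x \<in> {x. x - (\<Sum>b\<in>E. (x \<bullet> b) *\<^sub>R b) = 0}"
    then have "x = (\<Sum>b\<in>E. (x \<bullet> b) *\<^sub>R b)" by simp
    then show "x \<in> span E" by (metis (no_types, lifting) span_base span_scale span_sum)
  qed
  moreover have "closed {x. x - (\<Sum>b\<in>E. (x \<bullet> b) *\<^sub>R b) = 0}"
    by (intro closed_Collect_eq continuous_intros)
  ultimately show ?thesis using E(4) by simp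
qed

lemma closure_subspace:
  fixes S :: "'a::real_normed_vector set"
  assumes "subspace S" shows "subspace (closure S)"
  unfolding subspace_def
proof (intro conjI ballI allI)
  show "0 \<in> closure S" using subspace_0[OF assms] closure_subset by blast
  fix x assume x: "x \<in> closure S"
  then obtain X where X: "\<forall>n. X n \<in> S" "X \<longlonglongrightarrow> x" unfolding closure_sequential by blast
  {
    fix y assume "y \<in> closure S"
    then obtain Y where Y: "\<forall>n. Y n \<in> S" "Y \<longlonglongrightarrow> y" unfolding closure_sequential by blast
    have "\<forall>n. X n + Y n \<in> S" using X(1) Y(1) subspace_add[OF assms] by blast
    then show "x + y \<in> closure S" unfolding closure_sequential
      using tendsto_add[OF X(2) Y(2)] by (intro exI[of _ "\<lambda>n. X n + Y n"]) simp
  next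
    fix r :: real
    have "\<forall>n. r *\<^sub>R X n \<in> S" using X(1) subspace_scale[OF assms] by blast
    then show "r *\<^sub>R x \<in> closure S"
      unfolding closure_sequential using tendsto_scaleR[OF tendsto_const X(2)]
      by (intro exI[of _ "\<lambda>n. r *\<^sub>R X n"]) simp
  }
qed

lemma closed_span_eq_if_bounded_linear_agree:
  fixes f g :: "'a::real_normed_vector \<Rightarrow> 'b::real_normed_vector"
  assumes "bounded_linear f" "bounded_linear g" "closure (span S) = UNIV" "\<And>x. x \<in> S \<Longrightarrow> f x = g x"
  shows "f = g"
proof
  fix x
  interpret f: bounded_linear f by fact
  interpret g: bounded_linear g by fact
  have "closed {x. f x = g x}"
    by (intro closed_Collect_eq f.continuous_on g.continuous_on continuous_on_id)
  moreover have "span S \<subseteq> {x. f x = g x}"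
    using linear_eq_on_span[OF f.linear_axioms g.linear_axioms assms(4)] by blast
  ultimately have "closure (span S) \<subseteq> {x. f x = g x}" by (rule closure_minimal[rotated])
  then show "f x = g x" using assms(3) by blast
qed

section \<open>Lorentz geometry of the hyperboloid\<close>

locale lorentz =
  fixes u :: "'h::{real_inner, complete_space}"
  assumes norm_u: "norm u = 1"
begin

sublocale lor: bounded_bilinear "lor u" by (rule bounded_bilinear_lor)

lemma u_dot_u: "u \<bullet> u = 1" using norm_u by (simp add: dot_square_norm)

lemma lor_eq: "lor u x y = 2 * (x \<bullet> u) * (y \<bullet> u) - x \<bullet> y"
  by (simp add: lor_def inner_diff_left inner_diff_right u_dot_u inner_commute)

lemma lor_u: "lor u x u = x \<bullet> u"
  by (simp add: lor_eq u_dot_u)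

lemma norm_sq_lor: "(norm x)\<^sup>2 = 2 * (x \<bullet> u)\<^sup>2 - lor u x x"
  by (simp add: lor_eq power2_norm_eq_inner) (simp add: power2_eq_square)

lemma hinf_iff: "x \<in> hinf u \<longleftrightarrow> lor u x x = 1 \<and> x \<bullet> u > 0"
  by (simp add: hinf_def lor_u)

lemma u_in_hinf: "u \<in> hinf u" by (simp add: hinf_iff lor_u u_dot_u)

lemma lor_nondegenerate:
  assumes "closure (span S) = UNIV" "\<And>y. y \<in> S \<Longrightarrow> lor u x y = 0"
  shows "x = 0"
proof -
  have "lor u x = (\<lambda>y. 0)"
    by (rule closed_span_eq_if_bounded_linear_agree[OF lor.bounded_linear_right bounded_linear_zero assms])
  then have "lor u x y = 0" for y by metis
  from this[of u] this[of x] have "(norm x)\<^sup>2 = 0" by (simp add: norm_sq_lor lor_u)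
  then show ?thesis by simp
qed

lemma space_part:
  defines "q \<equiv> \<lambda>x. x - (x \<bullet> u) *\<^sub>R u"
  shows "lor u x y = (x \<bullet> u) * (y \<bullet> u) - q x \<bullet> q y" "lor u x x = (x \<bullet> u)\<^sup>2 - (norm (q x))\<^sup>2"
  by (simp_all add: lor_def q_def power2_eq_square[of "_ \<bullet> _"] power2_norm_eq_inner)

lemma lor_ge_1:
  assumes "x \<in> hinf u" "y \<in> hinf u"
  shows "lor u x y \<ge> 1"
proof -
  define p where "p = norm (x - (x \<bullet> u) *\<^sub>R u)"
  define q where "q = norm (y - (y \<bullet> u) *\<^sub>R u)"
  have a: "(x \<bullet> u)\<^sup>2 = 1 + p\<^sup>2" "x \<bullet> u > 0" "p \<ge> 0"
    using assms(1) by (simp_all add: hinf_iff space_part(2) p_def)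
  have b: "(y \<bullet> u)\<^sup>2 = 1 + q\<^sup>2" "y \<bullet> u > 0" "q \<ge> 0"
    using assms(2) by (simp_all add: hinf_iff space_part(2) q_def)
  have "(1 + p * q)\<^sup>2 \<le> ((x \<bullet> u) * (y \<bullet> u))\<^sup>2"
    unfolding power_mult_distrib a b
    using zero_le_power2[of "p - q"] by (simp add: power2_eq_square algebra_simps)
  then have "1 + p * q \<le> (x \<bullet> u) * (y \<bullet> u)"
    by (rule power2_le_imp_le) (use a(2) b(2) in auto)
  moreover have "(x - (x \<bullet> u) *\<^sub>R u) \<bullet> (y - (y \<bullet> u) *\<^sub>R u) \<le> p * q"
    unfolding p_def q_def by (rule norm_cauchy_schwarz)
  ultimately show ?thesis by (simp add: lor_def)
qed

text \<open>
  In coordinates adapted to \<open>u\<close>, orthogonality to a timelike vector and the Cauchy-Schwarz inequality bound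
  the time part of \<open>x\<close> strictly by its space part unless
  \<open>x = 0\<close>.
\<close>

lemma spacelike_if_orthogonal:
  assumes "p \<in> hinf u" "lor u x p = 0" "lor u x x \<ge> 0"
  shows "x = 0"
proof -
  define q where "q z = z - (z \<bullet> u) *\<^sub>R u" for z
  have 1: "(p \<bullet> u)\<^sup>2 = 1 + (norm (q p))\<^sup>2" "p \<bullet> u > 0"
    using assms(1) by (simp_all add: hinf_iff space_part(2) q_def)
  have 2: "(x \<bullet> u) * (p \<bullet> u) = q x \<bullet> q p" using assms(2) by (simp add: space_part(1) q_def)
  have 3: "(norm (q x))\<^sup>2 \<le> (x \<bullet> u)\<^sup>2" using assms(3) by (simp add: space_part(2) q_def)
  have "(x \<bullet> u)\<^sup>2 * (p \<bullet> u)\<^sup>2 \<le> (norm (q x))\<^sup>2 * (norm (q p))\<^sup>2"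
    using Cauchy_Schwarz_ineq[of "q x" "q p"]
    by (simp add: 2[symmetric] power_mult_distrib power2_norm_eq_inner)
  also have "\<dots> \<le> (x \<bullet> u)\<^sup>2 * (norm (q p))\<^sup>2" using 3 by (intro mult_right_mono) auto
  finally have "(x \<bullet> u)\<^sup>2 \<le> 0" unfolding 1 by (simp add: algebra_simps)
  then have "x \<bullet> u = 0" "q x = 0" using 3 by auto
  then show ?thesis by (simp add: q_def)
qed

text \<open>
  The combination with vanishing \<open>u\<close>-component is a null vector with no time part, hence zero.
\<close>

lemma null_vectors_proportional:
  assumes "lor u x x = 0" "lor u y y = 0" "lor u x y = 0"
  shows "(y \<bullet> u) *\<^sub>R x = (x \<bullet> u) *\<^sub>R y"
proof -
  define w where "w = (y \<bullet> u) *\<^sub>R x - (x \<bullet> u) *\<^sub>R y"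
  have "w \<bullet> u = 0" by (simp add: w_def inner_diff_left)
  moreover have "lor u w w = 0"
    using assms by (simp add: w_def lor.diff_left lor.diff_right lor.scaleR_left lor.scaleR_right lor_commute)
  ultimately have "w = 0" using norm_sq_lor[of w] by simp
  then show ?thesis by (simp add: w_def)
qed

lemma lor_isometry_hdist:
  assumes "lor u a b = lor u x y" shows "hdist u a b = hdist u x y"
  using assms by (simp add: hdist_def)

lemma lor_eq_cosh:
  assumes "x \<in> hinf u" "y \<in> hinf u" "hdist u x y = \<bar>s\<bar>"
  shows "lor u x y = cosh s"
  using cosh_arcosh_real[OF lor_ge_1[OF assms(1,2)]] assms(3) by (simp add: hdist_def)

text \<open>
  The step from an invariant kernel to a representation. The linear extension of \<open>\<psi>\<close> from a basis contained
  in \<open>S\<close> agrees with \<open>\<psi>\<close> on all of \<open>S\<close>, because the difference is orthogonal to \<open>\<psi> ` S = S\<close>, and it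
  preserves \<open>lor u\<close>. Such a map is not an isometry for the norm, but the norm is controlled by \<open>lor u\<close>
  and the \<open>u\<close>-component, and the \<open>u\<close>-component of \<open>T x\<close> is \<open>lor u x q\<close> where \<open>\<psi> q = u\<close>; so \<open>T\<close> is
  bounded and extends to the closure.
\<close>

lemma lorentz_extension:
  assumes dense: "closure (span S) = UNIV" and uS: "u \<in> S" and \<psi>S: "\<psi> ` S = S"
    and pres: "\<And>x y. x \<in> S \<Longrightarrow> y \<in> S \<Longrightarrow> lor u (\<psi> x) (\<psi> y) = lor u x y"
  obtains T where "bounded_linear T" "\<And>x. x \<in> S \<Longrightarrow> T x = \<psi> x"
    "\<And>x y. lor u (T x) (T y) = lor u x y"
proof -
  obtain B where B: "B \<subseteq> S" "independent B" "S \<subseteq> span B"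
    using maximal_independent_subset by blast
  have spB: "span B = span S"
    using B by (metis span_eq span_superset subset_trans)
  obtain T where T: "linear T" "\<And>b. b \<in> B \<Longrightarrow> T b = \<psi> b"
    using linear_independent_extend[OF B(2), of \<psi>] by blast
  interpret T: linear T by fact
  have half: "lor u (T x) (\<psi> z) = lor u x z" if "x \<in> span S" "z \<in> S" for x z
  proof -
    have "x \<in> span B" using that spB by simp
    then show ?thesis
    proof (induction rule: span_induct_alt)
      case base show ?case by (simp add: T.zero lor.zero_left)
    next
      case (step c b y)
      then show ?case using B(1) that(2) pres
        by (auto simp: T.add T.scale lor.add_left lor.scaleR_left T(2))
    qed
  qed
  have T\<psi>: "T x = \<psi> x" if "x \<in> S" for x
  proof -
    have "T x - \<psi> x = 0"
    proof (rule lor_nondegenerate[OF dense])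
      fix y assume "y \<in> S"
      then obtain z where z: "z \<in> S" "y = \<psi> z" using \<psi>S by blast
      then show "lor u (T x - \<psi> x) y = 0"
        using half[of x z] that pres by (simp add: lor.diff_left span_base)
    qed
    then show ?thesis by simp
  qed
  have pT: "lor u (T x) (T y) = lor u x y" if x: "x \<in> span S" and y: "y \<in> span S" for x y
    using y
  proof (induction rule: span_induct_alt)
    case base show ?case by (simp add: T.zero lor.zero_right)
  next
    case (step c b y)
    then show ?case using half[OF x]
      by (simp add: T.add T.scale lor.add_right lor.scaleR_right T\<psi>)
  qed
  obtain q where q: "q \<in> S" "\<psi> q = u" using uS \<psi>S by (metis imageE)
  obtain K where K: "\<And>x. norm (lor u x q) \<le> norm x * K" "K \<ge> 0"
    using bounded_linear.nonneg_bounded[OF lor.bounded_linear_left, of q] by metis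
  obtain M where M: "\<And>x. norm (lor u x x) \<le> norm x * norm x * M" "M \<ge> 0"
    using lor.nonneg_bounded by metis
  have bT: "norm (T x) \<le> sqrt (2 * K\<^sup>2 + M) * norm x" if "x \<in> span S" for x
  proof -
    have "\<bar>lor u x q\<bar>\<^sup>2 \<le> (norm x * K)\<^sup>2" using K(1)[of x] by (intro power_mono) auto
    then have "(lor u x q)\<^sup>2 \<le> (norm x * K)\<^sup>2" by simp
    moreover have "- lor u x x \<le> norm x * norm x * M" using M(1)[of x] by simp
    moreover have "T x \<bullet> u = lor u x q" using half[OF that q(1)] by (simp add: q lor_u)
    ultimately have "(norm (T x))\<^sup>2 \<le> (2 * K\<^sup>2 + M) * (norm x)\<^sup>2"
      using pT[OF that that] unfolding norm_sq_lor[of "T x"] by (simp add: power2_eq_square algebra_simps)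
    then have "norm (T x) \<le> sqrt ((2 * K\<^sup>2 + M) * (norm x)\<^sup>2)" by (rule real_le_rsqrt)
    then show ?thesis by (simp add: real_sqrt_mult)
  qed
  define c where "c = sqrt (2 * K\<^sup>2 + M)"
  have c: "c \<ge> 0" using M(2) by (simp add: c_def)
  have "uniformly_continuous_on (span S) T"
    unfolding uniformly_continuous_on_def
  proof (intro allI impI)
    fix \<epsilon> :: real assume "\<epsilon> > 0"
    show "\<exists>d>0. \<forall>x\<in>span S. \<forall>x'\<in>span S. dist x' x < d \<longrightarrow> dist (T x') (T x) < \<epsilon>"
    proof (intro exI[of _ "\<epsilon> / (c + 1)"] conjI ballI impI)
      show "\<epsilon> / (c + 1) > 0" using \<open>\<epsilon> > 0\<close> c by simp
      fix x x' assume x: "x \<in> span S" "x' \<in> span S" "dist x' x < \<epsilon> / (c + 1)"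
      have "dist (T x') (T x) \<le> c * norm (x' - x)"
        using bT[OF span_diff[OF x(2,1)]] by (simp add: dist_norm T.diff c_def)
      also have "\<dots> \<le> (c + 1) * norm (x' - x)" by (intro mult_right_mono) auto
      also have "\<dots> < \<epsilon>" using x(3) c by (simp add: dist_norm field_simps)
      finally show "dist (T x') (T x) < \<epsilon>" .
    qed
  qed
  then obtain g where g: "uniformly_continuous_on (closure (span S)) g" "\<And>x. x \<in> span S \<Longrightarrow> T x = g x"
    using uniformly_continuous_on_extension_on_closure by metis
  have cg: "continuous_on UNIV g"
    using uniformly_continuous_imp_continuous[OF g(1)] dense by simp
  have appr: "\<exists>X. (\<forall>n. X n \<in> span S) \<and> X \<longlonglongrightarrow> x \<and> (\<lambda>n. T (X n)) \<longlonglongrightarrow> g x" for x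
  proof -
    have "x \<in> closure (span S)" using dense by simp
    then obtain X where X: "\<forall>n. X n \<in> span S" "X \<longlonglongrightarrow> x" unfolding closure_sequential by blast
    have "(\<lambda>n. g (X n)) \<longlonglongrightarrow> g x" using cg X(2) by (simp add: continuous_on_sequentially)
      (auto simp: o_def)
    then show ?thesis using X g(2) by auto
  qed
  have ga: "g (x + y) = g x + g y" for x y
  proof -
    obtain X Y where X: "\<And>n. X n \<in> span S" "X \<longlonglongrightarrow> x" "(\<lambda>n. T (X n)) \<longlonglongrightarrow> g x"
      and Y: "\<And>n. Y n \<in> span S" "Y \<longlonglongrightarrow> y" "(\<lambda>n. T (Y n)) \<longlonglongrightarrow> g y"
      using appr by metis
    have "(\<lambda>n. g (X n + Y n)) \<longlonglongrightarrow> g (x + y)"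
      using cg tendsto_add[OF X(2) Y(2)] by (auto simp: continuous_on_sequentially o_def)
    moreover have "g (X n + Y n) = T (X n) + T (Y n)" for n
      using g(2)[of "X n + Y n"] X(1) Y(1) by (simp add: span_add T.add)
    ultimately show ?thesis using LIMSEQ_unique tendsto_add[OF X(3) Y(3)] by simp
  qed
  have gs: "g (r *\<^sub>R x) = r *\<^sub>R g x" for r x
  proof -
    obtain X where X: "\<And>n. X n \<in> span S" "X \<longlonglongrightarrow> x" "(\<lambda>n. T (X n)) \<longlonglongrightarrow> g x"
      using appr by metis
    have "(\<lambda>n. g (r *\<^sub>R X n)) \<longlonglongrightarrow> g (r *\<^sub>R x)"
      using cg tendsto_scaleR[OF tendsto_const X(2)] by (auto simp: continuous_on_sequentially o_def)
    moreover have "g (r *\<^sub>R X n) = r *\<^sub>R T (X n)" for n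
      using g(2)[of "r *\<^sub>R X n"] X(1) by (simp add: span_scale T.scale)
    ultimately have "(\<lambda>n. r *\<^sub>R T (X n)) \<longlonglongrightarrow> g (r *\<^sub>R x)" by simp
    from LIMSEQ_unique[OF this tendsto_scaleR[OF tendsto_const X(3)]] show ?thesis .
  qed
  have gn: "norm (g x) \<le> norm x * c" for x
  proof -
    obtain X where X: "\<And>n. X n \<in> span S" "X \<longlonglongrightarrow> x" "(\<lambda>n. T (X n)) \<longlonglongrightarrow> g x"
      using appr by metis
    have "(\<lambda>n. norm (T (X n))) \<longlonglongrightarrow> norm (g x)" "(\<lambda>n. c * norm (X n)) \<longlonglongrightarrow> c * norm x"
      by (rule tendsto_norm[OF X(3)], rule tendsto_mult[OF tendsto_const tendsto_norm[OF X(2)]])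
    then have "norm (g x) \<le> c * norm x"
      by (rule LIMSEQ_le) (use bT[OF X(1)] in \<open>auto simp: c_def\<close>)
    then show ?thesis by (simp add: mult.commute)
  qed
  have bl: "bounded_linear g" by (rule bounded_linear_intro[OF ga gs gn])
  have "lor u (g x) (g y) = lor u x y" for x y
  proof -
    obtain X Y where X: "\<And>n. X n \<in> span S" "X \<longlonglongrightarrow> x" "(\<lambda>n. T (X n)) \<longlonglongrightarrow> g x"
      and Y: "\<And>n. Y n \<in> span S" "Y \<longlonglongrightarrow> y" "(\<lambda>n. T (Y n)) \<longlonglongrightarrow> g y"
      using appr by metis
    have "(\<lambda>n. lor u (X n) (Y n)) \<longlonglongrightarrow> lor u x y" by (rule lor.tendsto[OF X(2) Y(2)])
    moreover have "(\<lambda>n. lor u (T (X n)) (T (Y n))) \<longlonglongrightarrow> lor u (g x) (g y)"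
      by (rule lor.tendsto[OF X(3) Y(3)])
    ultimately show ?thesis using LIMSEQ_unique pT X(1) Y(1) by simp
  qed
  moreover have "g x = \<psi> x" if "x \<in> S" for x
    using T\<psi>[OF that] g(2)[of x] that by (simp add: span_base)
  ultimately show thesis using that bl by blast
qed

end



section \<open>Maps of class C-k\<close>

lemma Ck_on_cong:
  assumes "open U" "\<And>x. x \<in> U \<Longrightarrow> f x = g x" "Ck_on k f U"
  shows "Ck_on k g U"
  using assms(2,3)
proof (induction k arbitrary: f g)
  case 0
  then show ?case by (simp cong: continuous_on_cong)
next
  case (Suc k)
  have d: "(g has_derivative frechet_derivative f (at x)) (at x)" if x: "x \<in> U" for x
  proof (rule has_derivative_transform_within_open[OF _ assms(1) x Suc.prems(1)])
    show "(f has_derivative frechet_derivative f (at x)) (at x)"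
      using Suc.prems(2) x frechet_derivative_works by auto
  qed
  have "frechet_derivative g (at x) = frechet_derivative f (at x)" if "x \<in> U" for x
    using frechet_derivative_at[OF d[OF that]] by simp
  then have "Ck_on k (\<lambda>x. frechet_derivative g (at x) v) U" for v
    using Suc.IH[of "\<lambda>x. frechet_derivative f (at x) v" "\<lambda>x. frechet_derivative g (at x) v"] Suc.prems(2)
    by simp
  moreover have "g differentiable (at x)" if "x \<in> U" for x
    using d[OF that] unfolding differentiable_def by blast
  ultimately show ?case by simp
qed

text \<open>
  Replaces \<open>frechet_derivative\<close>, which is only known on \<open>U\<close>, by an explicit formula, so that
  regularity of all orders can be proved by induction on \<open>k\<close> for classes of maps closed under
  differentiation.
\<close>

lemma Ck_on_SucI:
  assumes "open U" "\<And>x. x \<in> U \<Longrightarrow> (f has_derivative f' x) (at x)" "\<And>v. Ck_on k (\<lambda>x. f' x v) U"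
  shows "Ck_on (Suc k) f U"
proof -
  have "frechet_derivative f (at x) = f' x" if "x \<in> U" for x
    using frechet_derivative_at[OF assms(2)[OF that]] by simp
  then have "Ck_on k (\<lambda>x. frechet_derivative f (at x) v) U" for v
    by (intro Ck_on_cong[OF assms(1) _ assms(3)[of v]]) simp
  then show ?thesis using assms(2) by (auto simp: differentiable_def)
qed

lemma Ck_on_SucD: "Ck_on (Suc k) f U \<Longrightarrow> Ck_on k f U"
proof (induction k arbitrary: f)
  case 0
  then show ?case by (auto intro!: continuous_at_imp_continuous_on differentiable_imp_continuous_within)
next
  case (Suc k)
  then show ?case by (metis Ck_on.simps(2))
qed

lemma Ck_on_const: "open U \<Longrightarrow> Ck_on k (\<lambda>x. c) U"
proof (induction k arbitrary: c)
  case (Suc k)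
  show ?case by (rule Ck_on_SucI[OF Suc.prems has_derivative_const Suc.IH[OF Suc.prems]])
qed simp

lemma Ck_on_bounded_linear:
  assumes "open U" "bounded_linear f" shows "Ck_on k f U"
proof (cases k)
  case 0
  then show ?thesis using assms by (simp add: linear_continuous_on)
next
  case (Suc k')
  show ?thesis unfolding Suc
    by (rule Ck_on_SucI[OF assms(1) bounded_linear_imp_has_derivative[OF assms(2)] Ck_on_const[OF assms(1)]])
qed

lemma Ck_on_add:
  assumes "open U" "Ck_on k f U" "Ck_on k g U" shows "Ck_on k (\<lambda>x. f x + g x) U"
  using assms(2,3)
proof (induction k arbitrary: f g)
  case 0
  then show ?case by (simp add: continuous_on_add)
next
  case (Suc k)
  show ?case
  proof (rule Ck_on_SucI[OF assms(1)])
    fix x assume "x \<in> U"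
    then show "((\<lambda>x. f x + g x) has_derivative
        (\<lambda>v. frechet_derivative f (at x) v + frechet_derivative g (at x) v)) (at x)"
      using Suc.prems frechet_derivative_works by (intro has_derivative_add) auto
  next
    show "Ck_on k (\<lambda>x. frechet_derivative f (at x) v + frechet_derivative g (at x) v) U" for v
      using Suc.prems by (intro Suc.IH) auto
  qed
qed

lemma (in bounded_bilinear) Ck_on_bilinear:
  assumes "open U" "Ck_on k f U" "Ck_on k g U" shows "Ck_on k (\<lambda>x. prod (f x) (g x)) U"
  using assms(2,3)
proof (induction k arbitrary: f g)
  case 0
  then show ?case by (simp add: continuous_on)
next
  case (Suc k)
  show ?case
  proof (rule Ck_on_SucI[OF assms(1)])
    fix x assume x: "x \<in> U"
    show "((\<lambda>x. prod (f x) (g x)) has_derivative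
        (\<lambda>v. prod (f x) (frechet_derivative g (at x) v) + prod (frechet_derivative f (at x) v) (g x))) (at x)"
      by (intro FDERIV frechet_derivative_works[THEN iffD1]) (use Suc.prems x in auto)
  next
    show "Ck_on k (\<lambda>x. prod (f x) (frechet_derivative g (at x) v)
        + prod (frechet_derivative f (at x) v) (g x)) U" for v
      using Suc.prems Ck_on_SucD[of k f U] Ck_on_SucD[of k g U]
      by (intro Ck_on_add[OF assms(1)] Suc.IH) auto
  qed
qed

lemma disc_sq: "norm (z::complex) < 1 \<Longrightarrow> 1 - (norm z)\<^sup>2 > 0"
  by (simp add: abs_square_less_1)

lemma has_derivative_norm_sq:
  "((\<lambda>z. 1 - (norm z)\<^sup>2) has_derivative (\<lambda>v. - 2 * (z \<bullet> v))) (at (z::complex))"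
  unfolding power2_norm_eq_inner
  by (auto intro!: derivative_eq_intros simp: inner_commute)

lemma has_derivative_disc_powr:
  fixes z :: complex assumes "norm z < 1"
  shows "((\<lambda>z. (1 - (norm z)\<^sup>2) powr s) has_derivative
      (\<lambda>v. (- 2 * s) * ((z \<bullet> v) * (1 - (norm z)\<^sup>2) powr (s - 1)))) (at z)"
proof -
  have "((\<lambda>y. y powr s) has_real_derivative s * (1 - (norm z)\<^sup>2) powr (s - 1)) (at (1 - (norm z)\<^sup>2))"
    by (rule has_real_derivative_powr[OF disc_sq[OF assms]])
  from has_derivative_compose[OF has_derivative_norm_sq this[unfolded has_field_derivative_def]]
  show ?thesis by (simp add: algebra_simps)
qed

lemma Ck_on_disc_powr: "Ck_on k (\<lambda>z::complex. (1 - (norm z)\<^sup>2) powr s) (ball 0 1)"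
proof (induction k arbitrary: s)
  case 0
  show ?case
    by (auto intro!: continuous_at_imp_continuous_on has_derivative_continuous[OF has_derivative_disc_powr])
next
  case (Suc k)
  show ?case
  proof (rule Ck_on_SucI)
    show "((\<lambda>z. (1 - (norm z)\<^sup>2) powr s) has_derivative
      (\<lambda>v. (- 2 * s) * ((z \<bullet> v) * (1 - (norm z)\<^sup>2) powr (s - 1)))) (at z)" if "z \<in> ball 0 1" for z :: complex
      using that by (intro has_derivative_disc_powr) simp
    show "Ck_on k (\<lambda>z. (- 2 * s) * ((z \<bullet> v) * (1 - (norm z)\<^sup>2) powr (s - 1))) (ball 0 1)" for v :: complex
      by (intro bounded_bilinear.Ck_on_bilinear[OF bounded_bilinear_mult] Suc.IH open_ball
          Ck_on_const Ck_on_bounded_linear bounded_linear_inner_left)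
  qed simp
qed


section \<open>Power series in z and its conjugate\<close>

text \<open>
  Stated for the sort of the Hilbert space, which does not entail the class \<open>banach\<close>.
\<close>

lemma summable_norm_complete:
  fixes f :: "nat \<Rightarrow> 'b::{real_normed_vector, complete_space}"
  assumes "summable (\<lambda>n. norm (f n))" shows "summable f"
proof -
  have c: "Cauchy (\<lambda>n. \<Sum>i<n. norm (f i))"
    using assms by (simp add: summable_iff_convergent convergent_Cauchy)
  have "Cauchy (\<lambda>n. \<Sum>i<n. f i)"
  proof (rule CauchyI')
    fix e :: real assume "e > 0"
    then obtain M where M: "\<And>m n. m \<ge> M \<Longrightarrow> n > m \<Longrightarrow> dist (\<Sum>i<m. norm (f i)) (\<Sum>i<n. norm (f i)) < e"
      using c unfolding Cauchy_altdef by blast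
    have "norm ((\<Sum>i<m. f i) - (\<Sum>i<n. f i)) < e" if "m \<ge> M" "n > m" for m n
    proof -
      have "norm ((\<Sum>i<m. f i) - (\<Sum>i<n. f i)) = norm (\<Sum>i=m..<n. f i)"
        using that(2) sum_diff_nat_ivl[of 0 m n f] by (simp add: lessThan_atLeast0 norm_minus_commute[of "sum f {0..<m}"])
      also have "\<dots> \<le> (\<Sum>i=m..<n. norm (f i))" by (rule norm_sum)
      also have "\<dots> \<le> dist (\<Sum>i<m. norm (f i)) (\<Sum>i<n. norm (f i))"
        using that(2) sum_diff_nat_ivl[of 0 m n "\<lambda>i. norm (f i)"]
        by (simp add: lessThan_atLeast0 dist_real_def)
      also have "\<dots> < e" using M that by blast
      finally show ?thesis .
    qed
    then show "\<exists>M. \<forall>m\<ge>M. \<forall>n>m. dist (\<Sum>i<m. f i) (\<Sum>i<n. f i) < e" by (auto simp: dist_norm)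
  qed
  then show ?thesis by (simp add: summable_iff_convergent Cauchy_convergent)
qed

lemma norm_suminf_le_complete:
  fixes f :: "nat \<Rightarrow> 'b::{real_normed_vector, complete_space}"
  assumes "\<And>n. norm (f n) \<le> g n" "summable g"
  shows "summable f" "norm (suminf f) \<le> suminf g"
proof -
  have "summable (\<lambda>n. norm (f n))" by (rule summable_comparison_test_ev[OF _ assms(2)]) (simp add: assms(1))
  then show s: "summable f" by (rule summable_norm_complete)
  show "norm (suminf f) \<le> suminf g"
  proof (rule LIMSEQ_le)
    show "(\<lambda>n. norm (\<Sum>i<n. f i)) \<longlonglongrightarrow> norm (suminf f)" by (rule tendsto_norm[OF summable_LIMSEQ[OF s]])
    show "(\<lambda>n. \<Sum>i<n. g i) \<longlonglongrightarrow> suminf g" by (rule summable_LIMSEQ[OF assms(2)])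
    show "\<exists>N. \<forall>n\<ge>N. norm (\<Sum>i<n. f i) \<le> (\<Sum>i<n. g i)" using assms(1) by (blast intro: sum_norm_le)
  qed
qed

lemma summable_poly_times_power:
  fixes r :: real assumes "\<bar>r\<bar> < 1"
  shows "summable (\<lambda>n. (real n + 1) ^ q * r ^ n)"
  using assms
proof (induction q arbitrary: r)
  case 0
  then show ?case by (simp add: summable_geometric)
next
  case (Suc q)
  have "summable (\<lambda>n. diffs (\<lambda>n. (real n + 1) ^ q) n * \<bar>r\<bar> ^ n)"
    by (rule termdiff_converges[of _ 1]) (use Suc in auto)
  then show ?case
  proof (rule summable_comparison_test_ev[rotated], intro always_eventually allI)
    fix n
    have "(real n + 1) ^ q \<le> (real (Suc n) + 1) ^ q" by (intro power_mono) auto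
    then have "(real n + 1) * (real n + 1) ^ q \<le> (real n + 1) * (real (Suc n) + 1) ^ q" by (intro mult_left_mono) auto
    then have "((real n + 1) * (real n + 1) ^ q) * \<bar>r\<bar> ^ n \<le> ((real n + 1) * (real (Suc n) + 1) ^ q) * \<bar>r\<bar> ^ n"
      by (rule mult_right_mono) simp
    then show "norm ((real n + 1) ^ Suc q * r ^ n) \<le> diffs (\<lambda>n. (real n + 1) ^ q) n * \<bar>r\<bar> ^ n"
      by (simp add: diffs_def abs_mult power_abs add.commute)
  qed
qed

text \<open>
  A power series in \<open>z\<close> and \<open>cnj z\<close> with coefficients in a real vector space. The coefficient
  of \<open>z ^ k * cnj z ^ l\<close> is a real-linear map \<open>L k l\<close> on the complex plane, which replaces a complexification
  of the target. Polynomial growth of the coefficients gives convergence on the unit disc and is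
  inherited by the derivatives.
\<close>

definition poly_bounded :: "(nat \<Rightarrow> nat \<Rightarrow> complex \<Rightarrow> 'b::real_normed_vector) \<Rightarrow> bool" where
  "poly_bounded L \<longleftrightarrow> (\<forall>k l. linear (L k l)) \<and>
     (\<exists>C p. C \<ge> 0 \<and> (\<forall>k l w. norm (L k l w) \<le> C * (real (k + l) + 1) ^ p * norm w))"

definition hom_part :: "(nat \<Rightarrow> nat \<Rightarrow> complex \<Rightarrow> 'b::real_normed_vector) \<Rightarrow> nat \<Rightarrow> complex \<Rightarrow> 'b" where
  "hom_part L N z = (\<Sum>k\<le>N. L k (N - k) (z ^ k * cnj z ^ (N - k)))"

definition psum :: "(nat \<Rightarrow> nat \<Rightarrow> complex \<Rightarrow> 'b::real_normed_vector) \<Rightarrow> complex \<Rightarrow> 'b" where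
  "psum L z = (\<Sum>N. hom_part L N z)"

text \<open>
  The coefficients of the derivative of the series in the direction \<open>v\<close>.
\<close>

definition dcoeff :: "complex \<Rightarrow> (nat \<Rightarrow> nat \<Rightarrow> complex \<Rightarrow> 'b::real_normed_vector) \<Rightarrow> nat \<Rightarrow> nat \<Rightarrow> complex \<Rightarrow> 'b" where
  "dcoeff v L k l w = L (Suc k) l (of_nat (Suc k) * v * w) + L k (Suc l) (of_nat (Suc l) * cnj v * w)"

text \<open>
  The derivative of \<open>z ^ k * cnj z ^ l\<close> in the direction \<open>h\<close>.
\<close>

definition monoD :: "nat \<Rightarrow> nat \<Rightarrow> complex \<Rightarrow> complex \<Rightarrow> complex" where
  "monoD k l z h = of_nat k * z ^ (k - 1) * cnj z ^ l * h + of_nat l * z ^ k * cnj z ^ (l - 1) * cnj h"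

definition hom_partD :: "(nat \<Rightarrow> nat \<Rightarrow> complex \<Rightarrow> 'b::real_normed_vector) \<Rightarrow> nat \<Rightarrow> complex \<Rightarrow> complex \<Rightarrow> 'b" where
  "hom_partD L N z h = (\<Sum>k\<le>N. L k (N - k) (monoD k (N - k) z h))"

text \<open>
  The second order Taylor bound for monomials, by induction on the number of factors \<open>z\<close> and \<open>cnj z\<close>. The
  powers of \<open>r\<close> on the left avoid the exponents \<open>k + l - 1\<close> and \<open>k + l - 2\<close> on the right.
\<close>

lemma monomial_remainder:
  fixes z w :: complex and r :: real
  assumes "norm z \<le> r" "norm w \<le> r"
  shows "r * norm (w ^ k * cnj w ^ l - z ^ k * cnj z ^ l) \<le> real (k + l) * r ^ (k + l) * norm (w - z)
     \<and> r\<^sup>2 * norm (w ^ k * cnj w ^ l - z ^ k * cnj z ^ l - monoD k l z (w - z))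
          \<le> (real (k + l))\<^sup>2 * r ^ (k + l) * (norm (w - z))\<^sup>2"
proof -
  have r: "r \<ge> 0" using assms(1) norm_ge_zero order_trans by blast
  have step: "r * norm (a' * m' - a * m) \<le> real (Suc N) * r ^ Suc N * norm (w - z)
     \<and> r\<^sup>2 * norm (a' * m' - a * m - ((a' - a) * m + a * d)) \<le> (real (Suc N))\<^sup>2 * r ^ Suc N * (norm (w - z))\<^sup>2"
    if a: "norm a' \<le> r" "norm a \<le> r" "norm (a' - a) = norm (w - z)" and m: "norm m \<le> r ^ N"
      and 1: "r * norm (m' - m) \<le> real N * r ^ N * norm (w - z)"
      and 2: "r\<^sup>2 * norm (m' - m - d) \<le> (real N)\<^sup>2 * r ^ N * (norm (w - z))\<^sup>2"
    for a' a m' m d :: complex and N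
  proof
    have "norm (a' * m' - a * m) \<le> norm (a' * (m' - m)) + norm ((a' - a) * m)"
      using norm_triangle_ineq[of "a' * (m' - m)" "(a' - a) * m"] by (simp add: algebra_simps)
    also have "\<dots> \<le> r * norm (m' - m) + norm (w - z) * r ^ N"
      unfolding norm_mult using a m r by (intro add_mono mult_mono) auto
    also have "\<dots> \<le> real N * r ^ N * norm (w - z) + norm (w - z) * r ^ N" using 1 by simp
    also have "\<dots> = real (Suc N) * r ^ N * norm (w - z)" by (simp add: algebra_simps)
    finally show "r * norm (a' * m' - a * m) \<le> real (Suc N) * r ^ Suc N * norm (w - z)"
      using mult_left_mono[OF _ r] by (fastforce simp: algebra_simps)
    have eq: "a' * m' - a * m - ((a' - a) * m + a * d) = a * (m' - m - d) + (a' - a) * (m' - m)"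
      by (simp add: algebra_simps)
    have "norm (a' * m' - a * m - ((a' - a) * m + a * d)) \<le> norm (a * (m' - m - d)) + norm ((a' - a) * (m' - m))"
      unfolding eq by (rule norm_triangle_ineq)
    also have "\<dots> \<le> r * norm (m' - m - d) + norm (w - z) * norm (m' - m)"
      unfolding norm_mult using a r by (intro add_mono mult_mono) auto
    finally have "r\<^sup>2 * norm (a' * m' - a * m - ((a' - a) * m + a * d))
       \<le> r\<^sup>2 * (r * norm (m' - m - d) + norm (w - z) * norm (m' - m))"
      by (rule mult_left_mono) simp
    also have "\<dots> = r * (r\<^sup>2 * norm (m' - m - d)) + norm (w - z) * r * (r * norm (m' - m))"
      by (simp add: algebra_simps power2_eq_square)
    also have "\<dots> \<le> r * ((real N)\<^sup>2 * r ^ N * (norm (w - z))\<^sup>2) + norm (w - z) * r * (real N * r ^ N * norm (w - z))"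
      using 1 2 r by (intro add_mono mult_left_mono) auto
    also have "\<dots> = ((real N)\<^sup>2 + real N) * (r ^ Suc N * (norm (w - z))\<^sup>2)"
      by (simp add: algebra_simps power2_eq_square)
    also have "\<dots> \<le> (real (Suc N))\<^sup>2 * (r ^ Suc N * (norm (w - z))\<^sup>2)"
      using r by (intro mult_right_mono) (auto simp: power2_eq_square algebra_simps)
    finally show "r\<^sup>2 * norm (a' * m' - a * m - ((a' - a) * m + a * d))
        \<le> (real (Suc N))\<^sup>2 * r ^ Suc N * (norm (w - z))\<^sup>2" by (simp add: mult.assoc)
  qed
  have nm: "norm (z ^ k * cnj z ^ l) \<le> r ^ (k + l)" for k l
    using assms(1) by (simp add: norm_mult norm_power power_add[symmetric] power_mono)
  have cl: "r * norm (cnj w ^ l - cnj z ^ l) \<le> real l * r ^ l * norm (w - z)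
     \<and> r\<^sup>2 * norm (cnj w ^ l - cnj z ^ l - monoD 0 l z (w - z)) \<le> (real l)\<^sup>2 * r ^ l * (norm (w - z))\<^sup>2" for l
  proof (induction l)
    case 0
    show ?case by (simp add: monoD_def)
  next
    case (Suc l)
    have "norm (cnj w - cnj z) = norm (w - z)" by (metis complex_cnj_diff complex_mod_cnj)
    moreover have "(cnj w - cnj z) * cnj z ^ l + cnj z * monoD 0 l z (w - z) = monoD 0 (Suc l) z (w - z)"
      by (cases l) (simp_all add: monoD_def algebra_simps)
    ultimately show ?case
      using step[of "cnj w" "cnj z" "cnj z ^ l" l "cnj w ^ l" "monoD 0 l z (w - z)"] Suc assms nm[of 0 l] by simp
  qed
  show ?thesis
  proof (induction k)
    case 0
    then show ?case using cl by simp
  next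
    case (Suc k)
    have "(w - z) * (z ^ k * cnj z ^ l) + z * monoD k l z (w - z) = monoD (Suc k) l z (w - z)"
      by (cases k) (simp_all add: monoD_def algebra_simps)
    then show ?case
      using step[of w z "z ^ k * cnj z ^ l" "k + l" "w ^ k * cnj w ^ l" "monoD k l z (w - z)"] Suc assms nm
      by (simp add: mult.assoc)
  qed
qed

lemma hom_partD_Suc:
  assumes "\<And>k l. linear (L k l)"
  shows "hom_partD L 0 z v = 0" "hom_partD L (Suc N) z v = hom_part (dcoeff v L) N z"
proof -
  show "hom_partD L 0 z v = 0" by (simp add: hom_partD_def monoD_def linear_0[OF assms])
  have sp: "L k l (monoD k l z v) = L k l (of_nat k * z ^ (k - 1) * cnj z ^ l * v)
     + L k l (of_nat l * z ^ k * cnj z ^ (l - 1) * cnj v)" for k l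
    by (simp add: monoD_def linear_add[OF assms])
  have "hom_partD L (Suc N) z v =
      (\<Sum>k\<le>Suc N. L k (Suc N - k) (of_nat k * z ^ (k - 1) * cnj z ^ (Suc N - k) * v))
    + (\<Sum>k\<le>Suc N. L k (Suc N - k) (of_nat (Suc N - k) * z ^ k * cnj z ^ (Suc N - k - 1) * cnj v))"
    unfolding hom_partD_def sp by (rule sum.distrib)
  also have "(\<Sum>k\<le>Suc N. L k (Suc N - k) (of_nat k * z ^ (k - 1) * cnj z ^ (Suc N - k) * v))
     = (\<Sum>k\<le>N. L (Suc k) (N - k) (of_nat (Suc k) * v * (z ^ k * cnj z ^ (N - k))))"
    unfolding sum.atMost_Suc_shift by (simp add: linear_0[OF assms] mult_ac del: of_nat_Suc)
  also have "(\<Sum>k\<le>Suc N. L k (Suc N - k) (of_nat (Suc N - k) * z ^ k * cnj z ^ (Suc N - k - 1) * cnj v))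
     = (\<Sum>k\<le>N. L k (Suc (N - k)) (of_nat (Suc (N - k)) * cnj v * (z ^ k * cnj z ^ (N - k))))"
    unfolding sum.atMost_Suc by (simp add: linear_0[OF assms] mult_ac Suc_diff_le del: of_nat_Suc)
  finally show "hom_partD L (Suc N) z v = hom_part (dcoeff v L) N z"
    by (simp add: hom_part_def dcoeff_def sum.distrib del: of_nat_Suc)
qed

lemma poly_bounded_dcoeff:
  assumes "poly_bounded L" shows "poly_bounded (dcoeff v L)"
proof -
  obtain C p where lin: "\<And>k l. linear (L k l)" and C: "C \<ge> 0"
    and b: "\<And>k l w. norm (L k l w) \<le> C * (real (k + l) + 1) ^ p * norm w"
    using assms unfolding poly_bounded_def by blast
  have "linear (dcoeff v L k l)" for k l
    unfolding dcoeff_def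
    by (intro linear_compose_add linear_compose[unfolded o_def, OF _ lin] linear_times)
  moreover have "norm (dcoeff v L k l w) \<le> (C * norm v * 2 ^ Suc p) * (real (k + l) + 1) ^ Suc p * norm w" for k l w
  proof -
    let ?n = "real (k + l) + 1"
    have e: "real (Suc k + l) + 1 = ?n + 1" "real (k + Suc l) + 1 = ?n + 1" by simp_all
    have "norm (dcoeff v L k l w) \<le> C * (?n + 1) ^ p * (real (Suc k) * norm v * norm w)
        + C * (?n + 1) ^ p * (real (Suc l) * norm v * norm w)"
      unfolding dcoeff_def
      using b[of "Suc k" l "of_nat (Suc k) * v * w", unfolded e norm_mult norm_of_nat]
        b[of k "Suc l" "of_nat (Suc l) * cnj v * w", unfolded e norm_mult norm_of_nat complex_mod_cnj]
      by (rule order_trans[OF norm_triangle_ineq add_mono])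
    also have "\<dots> = C * norm v * ((?n + 1) ^ Suc p) * norm w" by (simp add: algebra_simps)
    also have "\<dots> \<le> C * norm v * ((2 * ?n) ^ Suc p) * norm w"
      using C by (intro mult_right_mono mult_left_mono power_mono) auto
    also have "\<dots> = (C * norm v * 2 ^ Suc p) * ?n ^ Suc p * norm w" by (simp only: power_mult_distrib mult_ac)
    finally show ?thesis .
  qed
  ultimately show ?thesis using C unfolding poly_bounded_def
    by (metis mult_nonneg_nonneg norm_ge_zero zero_le_numeral zero_le_power)
qed

lemma hom_part_bound:
  assumes "poly_bounded L"
  obtains C p where "C \<ge> 0" "\<And>N z. norm (hom_part L N z) \<le> C * ((real N + 1) ^ p * norm z ^ N)"
    "\<And>N z w r. norm z \<le> r \<Longrightarrow> norm w \<le> r \<Longrightarrow>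
       r\<^sup>2 * norm (hom_part L N w - hom_part L N z - hom_partD L N z (w - z))
         \<le> C * ((real N + 1) ^ p * r ^ N) * (norm (w - z))\<^sup>2"
proof -
  obtain C p where lin: "\<And>k l. linear (L k l)" and C: "C \<ge> 0"
    and b: "\<And>k l w. norm (L k l w) \<le> C * (real (k + l) + 1) ^ p * norm w"
    using assms unfolding poly_bounded_def by blast
  show thesis
  proof (rule that[of C "p + 3"])
    show "C \<ge> 0" by fact
    fix N :: nat and z w :: complex and r :: real
    have "norm (hom_part L N z) \<le> (\<Sum>k\<le>N. C * (real N + 1) ^ p * norm z ^ N)"
      unfolding hom_part_def
    proof (rule sum_norm_le)
      fix k assume "k \<in> {..N}"
      then show "norm (L k (N - k) (z ^ k * cnj z ^ (N - k))) \<le> C * (real N + 1) ^ p * norm z ^ N"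
        using b[of k "N - k" "z ^ k * cnj z ^ (N - k)"] by (simp add: norm_mult norm_power power_add[symmetric])
    qed
    also have "\<dots> = C * ((real N + 1) ^ (p + 1) * norm z ^ N)" by (simp add: algebra_simps)
    also have "\<dots> \<le> C * ((real N + 1) ^ (p + 3) * norm z ^ N)"
      using C by (intro mult_left_mono mult_right_mono power_increasing) auto
    finally show "norm (hom_part L N z) \<le> C * ((real N + 1) ^ (p + 3) * norm z ^ N)" .
    assume r: "norm z \<le> r" "norm w \<le> r"
    then have r0: "r \<ge> 0" using norm_ge_zero order_trans by blast
    have "r\<^sup>2 * norm (hom_part L N w - hom_part L N z - hom_partD L N z (w - z))
      = norm (\<Sum>k\<le>N. r\<^sup>2 *\<^sub>R L k (N - k) (w ^ k * cnj w ^ (N - k) - z ^ k * cnj z ^ (N - k) - monoD k (N - k) z (w - z)))"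
      by (simp add: hom_part_def hom_partD_def linear_diff[OF lin] sum_subtractf scaleR_sum_right[symmetric])
    also have "\<dots> \<le> (\<Sum>k\<le>N. C * (real N + 1) ^ p * ((real N)\<^sup>2 * r ^ N * (norm (w - z))\<^sup>2))"
    proof (rule sum_norm_le)
      fix k assume k: "k \<in> {..N}"
      let ?x = "w ^ k * cnj w ^ (N - k) - z ^ k * cnj z ^ (N - k) - monoD k (N - k) z (w - z)"
      have "norm (r\<^sup>2 *\<^sub>R L k (N - k) ?x) \<le> r\<^sup>2 * (C * (real N + 1) ^ p * norm ?x)"
        using b[of k "N - k" ?x] k by (simp add: mult_left_mono)
      also have "\<dots> = C * (real N + 1) ^ p * (r\<^sup>2 * norm ?x)" by simp
      also have "\<dots> \<le> C * (real N + 1) ^ p * ((real N)\<^sup>2 * r ^ N * (norm (w - z))\<^sup>2)"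
        using monomial_remainder[OF r, of k "N - k"] k C by (intro mult_left_mono) auto
      finally show "norm (r\<^sup>2 *\<^sub>R L k (N - k) ?x) \<le> C * (real N + 1) ^ p * ((real N)\<^sup>2 * r ^ N * (norm (w - z))\<^sup>2)" .
    qed
    also have "\<dots> = C * (((real N + 1) ^ (p + 1) * (real N)\<^sup>2) * r ^ N) * (norm (w - z))\<^sup>2"
      by (simp add: algebra_simps)
    also have "\<dots> \<le> C * (((real N + 1) ^ (p + 1) * (real N + 1)\<^sup>2) * r ^ N) * (norm (w - z))\<^sup>2"
      using C r0 by (intro mult_left_mono mult_right_mono power_mono) auto
    also have "\<dots> = C * ((real N + 1) ^ (p + 3) * r ^ N) * (norm (w - z))\<^sup>2"
      by (simp add: power_add power3_eq_cube power2_eq_square)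
    finally show "r\<^sup>2 * norm (hom_part L N w - hom_part L N z - hom_partD L N z (w - z))
         \<le> C * ((real N + 1) ^ (p + 3) * r ^ N) * (norm (w - z))\<^sup>2" .
  qed
qed

lemma summable_norm_hom_part:
  assumes "poly_bounded L" "norm z < 1"
  shows "summable (\<lambda>N. norm (hom_part L N z))"
proof -
  obtain C p where C: "\<And>N z. norm (hom_part L N z) \<le> C * ((real N + 1) ^ p * norm z ^ N)"
    using hom_part_bound[OF assms(1)] by metis
  have "summable (\<lambda>N. C * ((real N + 1) ^ p * norm z ^ N))"
    using assms(2) by (intro summable_mult summable_poly_times_power) simp
  then show ?thesis by (rule summable_comparison_test_ev[rotated]) (simp add: C)
qed

lemma summable_hom_part:
  fixes L :: "nat \<Rightarrow> nat \<Rightarrow> complex \<Rightarrow> 'b::{real_normed_vector, complete_space}"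
  assumes "poly_bounded L" "norm z < 1"
  shows "summable (\<lambda>N. hom_part L N z)"
  by (rule summable_norm_complete[OF summable_norm_hom_part[OF assms]])

text \<open>
  Termwise differentiation. The second order remainders of the homogeneous parts are summable, uniformly near
  \<open>z\<close>, by \<open>hom_part_bound\<close>.
\<close>

lemma has_derivative_psum:
  fixes L :: "nat \<Rightarrow> nat \<Rightarrow> complex \<Rightarrow> 'b::{real_normed_vector, complete_space}"
  assumes "poly_bounded L" "norm z < 1"
  shows "(psum L has_derivative (\<lambda>v. psum (dcoeff v L) z)) (at z)"
proof -
  have lin: "\<And>k l. linear (L k l)" using assms(1) by (simp add: poly_bounded_def)
  \<comment> \<open>Any radius strictly between \<open>norm z\<close> and \<open>1\<close>.\<close>
  define r where "r = (1 + norm z) / 2"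
  have r: "norm z < r" "r < 1" "r > 0" using assms(2) by (auto simp: r_def add_pos_nonneg)
  obtain C p where C: "C \<ge> 0"
    "\<And>N z w r. norm z \<le> r \<Longrightarrow> norm w \<le> r \<Longrightarrow>
       r\<^sup>2 * norm (hom_part L N w - hom_part L N z - hom_partD L N z (w - z))
         \<le> C * ((real N + 1) ^ p * r ^ N) * (norm (w - z))\<^sup>2"
    using hom_part_bound[OF assms(1)] by metis
  have sD: "(\<lambda>N. hom_partD L N z v) sums psum (dcoeff v L) z" for v
  proof -
    have "(\<lambda>N. hom_part (dcoeff v L) N z) sums psum (dcoeff v L) z"
      unfolding psum_def by (intro summable_sums summable_hom_part poly_bounded_dcoeff assms)
    then have "(\<lambda>N. hom_partD L (Suc N) z v) sums psum (dcoeff v L) z"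
      by (simp add: hom_partD_Suc(2)[OF lin])
    then show ?thesis using sums_Suc_iff[of "\<lambda>N. hom_partD L N z v"] by (simp add: hom_partD_Suc(1)[OF lin])
  qed
  have monoD_add: "monoD k l z (v + w) = monoD k l z v + monoD k l z w" for k l v w
    by (simp add: monoD_def algebra_simps)
  have monoD_scale: "monoD k l z (c *\<^sub>R v) = c *\<^sub>R monoD k l z v" for k l c v
    by (simp add: monoD_def algebra_simps)
  have "linear (\<lambda>v. psum (dcoeff v L) z)"
  proof (rule linearI)
    fix v w and c :: real
    have "hom_partD L N z (v + w) = hom_partD L N z v + hom_partD L N z w" for N
      by (simp add: hom_partD_def monoD_add linear_add[OF lin] sum.distrib)
    then show "psum (dcoeff (v + w) L) z = psum (dcoeff v L) z + psum (dcoeff w L) z"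
      using sums_unique2[OF sD[of "v + w"]] sums_add[OF sD[of v] sD[of w]] by simp
    have "hom_partD L N z (c *\<^sub>R v) = c *\<^sub>R hom_partD L N z v" for N
      by (simp only: hom_partD_def monoD_scale linear_scale[OF lin] scaleR_sum_right)
    then show "psum (dcoeff (c *\<^sub>R v) L) z = c *\<^sub>R psum (dcoeff v L) z"
      using sums_unique2[OF sD[of "c *\<^sub>R v"]] sums_scaleR_right[OF sD[of v], of c] by simp
  qed
  then have bl: "bounded_linear (\<lambda>v. psum (dcoeff v L) z)" by (simp add: linear_conv_bounded_linear)
  define M where "M = (\<Sum>N. (C / r\<^sup>2) * ((real N + 1) ^ p * r ^ N))"
  have sM: "summable (\<lambda>N. (C / r\<^sup>2) * ((real N + 1) ^ p * r ^ N))"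
    using r by (intro summable_mult summable_poly_times_power) simp
  have est: "norm (psum L w - psum L z - psum (dcoeff (w - z) L) z) \<le> M * (norm (w - z))\<^sup>2"
    if w: "norm w < r" for w
  proof -
    have "(\<lambda>N. hom_part L N w - hom_part L N z - hom_partD L N z (w - z)) sums
        (psum L w - psum L z - psum (dcoeff (w - z) L) z)"
      using w r unfolding psum_def
      by (intro sums_diff sD[unfolded psum_def] summable_sums summable_hom_part assms) auto
    then have "psum L w - psum L z - psum (dcoeff (w - z) L) z =
        (\<Sum>N. hom_part L N w - hom_part L N z - hom_partD L N z (w - z))" by (simp add: sums_iff)
    moreover have bnd: "norm (hom_part L N w - hom_part L N z - hom_partD L N z (w - z))
        \<le> (C / r\<^sup>2) * ((real N + 1) ^ p * r ^ N) * (norm (w - z))\<^sup>2" for N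
      using C(2)[of z r w N] r w by (simp add: field_simps)
    ultimately show ?thesis
      using norm_suminf_le_complete(2)[OF bnd summable_mult2[OF sM]]
      unfolding M_def suminf_mult2[OF sM] by simp
  qed
  have "((\<lambda>w. norm (psum L w - psum L z - psum (dcoeff (w - z) L) z) / norm (w - z)) \<longlongrightarrow> 0) (at z)"
  proof (rule Lim_null_comparison)
    have "\<forall>\<^sub>F w in at z. norm w < r"
    proof (rule order_tendstoD)
      show "((\<lambda>w. norm w) \<longlongrightarrow> norm z) (at z)" by (intro tendsto_intros)
    qed (rule r(1))
    then show "\<forall>\<^sub>F w in at z. norm (norm (psum L w - psum L z - psum (dcoeff (w - z) L) z) / norm (w - z))
        \<le> M * norm (w - z)"
    proof eventually_elim
      case (elim w)
      then show ?case using est[OF elim] by (cases "w = z") (simp_all add: field_simps power2_eq_square)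
    qed
    have "((\<lambda>w. M * norm (w - z)) \<longlongrightarrow> M * norm (z - z)) (at z)" by (intro tendsto_intros)
    then show "((\<lambda>w. M * norm (w - z)) \<longlongrightarrow> 0) (at z)" by simp
  qed
  with bl show ?thesis unfolding has_derivative_iff_norm by blast
qed

lemma Ck_on_psum:
  fixes L :: "nat \<Rightarrow> nat \<Rightarrow> complex \<Rightarrow> 'b::{real_normed_vector, complete_space}"
  assumes "poly_bounded L" shows "Ck_on k (psum L) (ball 0 1)"
  using assms
proof (induction k arbitrary: L)
  case 0
  then show ?case
    by (auto intro!: continuous_at_imp_continuous_on has_derivative_continuous[OF has_derivative_psum])
next
  case (Suc k)
  show ?case
    by (rule Ck_on_SucI[OF open_ball has_derivative_psum[OF Suc.prems] Suc.IH[OF poly_bounded_dcoeff[OF Suc.prems]]])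
      simp
qed

text \<open>
  Along a ray, the homogeneous part of degree \<open>N\<close> is the limit, as the point tends to the origin, of the
  rescaled difference of the series and its parts of lower degree. This recovers the derivatives of a series at the
  origin from its values and is used to show that the image of the equivariant map is total.
\<close>

lemma hom_part_in_closed_subspace:
  fixes L :: "nat \<Rightarrow> nat \<Rightarrow> complex \<Rightarrow> 'b::{real_normed_vector, complete_space}"
  assumes L: "poly_bounded L" and V: "subspace V" "closed V" "\<And>z. norm z < 1 \<Longrightarrow> psum L z \<in> V"
    and z: "norm z < 1"
  shows "hom_part L N z \<in> V"
proof (induction N rule: less_induct)
  case (less N)
  have lin: "\<And>k l. linear (L k l)" using L by (simp add: poly_bounded_def)
  have scale: "hom_part L m (of_real r * z) = r ^ m *\<^sub>R hom_part L m z" for m r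
  proof -
    have "L k (m - k) ((of_real r * z) ^ k * cnj (of_real r * z) ^ (m - k)) = r ^ m *\<^sub>R L k (m - k) (z ^ k * cnj z ^ (m - k))"
      if "k \<le> m" for k
    proof -
      have "(of_real r * z) ^ k * cnj (of_real r * z) ^ (m - k) = of_real (r ^ k * r ^ (m - k)) * (z ^ k * cnj z ^ (m - k))"
        by (simp add: power_mult_distrib mult_ac)
      also have "\<dots> = r ^ m *\<^sub>R (z ^ k * cnj z ^ (m - k))"
        unfolding power_add[symmetric] using that by (simp add: scaleR_conv_of_real)
      finally show ?thesis by (simp only: linear_scale[OF lin])
    qed
    then show ?thesis by (simp add: hom_part_def scaleR_sum_right)
  qed
  define r where "r n = inverse (real (Suc n))" for n
  have r: "0 < r n" "r n \<le> 1" for n by (auto simp: r_def field_simps)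
  define X where "X n = inverse (r n ^ N) *\<^sub>R (psum L (of_real (r n) * z) - (\<Sum>m<N. r n ^ m *\<^sub>R hom_part L m z))" for n
  define S where "S = (\<Sum>m. norm (hom_part L (m + Suc N) z))"
  have sN: "summable (\<lambda>m. norm (hom_part L (m + Suc N) z))"
    by (rule summable_ignore_initial_segment[OF summable_norm_hom_part[OF L z]])
  have "norm (of_real (r n) * z) < 1" for n
    using r[of n] z mult_mono[of "r n" 1 "norm z" "norm z"] by (simp add: norm_mult)
  note rz = this
  have XV: "X n \<in> V" for n
    unfolding X_def
    by (intro subspace_scale subspace_diff subspace_sum V rz less) auto
  have est: "norm (X n - hom_part L N z) \<le> r n * S" for n
  proof -
    have s: "(\<lambda>m. hom_part L m (of_real (r n) * z)) sums psum L (of_real (r n) * z)"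
      unfolding psum_def by (intro summable_sums summable_hom_part L rz)
    have "(\<lambda>m. hom_part L (m + Suc N) (of_real (r n) * z)) sums
        (psum L (of_real (r n) * z) - (\<Sum>m<Suc N. hom_part L m (of_real (r n) * z)))"
      using sums_iff_shift[of "\<lambda>m. hom_part L m (of_real (r n) * z)" "Suc N"] s by simp
    from sums_scaleR_right[OF this, of "inverse (r n ^ N)"]
    have "(\<lambda>m. inverse (r n ^ N) *\<^sub>R hom_part L (m + Suc N) (of_real (r n) * z)) sums (X n - hom_part L N z)"
      unfolding scale X_def using r(1)[of n] by (simp add: algebra_simps)
    moreover have "inverse (r n ^ N) *\<^sub>R hom_part L (m + Suc N) (of_real (r n) * z) = r n ^ Suc m *\<^sub>R hom_part L (m + Suc N) z" for m
      unfolding scale using r(1)[of n] by (simp add: power_add field_simps)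
    ultimately have "X n - hom_part L N z = (\<Sum>m. r n ^ Suc m *\<^sub>R hom_part L (m + Suc N) z)"
      by (simp add: sums_iff)
    moreover have bnd: "norm (r n ^ Suc m *\<^sub>R hom_part L (m + Suc N) z) \<le> r n * norm (hom_part L (m + Suc N) z)" for m
      using r[of n] by (simp add: power_le_one mult_left_le mult_right_mono)
    ultimately show ?thesis
      using norm_suminf_le_complete(2)[OF bnd summable_mult[OF sN]]
      unfolding S_def suminf_mult[OF sN] by simp
  qed
  have "X \<longlonglongrightarrow> hom_part L N z"
  proof (rule LIM_zero_cancel, rule Lim_null_comparison)
    show "\<forall>\<^sub>F n in sequentially. norm (X n - hom_part L N z) \<le> r n * S" using est by simp
    have "(\<lambda>n. r n * S) \<longlonglongrightarrow> 0 * S" unfolding r_def by (intro tendsto_mult LIMSEQ_inverse_real_of_nat tendsto_const)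
    then show "(\<lambda>n. r n * S) \<longlonglongrightarrow> 0" by simp
  qed
  then show ?case using closed_sequentially[OF V(2)] XV by blast
qed



section \<open>Wirtinger derivatives\<close>

text \<open>
  \<open>A\<close> and \<open>B\<close> are the derivatives of \<open>f\<close> at \<open>z\<close> with respect to \<open>z\<close> and \<open>cnj z\<close>.
\<close>

definition wirtinger :: "(complex \<Rightarrow> complex) \<Rightarrow> complex \<Rightarrow> complex \<Rightarrow> complex \<Rightarrow> bool" where
  "wirtinger f z A B \<longleftrightarrow> (f has_derivative (\<lambda>v. A * v + B * cnj v)) (at z)"

lemma wirtinger_ident: "wirtinger (\<lambda>z. z) z 1 0"
  by (simp add: wirtinger_def)

lemma wirtinger_cnj: "wirtinger f z A B \<Longrightarrow> wirtinger (\<lambda>z. cnj (f z)) z (cnj B) (cnj A)"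
  unfolding wirtinger_def using bounded_linear.has_derivative[OF bounded_linear_cnj] by (fastforce simp: add.commute)

lemma wirtinger_diff:
  "wirtinger f z A B \<Longrightarrow> wirtinger g z A' B' \<Longrightarrow> wirtinger (\<lambda>z. f z - g z) z (A - A') (B - B')"
  unfolding wirtinger_def by (drule (1) has_derivative_diff) (simp add: algebra_simps)

lemma wirtinger_mult:
  "wirtinger f z A B \<Longrightarrow> wirtinger g z A' B' \<Longrightarrow>
     wirtinger (\<lambda>z. f z * g z) z (f z * A' + A * g z) (f z * B' + B * g z)"
  unfolding wirtinger_def by (drule (1) has_derivative_mult) (simp add: algebra_simps)

lemma wirtinger_const: "wirtinger (\<lambda>z. c) z 0 0"
  by (simp add: wirtinger_def)

lemma wirtinger_unique_eq:
  "wirtinger f z A B \<Longrightarrow> A = A' \<Longrightarrow> B = B' \<Longrightarrow> wirtinger f z A' B'"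
  by simp

lemma wirtinger_of_real:
  assumes "(f has_derivative (\<lambda>v. 2 * c * (z \<bullet> v))) (at z)"
  shows "wirtinger (\<lambda>z. of_real (f z)) z (of_real c * cnj z) (of_real c * z)"
proof -
  have "((\<lambda>z. of_real (f z) :: complex) has_derivative (\<lambda>v. of_real (2 * c * (z \<bullet> v)))) (at z)"
    using bounded_linear.has_derivative[OF bounded_linear_of_real assms] .
  moreover have "of_real (2 * c * (z \<bullet> v)) = of_real c * cnj z * v + of_real c * z * cnj v" for v
    by (simp add: complex_eq_iff inner_complex_def algebra_simps)
  ultimately show ?thesis by (simp add: wirtinger_def)
qed

lemma wirtinger_power:
  "wirtinger (\<lambda>z. z ^ n) z (of_nat n * z ^ (n - 1)) 0"
proof (induction n)
  case 0
  then show ?case by (simp add: wirtinger_def)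
next
  case (Suc n)
  show ?case unfolding power_Suc
    by (rule wirtinger_unique_eq[OF wirtinger_mult[OF wirtinger_ident Suc]])
       (cases n; simp add: algebra_simps)+
qed

section \<open>The Fourier coefficients of powers of the Poisson kernel\<close>

locale exponent =
  fixes t :: real
  assumes t_pos: "0 < t" and t_less_1: "t < 1"
begin

text \<open>
  The Taylor coefficients of \<open>(1 - x) powr - (1 + t)\<close>.
\<close>

definition b :: "nat \<Rightarrow> real" where "b k = pochhammer (1 + t) k / fact k"

lemma b_0: "b 0 = 1" by (simp add: b_def)

lemma b_Suc: "(real k + 1) * b (Suc k) = (real k + 1 + t) * b k"
proof -
  have "fact (Suc k) = (real k + 1) * fact k" "real k + 1 \<noteq> 0" by simp_all
  then show ?thesis unfolding b_def pochhammer_Suc by (simp add: divide_simps) (simp add: algebra_simps)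
qed

lemma b_ge_1: "b k \<ge> 1"
proof (induction k)
  case (Suc k)
  have "(real k + 1) * 1 \<le> (real k + 1 + t) * b k" using Suc t_pos by (intro mult_mono) auto
  then have "(real k + 1) * 1 \<le> (real k + 1) * b (Suc k)" by (simp only: b_Suc)
  then show ?case by (simp add: mult_le_cancel_left)
qed (simp add: b_0)

lemma b_le: "b k \<le> real k + 1"
proof (induction k)
  case (Suc k)
  have "(real k + 1) * b (Suc k) \<le> (real k + 1 + 1) * (real k + 1)"
    unfolding b_Suc using Suc t_pos t_less_1 b_ge_1[of k] by (intro mult_mono) auto
  then have "(real k + 1) * b (Suc k) \<le> (real k + 1) * (real (Suc k) + 1)" by (simp add: algebra_simps)
  then show ?case by (simp add: mult_le_cancel_left)
qed (simp add: b_0)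

text \<open>
  The hypergeometric series that occurs in the \<open>n\<close>-th Fourier coefficient: multiplying the
  expansions of \<open>(1 - z cnj \<zeta>) powr - (1 + t)\<close> and of its conjugate, the terms with \<open>cnj \<zeta> ^ n\<close> add up
  to \<open>z ^ n * h n (|z|\<^sup>2)\<close>.
\<close>

definition hser :: "nat \<Rightarrow> real fps" where "hser n = Abs_fps (\<lambda>k. b (n + k) * b k)"

definition h :: "nat \<Rightarrow> real \<Rightarrow> real" where "h n x = eval_fps (hser n) x"

definition h' :: "nat \<Rightarrow> real \<Rightarrow> real" where "h' n x = eval_fps (fps_deriv (hser n)) x"

lemma h_coeff_bound: "b (n + k) * b k \<le> (real n + 1) * (real k + 1) ^ 2"
proof -
  have "b (n + k) * b k \<le> (real (n + k) + 1) * (real k + 1)"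
    using b_le[of "n + k"] b_le[of k] b_ge_1[of "n + k"] b_ge_1[of k] by (intro mult_mono) auto
  also have "\<dots> \<le> ((real n + 1) * (real k + 1)) * (real k + 1)"
    by (intro mult_right_mono) (auto simp: algebra_simps)
  finally show ?thesis by (simp add: power2_eq_square)
qed

lemma summable_h:
  assumes "\<bar>x\<bar> < 1" shows "summable (\<lambda>k. b (n + k) * b k * x ^ k)"
proof (rule summable_comparison_test_ev[rotated])
  show "summable (\<lambda>k. (real n + 1) * ((real k + 1) ^ 2 * \<bar>x\<bar> ^ k))"
    using assms by (intro summable_mult summable_poly_times_power) simp
  have "norm (b (n + k) * b k * x ^ k) \<le> (real n + 1) * ((real k + 1) ^ 2 * \<bar>x\<bar> ^ k)" for k
    using mult_right_mono[OF h_coeff_bound[of n k], of "\<bar>x\<bar> ^ k"] b_ge_1[of "n + k"] b_ge_1[of k]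
    by (simp add: abs_mult power_abs mult.assoc)
  then show "\<forall>\<^sub>F k in sequentially. norm (b (n + k) * b k * x ^ k) \<le> (real n + 1) * ((real k + 1) ^ 2 * \<bar>x\<bar> ^ k)"
    by simp
qed

lemma h_sums: "\<bar>x\<bar> < 1 \<Longrightarrow> (\<lambda>k. b (n + k) * b k * x ^ k) sums h n x"
  using summable_h[of x n] by (simp add: h_def eval_fps_def hser_def summable_sums)

lemma conv_radius_h: "fps_conv_radius (hser n) \<ge> 1"
  unfolding fps_conv_radius_def hser_def fps_nth_Abs_fps
proof (rule conv_radius_geI_ex)
  fix r :: real assume r: "0 < r" "ereal r < 1"
  then show "\<exists>z::real. norm z = r \<and> summable (\<lambda>k. b (n + k) * b k * z ^ k)"
    by (intro exI[of _ r]) (auto intro!: summable_h)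
qed

lemma conv_h:
  assumes "\<bar>x::real\<bar> < 1" shows "ereal (norm x) < fps_conv_radius (hser n)"
    "ereal (norm x) < fps_conv_radius (fps_deriv (hser n))"
proof -
  show 1: "ereal (norm x) < fps_conv_radius (hser n)"
    by (rule less_le_trans[OF _ conv_radius_h]) (use assms in simp)
  show "ereal (norm x) < fps_conv_radius (fps_deriv (hser n))"
    by (rule less_le_trans[OF 1 fps_conv_radius_deriv])
qed

lemma h_deriv: "\<bar>x\<bar> < 1 \<Longrightarrow> (h n has_real_derivative h' n x) (at x)"
  using has_field_derivative_eval_fps[OF conv_h(1)] by (simp add: h_def[abs_def] h'_def)

text \<open>
  The two contiguity relations \<open>h_rec_up\<close> and \<open>h_rec_down\<close> express \<open>h'\<close> through the neighbours of
  \<open>h n\<close>; they are identities between the coefficients of power series that reduce to \<open>b_Suc\<close>.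
\<close>

lemma h_rec_up:
  assumes "\<bar>x\<bar> < 1"
  shows "(1 - x) * h' n x = (real n + 1 + t) * h n x - (real n - t) * h (Suc n) x"
proof -
  have "(1 - fps_X) * fps_deriv (hser n)
      = fps_const (real n + 1 + t) * hser n - fps_const (real n - t) * hser (Suc n)"
  proof (rule fps_ext)
    fix k
    have "(real k + 1) * b (n + Suc k) * b (Suc k) = (real k + 1 + t) * b (n + Suc k) * b k"
      using arg_cong[OF b_Suc[of k], of "\<lambda>x. b (n + Suc k) * x"] by (simp add: algebra_simps)
    moreover have "(real (n + k) + 1) * b (n + Suc k) = (real (n + k) + 1 + t) * b (n + k)"
      using b_Suc[of "n + k"] by simp
    then have "(real (n + k) + 1) * b (n + Suc k) * b k = (real (n + k) + 1 + t) * b (n + k) * b k" by simp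
    ultimately have "(real k + 1) * b (n + Suc k) * b (Suc k) - real k * b (n + k) * b k
       = (real n + 1 + t) * b (n + k) * b k - (real n - t) * b (n + Suc k) * b k"
      by (simp add: algebra_simps)
    then show "fps_nth ((1 - fps_X) * fps_deriv (hser n)) k
      = fps_nth (fps_const (real n + 1 + t) * hser n - fps_const (real n - t) * hser (Suc n)) k"
      by (cases k) (simp_all add: hser_def left_diff_distrib algebra_simps)
  qed
  then have "eval_fps ((1 - fps_X) * fps_deriv (hser n)) x
     = eval_fps (fps_const (real n + 1 + t) * hser n - fps_const (real n - t) * hser (Suc n)) x" by simp
  moreover have "ereal (norm x) < fps_conv_radius (fps_const c * hser m)" for c m
    using conv_h(1)[OF assms, of m] fps_conv_radius_mult[of "fps_const c" "hser m"] by simp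
  moreover have "ereal (norm x) < fps_conv_radius (1 - fps_X :: real fps)"
    using fps_conv_radius_diff[of "1 :: real fps" fps_X] by simp
  ultimately show ?thesis
    using conv_h[OF assms] by (simp add: eval_fps_mult eval_fps_diff h_def h'_def)
qed

lemma h_rec_down:
  assumes "\<bar>x\<bar> < 1"
  shows "x * (1 - x) * h' (Suc m) x + (real m + 1 - (1 + t) * x) * h (Suc m) x = (real m + 1 + t) * h m x"
proof -
  have "fps_X * ((1 - fps_X) * fps_deriv (hser (Suc m))) + fps_const (real m + 1) * hser (Suc m)
      - fps_const (1 + t) * (fps_X * hser (Suc m)) = fps_const (real m + 1 + t) * hser m"
  proof (rule fps_ext)
    fix k
    show "fps_nth (fps_X * ((1 - fps_X) * fps_deriv (hser (Suc m))) + fps_const (real m + 1) * hser (Suc m)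
      - fps_const (1 + t) * (fps_X * hser (Suc m))) k = fps_nth (fps_const (real m + 1 + t) * hser m) k"
    proof (cases k)
      case 0
      then show ?thesis using b_Suc[of m] by (simp add: hser_def b_0)
    next
      case (Suc j)
      have 1: "(real (m + k) + 1) * b (Suc (m + k)) * b k = (real (m + k) + 1 + t) * b (m + k) * b k"
        using b_Suc[of "m + k"] by simp
      have 2: "(real j + 1) * b (Suc (m + j)) * b (Suc j) = (real j + 1 + t) * b (Suc (m + j)) * b j"
        using arg_cong[OF b_Suc[of j], of "\<lambda>x. b (Suc (m + j)) * x"] by (simp add: algebra_simps)
      have "fps_nth (fps_X * ((1 - fps_X) * fps_deriv (hser (Suc m)))) k
          = (real j + 1) * b (Suc (m + k)) * b k - real j * b (Suc (m + j)) * b j"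
        unfolding Suc by (cases j) (simp_all add: hser_def left_diff_distrib algebra_simps)
      then show ?thesis using 1 2 unfolding Suc by (simp add: hser_def algebra_simps)
    qed
  qed
  then have "eval_fps (fps_X * ((1 - fps_X) * fps_deriv (hser (Suc m))) + fps_const (real m + 1) * hser (Suc m)
      - fps_const (1 + t) * (fps_X * hser (Suc m))) x = eval_fps (fps_const (real m + 1 + t) * hser m) x" by simp
  moreover have c: "ereal (norm x) < fps_conv_radius (f * g)"
    if "ereal (norm x) < fps_conv_radius f" "ereal (norm x) < fps_conv_radius g" for f g :: "real fps"
    using that fps_conv_radius_mult[of f g] by (simp add: min_def split: if_splits)
  moreover have "ereal (norm x) < fps_conv_radius (f + g)"
    if "ereal (norm x) < fps_conv_radius f" "ereal (norm x) < fps_conv_radius g" for f g :: "real fps"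
    using that fps_conv_radius_add[of f g] by (simp add: min_def split: if_splits)
  moreover have "ereal (norm x) < fps_conv_radius (1 - fps_X :: real fps)"
    using fps_conv_radius_diff[of "1 :: real fps" fps_X] by simp
  ultimately show ?thesis
    using conv_h[OF assms] by (simp add: eval_fps_mult eval_fps_diff eval_fps_add h_def h'_def algebra_simps)
qed

text \<open>
  Since \<open>b \<ge> 1\<close>, the series dominates the binomial series of \<open>(1 - x) powr - (1 + t)\<close> term by term.
\<close>

lemma h_ge:
  assumes "0 \<le> x" "x < 1" shows "h n x * (1 - x) powr (1 + t) \<ge> 1" "h n x \<ge> 0"
proof -
  have ax: "\<bar>x\<bar> < 1" using assms by simp
  have "(\<lambda>k. (- (1 + t) gchoose k) * (- x) ^ k) sums (1 + (- x)) powr (- (1 + t))"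
    by (rule gen_binomial_real) (use ax in simp)
  moreover have "(- (1 + t) gchoose k) * (- x) ^ k = b k * x ^ k" for k
  proof -
    have "(- (1 + t) gchoose k) = (- 1) ^ k * b k"
      by (simp only: gbinomial_pochhammer b_def minus_minus times_divide_eq_right)
    then have "(- (1 + t) gchoose k) * (- x) ^ k = ((- 1) ^ k * (- 1) ^ k) * (b k * x ^ k)"
      unfolding power_minus[of x] by (simp only: mult_ac)
    then show ?thesis by simp
  qed
  ultimately have s: "(\<lambda>k. b k * x ^ k) sums (1 - x) powr (- (1 + t))" by simp
  have "(1 - x) powr (- (1 + t)) \<le> h n x"
  proof (rule sums_le[OF _ s h_sums[OF ax]])
    fix k show "b k * x ^ k \<le> b (n + k) * b k * x ^ k"
      using b_ge_1[of "n + k"] b_ge_1[of k] assms by (intro mult_right_mono) auto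
  qed
  then have "(1 - x) powr (- (1 + t)) * (1 - x) powr (1 + t) \<le> h n x * (1 - x) powr (1 + t)"
    by (rule mult_right_mono) simp
  then show "h n x * (1 - x) powr (1 + t) \<ge> 1" using assms by (simp add: powr_add[symmetric])
  show "h n x \<ge> 0" using \<open>(1 - x) powr (- (1 + t)) \<le> h n x\<close> powr_ge_zero[of "1 - x" "- (1 + t)"] by linarith
qed

lemma h_le:
  assumes "0 \<le> x" "x < 1"
  shows "h n x \<le> (real n + 1) * (\<Sum>k. (real k + 1) ^ 2 * x ^ k)"
proof -
  have ax: "\<bar>x\<bar> < 1" using assms by simp
  have s: "(\<lambda>k. (real n + 1) * ((real k + 1) ^ 2 * x ^ k)) sums ((real n + 1) * (\<Sum>k. (real k + 1) ^ 2 * x ^ k))"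
    by (intro sums_mult summable_sums summable_poly_times_power ax)
  show ?thesis
  proof (rule sums_le[OF _ h_sums[OF ax] s])
    fix k show "b (n + k) * b k * x ^ k \<le> (real n + 1) * ((real k + 1) ^ 2 * x ^ k)"
      using mult_right_mono[OF h_coeff_bound[of n k], of "x ^ k"] assms by (simp add: mult.assoc)
  qed
qed

text \<open>
  The coefficient of \<open>cnj \<zeta> ^ n\<close> in the Fourier expansion of the power \<open>1 + t\<close> of the Poisson kernel.
\<close>

definition cn :: "nat \<Rightarrow> complex \<Rightarrow> complex" where
  "cn n z = of_real ((1 - (norm z)\<^sup>2) powr (1 + t) * h n ((norm z)\<^sup>2)) * z ^ n"

definition c :: "int \<Rightarrow> complex \<Rightarrow> complex" where
  "c n z = (if n \<ge> 0 then cn (nat n) z else cnj (cn (nat (- n)) z))"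

lemma c_nat: "c (int n) = cn n" by (simp add: c_def fun_eq_iff)

lemma cnj_cn_0: "cnj (cn 0 z) = cn 0 z" by (simp add: cn_def)

lemma cnj_c: "cnj (c n z) = c (- n) z"
  using cnj_cn_0[of z] by (auto simp: c_def)

lemma norm_sq_bounds: "norm (z::complex) < 1 \<Longrightarrow> \<bar>(norm z)\<^sup>2\<bar> < 1" "0 \<le> (norm z)\<^sup>2"
  by (simp_all add: abs_square_less_1)

lemma one_minus: "of_real (1 - (norm z)\<^sup>2) = 1 - z * cnj z"
  by (simp add: complex_norm_square del: of_real_power)

lemma cn_wirtinger:
  assumes z: "norm z < 1"
  defines "x \<equiv> (norm z)\<^sup>2"
  shows "wirtinger (cn n) z
     (of_real ((1 - x) powr t) * (of_real (real n * h n x - (real n - t) * h (Suc n) x) * cnj z * z ^ n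
        + of_real ((1 - x) * h n x * real n) * z ^ (n - 1)))
     (of_real ((1 - x) powr t) * of_real (real n * h n x - (real n - t) * h (Suc n) x) * z ^ Suc n)"
proof -
  have x: "\<bar>x\<bar> < 1" using norm_sq_bounds(1)[OF z] by (simp add: x_def)
  have y: "1 - x > 0" using disc_sq[OF z] by (simp add: x_def)
  have D1: "((\<lambda>z. (1 - (norm z)\<^sup>2) powr (1 + t)) has_derivative (\<lambda>v. (- 2 * (1 + t)) * ((z \<bullet> v) * (1 - x) powr t))) (at z)"
    using has_derivative_disc_powr[OF z, of "1 + t"] by (simp add: x_def)
  have "((\<lambda>z. (norm z)\<^sup>2) has_derivative (\<lambda>v. 2 * (z \<bullet> v))) (at z)"
    unfolding power2_norm_eq_inner by (auto intro!: derivative_eq_intros simp: inner_commute)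
  from has_derivative_compose[OF this h_deriv[OF x[unfolded x_def], of n, unfolded has_field_derivative_def]]
  have D2: "((\<lambda>z. h n ((norm z)\<^sup>2)) has_derivative (\<lambda>v. h' n x * (2 * (z \<bullet> v)))) (at z)"
    by (simp add: x_def)
  have yy: "(1 - x) powr (1 + t) = (1 - x) powr t * (1 - x)" using y by (simp add: powr_add mult.commute)
  define q where "q = (1 - x) powr t * (real n * h n x - (real n - t) * h (Suc n) x)"
  have q: "(1 - x) powr (1 + t) * h' n x - (1 + t) * (1 - x) powr t * h n x = q"
  proof -
    have "(1 - x) powr (1 + t) * h' n x - (1 + t) * (1 - x) powr t * h n x
       = (1 - x) powr t * ((1 - x) * h' n x - (1 + t) * h n x)" by (simp add: yy algebra_simps)
    also have "\<dots> = q" unfolding h_rec_up[OF x] q_def by (simp add: algebra_simps)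
    finally show ?thesis .
  qed
  have "((\<lambda>z. (1 - (norm z)\<^sup>2) powr (1 + t) * h n ((norm z)\<^sup>2)) has_derivative (\<lambda>v. 2 * q * (z \<bullet> v))) (at z)"
    using has_derivative_mult[OF D1 D2] by (simp add: x_def[symmetric] q[symmetric] algebra_simps)
  from wirtinger_mult[OF wirtinger_of_real[OF this] wirtinger_power[of n z]]
  show ?thesis unfolding cn_def[abs_def]
    by (rule wirtinger_unique_eq) (simp_all add: x_def[symmetric] q_def yy algebra_simps)
qed

text \<open>
  The product rule leaves \<open>h n\<close> and its derivative. In the derivative with respect to \<open>cnj z\<close> the
  latter is eliminated by \<open>h_rec_up\<close>, and in the derivative with respect to \<open>z\<close> by \<open>h_rec_down\<close> as well.
\<close>

lemma c_wirtinger_nonneg: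
  assumes z: "norm z < 1"
  shows "wirtinger (c (int n)) z
    (((of_nat n + of_real t) * c (int n - 1) z - of_nat n * cnj z * c (int n) z) / (1 - z * cnj z))
    ((of_nat n * z * c (int n) z - (of_nat n - of_real t) * c (int n + 1) z) / (1 - z * cnj z))"
proof -
  define x where "x = (norm z)\<^sup>2"
  have x: "\<bar>x\<bar> < 1" using norm_sq_bounds(1)[OF z] by (simp add: x_def)
  have y: "1 - x > 0" using disc_sq[OF z] by (simp add: x_def)
  have xc: "z * cnj z = of_real x" unfolding x_def by (rule complex_norm_square[symmetric])
  have yc: "1 - z * cnj z = of_real (1 - x)" unfolding xc by simp
  have y0: "complex_of_real (1 - x) \<noteq> 0" using y by (simp del: of_real_diff)
  have cS: "c (int n + 1) z = cn (Suc n) z" using c_nat[of "Suc n"] by (simp add: add.commute)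
  have yy: "(1 - x) powr (1 + t) = (1 - x) powr t * (1 - x)" using y by (simp add: powr_add mult.commute)
  have cn_x: "cn k z = of_real ((1 - x) powr t) * of_real (1 - x) * of_real (h k x) * z ^ k" for k
    by (simp add: cn_def x_def[symmetric] yy del: of_real_diff)
  have B: "of_real ((1 - x) powr t) * of_real (real n * h n x - (real n - t) * h (Suc n) x) * z ^ Suc n
     = (of_nat n * z * c (int n) z - (of_nat n - of_real t) * c (int n + 1) z) / (1 - z * cnj z)"
    unfolding cS c_nat cn_x yc using y0 by (simp add: field_simps del: of_real_diff) (simp add: algebra_simps)
  have A: "of_real ((1 - x) powr t) * (of_real (real n * h n x - (real n - t) * h (Suc n) x) * cnj z * z ^ n
        + of_real ((1 - x) * h n x * real n) * z ^ (n - 1))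
     = ((of_nat n + of_real t) * c (int n - 1) z - of_nat n * cnj z * c (int n) z) / (1 - z * cnj z)"
  proof (cases n)
    case 0
    have "c (- 1) z = cnj (cn 1 z)" by (simp add: c_def)
    then show ?thesis unfolding 0 c_nat yc using y0
      by (simp add: cn_x c_nat[of 0, simplified] field_simps del: of_real_diff)
  next
    case (Suc m)
    have cm: "c (int n - 1) z = cn m z" using c_nat[of m] by (simp add: Suc)
    have "x * (real n * h n x - (real n - t) * h (Suc n) x) + (1 - x) * h n x * real n
        = (real n + t) * h m x - real n * x * h n x"
    proof -
      have "(real n + t) * h m x = x * ((1 - x) * h' n x) + (real n - (1 + t) * x) * h n x"
        using h_rec_down[OF x, of m] by (simp add: Suc algebra_simps)
      then show ?thesis unfolding h_rec_up[OF x] by (simp add: algebra_simps)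
    qed
    then have e: "of_real (real n * h n x - (real n - t) * h (Suc n) x) * (of_real x :: complex)
       + of_real ((1 - x) * h n x * real n) = of_real ((real n + t) * h m x - real n * x * h n x)"
      by (metis mult.commute of_real_add of_real_mult)
    have "of_real (real n * h n x - (real n - t) * h (Suc n) x) * cnj z * z ^ n
        + of_real ((1 - x) * h n x * real n) * z ^ (n - 1)
        = (of_real (real n * h n x - (real n - t) * h (Suc n) x) * (z * cnj z)
       + of_real ((1 - x) * h n x * real n)) * z ^ m"
      unfolding Suc by (simp add: algebra_simps)
    also have "\<dots> = of_real ((real n + t) * h m x - real n * x * h n x) * z ^ m" unfolding xc e ..
    finally have 1: "of_real ((1 - x) powr t) * (of_real (real n * h n x - (real n - t) * h (Suc n) x) * cnj z * z ^ n
        + of_real ((1 - x) * h n x * real n) * z ^ (n - 1))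
       = of_real ((1 - x) powr t) * of_real ((real n + t) * h m x - real n * x * h n x) * z ^ m" by simp
    have "(of_nat n + of_real t) * cn m z - of_nat n * cnj z * cn n z
        = of_real ((1 - x) powr t) * of_real (1 - x) *
          ((of_nat n + of_real t) * of_real (h m x) - of_nat n * (z * cnj z) * of_real (h n x)) * z ^ m"
      unfolding cn_x Suc by (simp add: algebra_simps del: of_real_diff)
    also have "\<dots> = of_real (1 - x) * (of_real ((1 - x) powr t) * of_real ((real n + t) * h m x - real n * x * h n x) * z ^ m)"
      unfolding xc by (simp add: algebra_simps)
    finally show ?thesis unfolding 1 cm c_nat yc using y0 by (simp add: field_simps del: of_real_diff)
  qed
  show ?thesis
    using cn_wirtinger[OF z, of n] unfolding c_nat[symmetric, of n] x_def[symmetric] A B .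
qed

text \<open>
  The derivatives of \<open>c n\<close> with respect to \<open>z\<close> and \<open>cnj z\<close>. They involve only the neighbouring
  coefficients, and conjugation exchanges them and changes the sign of \<open>n\<close>.
\<close>

definition cA :: "int \<Rightarrow> complex \<Rightarrow> complex" where
  "cA n z = ((of_int n + of_real t) * c (n - 1) z - of_int n * cnj z * c n z) / (1 - z * cnj z)"

definition cB :: "int \<Rightarrow> complex \<Rightarrow> complex" where
  "cB n z = (of_int n * z * c n z - (of_int n - of_real t) * c (n + 1) z) / (1 - z * cnj z)"

lemma cnj_cA: "cnj (cA n z) = cB (- n) z"
proof -
  have "cnj (c (n - 1) z) = c (- n + 1) z" by (simp add: cnj_c)
  then show ?thesis by (simp add: cA_def cB_def cnj_c algebra_simps)
qed

lemma cnj_cB: "cnj (cB n z) = cA (- n) z"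
  using cnj_cA[of "- n" z] by (metis complex_cnj_cnj minus_minus)

lemma c_wirtinger:
  assumes z: "norm z < 1"
  shows "wirtinger (c n) z (cA n z) (cB n z)"
proof (cases "n \<ge> 0")
  case True
  then obtain m where "n = int m" using nonneg_int_cases by blast
  then show ?thesis using c_wirtinger_nonneg[OF z, of m] by (simp add: cA_def cB_def)
next
  case False
  then have "0 \<le> - n" by simp
  then obtain m where m: "- n = int m" by (rule nonneg_int_cases)
  have "wirtinger (c (- n)) z (cA (- n) z) (cB (- n) z)"
    unfolding m using c_wirtinger_nonneg[OF z, of m] by (simp add: cA_def cB_def)
  from wirtinger_cnj[OF this] show ?thesis by (simp add: cnj_c cnj_cA cnj_cB)
qed

text \<open>
  The contiguity relations with the derivative of \<open>h n\<close> eliminated.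
\<close>

lemma c_three_term_nonneg:
  assumes z: "norm z < 1"
  shows "(of_nat n + of_real t) * z * c (int n - 1) z + (of_nat n - of_real t) * cnj z * c (int n + 1) z
     = of_nat n * (1 + z * cnj z) * c (int n) z"
proof -
  define x where "x = (norm z)\<^sup>2"
  have x: "\<bar>x\<bar> < 1" using norm_sq_bounds(1)[OF z] by (simp add: x_def)
  have xc: "z * cnj z = of_real x" unfolding x_def by (rule complex_norm_square[symmetric])
  have cS: "c (int n + 1) z = cn (Suc n) z" using c_nat[of "Suc n"] by (simp add: add.commute)
  show ?thesis
  proof (cases n)
    case 0
    have "c (- 1) z = cnj (cn 1 z)" by (simp add: c_def)
    moreover have "c 1 z = cn 1 z" by (simp add: c_def)
    ultimately show ?thesis by (simp add: 0 cn_def)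
  next
    case (Suc m)
    have cm: "c (int n - 1) z = cn m z" using c_nat[of m] by (simp add: Suc)
    have zn: "z ^ n = z * z ^ m" by (simp add: Suc)
    have e: "(real n + t) * h m x + (real n - t) * x * h (Suc n) x = real n * (1 + x) * h n x"
    proof -
      have "(real n + t) * h m x = x * ((1 - x) * h' n x) + (real n - (1 + t) * x) * h n x"
        using h_rec_down[OF x, of m] by (simp add: Suc algebra_simps)
      then show ?thesis unfolding h_rec_up[OF x] by (simp add: algebra_simps)
    qed
    have "(of_nat n + of_real t) * z * cn m z + (of_nat n - of_real t) * cnj z * cn (Suc n) z
      = of_real ((1 - x) powr (1 + t)) * (of_real ((real n + t) * h m x) + of_real ((real n - t) * h (Suc n) x) * (z * cnj z)) * z ^ n"
      unfolding cn_def x_def[symmetric] zn power_Suc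
      by (simp only: of_real_mult of_real_add of_real_diff of_real_of_nat_eq) (simp add: algebra_simps)
    also have "\<dots> = of_real ((1 - x) powr (1 + t)) * of_real ((real n + t) * h m x + (real n - t) * x * h (Suc n) x) * z ^ n"
      unfolding xc by (simp add: algebra_simps)
    also have "\<dots> = of_nat n * (1 + z * cnj z) * cn n z"
      unfolding e xc by (simp add: cn_def x_def[symmetric] algebra_simps)
    finally show ?thesis by (simp only: cm cS c_nat)
  qed
qed

lemma c_three_term:
  assumes z: "norm z < 1"
  shows "(of_int n + of_real t) * z * c (n - 1) z + (of_int n - of_real t) * cnj z * c (n + 1) z
     = of_int n * (1 + z * cnj z) * c n z"
proof (cases "n \<ge> 0")
  case True
  then obtain m where "n = int m" using nonneg_int_cases by blast
  then show ?thesis using c_three_term_nonneg[OF z, of m] by simp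
next
  case False
  then have "0 \<le> - n" by simp
  then obtain m where "- n = int m" by (rule nonneg_int_cases)
  then have m: "n = - int m" by simp
  have 1: "c (n - 1) z = cnj (c (int m + 1) z)" "c (n + 1) z = cnj (c (int m - 1) z)" "c n z = cnj (c (int m) z)"
    by (simp_all add: cnj_c m)
  show ?thesis
    using arg_cong[OF c_three_term_nonneg[OF z, of m], of cnj] unfolding 1
    by (simp add: m algebra_simps)
qed

text \<open>
  The vector field \<open>1 - z\<^sup>2\<close> generates the translations along the real axis. In this direction the terms with
  coefficients depending on \<open>z\<close> cancel by \<open>c_three_term\<close>: the infinitesimal translation acts on the
  sequence of Fourier coefficients by a constant matrix with two nonzero diagonals.
\<close>

lemma c_translation:
  assumes z: "norm z < 1"
  shows "cA n z * (1 - z\<^sup>2) + cB n z * cnj (1 - z\<^sup>2)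
     = (of_int n + of_real t) * c (n - 1) z - (of_int n - of_real t) * c (n + 1) z"
proof -
  have y0: "1 - z * cnj z \<noteq> 0"
    using disc_sq[OF z] unfolding one_minus[symmetric] by (simp del: of_real_diff)
  define P Q R where "P = (of_int n + of_real t) * c (n - 1) z" and "Q = of_int n * c n z"
    and "R = (of_int n - of_real t) * c (n + 1) z"
  have tt: "z * P + cnj z * R = (1 + z * cnj z) * Q"
    using c_three_term[OF z, of n] by (simp add: P_def Q_def R_def algebra_simps)
  have "(P - cnj z * Q) * (1 - z\<^sup>2) + (z * Q - R) * (1 - (cnj z)\<^sup>2)
     = (P - R) * (1 - z * cnj z) + (z - cnj z) * ((1 + z * cnj z) * Q - (z * P + cnj z * R))"
    by (simp add: algebra_simps power2_eq_square)
  then have "(P - cnj z * Q) * (1 - z\<^sup>2) + (z * Q - R) * (1 - (cnj z)\<^sup>2) = (P - R) * (1 - z * cnj z)"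
    by (simp add: tt)
  moreover have "cA n z = (P - cnj z * Q) / (1 - z * cnj z)" "cB n z = (z * Q - R) / (1 - z * cnj z)"
    by (simp_all add: cA_def cB_def P_def Q_def R_def mult_ac)
  ultimately have "cA n z * (1 - z\<^sup>2) + cB n z * (1 - (cnj z)\<^sup>2) = P - R"
    using y0 by (simp add: add_divide_distrib[symmetric])
  then show ?thesis by (simp add: P_def R_def)
qed

text \<open>
  Applying the first order system twice and using \<open>c_three_term\<close> shows that the mixed second derivative of
  \<open>c n\<close> is a multiple of \<open>c n\<close> itself that does not depend on \<open>n\<close>: each coefficient satisfies the
  eigenvalue equation of the hyperbolic Laplacian.
\<close>

lemma cA_wirtinger:
  assumes z: "norm z < 1"
  shows "\<exists>A. wirtinger (cA n) z A (of_real (t * (t + 1)) * c n z / (1 - z * cnj z)\<^sup>2)"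
proof -
  define y where "y = 1 - z * cnj z"
  have y0: "y \<noteq> 0"
    using disc_sq[OF z] unfolding y_def one_minus[symmetric] by (simp del: of_real_diff)
  have "((\<lambda>z. inverse (1 - (norm z)\<^sup>2)) has_derivative (\<lambda>v. 2 * (1 / (1 - (norm z)\<^sup>2)\<^sup>2) * (z \<bullet> v))) (at z)"
    using has_derivative_compose[OF has_derivative_norm_sq DERIV_inverse[unfolded has_field_derivative_def], of z]
      disc_sq[OF z]
    by (simp add: power2_eq_square field_simps)
  from wirtinger_of_real[OF this]
  have wy: "wirtinger (\<lambda>z. inverse (1 - z * cnj z)) z (cnj z / y\<^sup>2) (z / y\<^sup>2)"
    by (simp only: of_real_inverse of_real_divide of_real_power one_minus y_def of_real_1) simp
  have cz: "wirtinger cnj z 0 1" using wirtinger_cnj[OF wirtinger_ident] by simp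
  note w = wirtinger_mult[OF wirtinger_diff[OF wirtinger_mult[OF wirtinger_const[of "of_int n + of_real t"] c_wirtinger[OF z, of "n - 1"]]
      wirtinger_mult[OF wirtinger_mult[OF wirtinger_const[of "of_int n"] cz] c_wirtinger[OF z, of n]]] wy]
  have eq: "cA n = (\<lambda>z. ((of_int n + of_real t) * c (n - 1) z - of_int n * cnj z * c n z) * inverse (1 - z * cnj z))"
    by (simp add: cA_def fun_eq_iff divide_inverse)
  define P Q R T m where "P = c (n - 1) z" and "Q = c n z" and "R = c (n + 1) z" and "T = complex_of_real t"
    and "m = (of_int n :: complex)"
  have tt: "(m - T) * cnj z * R = m * (1 + z * cnj z) * Q - (m + T) * z * P"
    using c_three_term[OF z, of n] by (simp add: P_def Q_def R_def T_def m_def algebra_simps)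
  \<comment> \<open>The numerator of the mixed second derivative; \<open>tt\<close> removes the coefficient \<open>R\<close> of index \<open>n + 1\<close>.\<close>
  have e: "(m + T) * ((m - 1) * z * P - (m - 1 - T) * Q) - (m * Q * y + m * cnj z * (m * z * Q - (m - T) * R))
     + ((m + T) * P - m * cnj z * Q) * z = T * (T + 1) * Q"
  proof -
    have "(m + T) * ((m - 1) * z * P - (m - 1 - T) * Q) - (m * Q * y + m * cnj z * (m * z * Q - (m - T) * R))
     + ((m + T) * P - m * cnj z * Q) * z
     = (m + T) * ((m - 1) * z * P - (m - 1 - T) * Q) - (m * Q * y + m * cnj z * (m * z * Q)) + m * ((m - T) * cnj z * R)
     + ((m + T) * P - m * cnj z * Q) * z" by (simp add: algebra_simps)
    also have "\<dots> = T * (T + 1) * Q" unfolding tt y_def by (simp add: algebra_simps)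
    finally show ?thesis .
  qed
  have B1: "cB (n - 1) z = ((m - 1) * z * P - (m - 1 - T) * Q) / y"
    by (simp add: cB_def m_def P_def Q_def T_def y_def)
  have B2: "cB n z = (m * z * Q - (m - T) * R) / y"
    by (simp add: cB_def m_def R_def Q_def T_def y_def)
  have fin: "((m + T) * P - m * cnj z * Q) * (z / y\<^sup>2) + ((m + T) * cB (n - 1) z - (m * cnj z * cB n z + m * Q)) * inverse y
      = T * (T + 1) * Q / y\<^sup>2"
  proof -
    have "((m + T) * P - m * cnj z * Q) * (z / y\<^sup>2) + ((m + T) * cB (n - 1) z - (m * cnj z * cB n z + m * Q)) * inverse y
      = ((m + T) * ((m - 1) * z * P - (m - 1 - T) * Q) - (m * Q * y + m * cnj z * (m * z * Q - (m - T) * R))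
     + ((m + T) * P - m * cnj z * Q) * z) / y\<^sup>2"
      unfolding B1 B2 using y0 by (simp add: divide_simps power2_eq_square)
    then show ?thesis unfolding e .
  qed
  show ?thesis unfolding eq
    by (rule exI, rule wirtinger_unique_eq[OF w refl])
       (use fin in \<open>simp add: P_def Q_def T_def m_def y_def algebra_simps\<close>)
qed

lemma cB_wirtinger:
  assumes z: "norm z < 1"
  shows "\<exists>B. wirtinger (cB n) z (of_real (t * (t + 1)) * c n z / (1 - z * cnj z)\<^sup>2) B"
proof -
  obtain A where "wirtinger (cA (- n)) z A (of_real (t * (t + 1)) * c (- n) z / (1 - z * cnj z)\<^sup>2)"
    using cA_wirtinger[OF z] by blast
  from wirtinger_cnj[OF this] show ?thesis
    by (auto simp: cnj_cA cnj_c mult.commute[of "cnj z"])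
qed

text \<open>
  The factor of \<open>z\<close> in \<open>cn 1 z\<close> is at least \<open>1\<close> by \<open>h_ge\<close>. Thus one Fourier coefficient
  controls the distance of \<open>z\<close> from the origin, all the way to the boundary of the disc.
\<close>

lemma norm_cn_ge: "norm z < 1 \<Longrightarrow> norm (cn 1 z) \<ge> norm z"
proof -
  assume z: "norm z < 1"
  have "1 * norm z \<le> (h 1 ((norm z)\<^sup>2) * (1 - (norm z)\<^sup>2) powr (1 + t)) * norm z"
    using norm_sq_bounds(1)[OF z] by (intro mult_right_mono h_ge) auto
  then show ?thesis using h_ge(2)[of "(norm z)\<^sup>2" 1] norm_sq_bounds(1)[OF z] by (simp add: cn_def norm_mult mult_ac)
qed

lemma norm_cn_le:
  assumes "norm z < 1" obtains M where "\<And>n. norm (cn n z) \<le> M * ((real n + 1) * norm z ^ n)"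
proof
  fix n
  define x where "x = (norm z)\<^sup>2"
  have x: "0 \<le> x" "x < 1" using norm_sq_bounds(1)[OF assms] by (auto simp: x_def)
  have "norm (cn n z) = ((1 - x) powr (1 + t) * norm z ^ n) * h n x"
    using h_ge(2)[OF x, of n] by (simp add: cn_def norm_mult norm_power x_def mult_ac)
  also have "\<dots> \<le> ((1 - x) powr (1 + t) * norm z ^ n) * ((real n + 1) * (\<Sum>k. (real k + 1) ^ 2 * x ^ k))"
    by (intro mult_left_mono h_le x) auto
  finally show "norm (cn n z) \<le> ((1 - x) powr (1 + t) * (\<Sum>k. (real k + 1) ^ 2 * x ^ k)) * ((real n + 1) * norm z ^ n)"
    by (simp add: mult_ac)
qed

lemma cn_rotate: "norm \<omega> = 1 \<Longrightarrow> cn n (\<omega> * z) = \<omega> ^ n * cn n z"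
  by (simp add: cn_def norm_mult power_mult_distrib)

lemma cn_at_0: "cn n 0 = (if n = 0 then 1 else 0)"
  by (simp add: cn_def h_def eval_fps_at_0 hser_def b_0)

end



section \<open>The equivariant map\<close>

text \<open>
  The basis vector \<open>e 0\<close> plays the role of \<open>u\<close> and spans the constants; the pair of \<open>e (2 n - 1)\<close> and
  \<open>e (2 n)\<close> carries the real and imaginary parts of the Fourier coefficients of index \<open>n\<close>. Those of index
  \<open>- n\<close> are their conjugates.
\<close>

locale model = exponent t for t :: real +
  fixes e :: "nat \<Rightarrow> 'h::{real_inner, complete_space}"
  assumes orthonormal: "e i \<bullet> e j = (if i = j then 1 else 0)"
    and total: "closure (span (range e)) = UNIV"
begin

abbreviation u :: 'h where "u \<equiv> e 0"

sublocale lorentz "e 0"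
  by unfold_locales (simp add: norm_eq_sqrt_inner orthonormal)

text \<open>
  The invariant form on the Fourier mode \<open>n\<close>.
\<close>

definition lam :: "nat \<Rightarrow> real" where "lam n = (\<Prod>k<n. (real k - t) / (real k + 1 + t))"

lemma lam_0: "lam 0 = 1" by (simp add: lam_def)

lemma lam_Suc: "lam (Suc n) * (real n + 1 + t) = lam n * (real n - t)"
  using t_pos by (simp add: lam_def)

lemma lam_neg: "lam (Suc n) < 0"
proof (induction n)
  case 0
  then show ?case using t_pos t_less_1 by (simp add: lam_def divide_neg_pos)
next
  case (Suc n)
  have "lam (Suc (Suc n)) * (real (Suc n) + 1 + t) < 0"
    unfolding lam_Suc using Suc t_less_1 by (intro mult_neg_pos) auto
  then show ?case using t_pos by (simp add: mult_less_0_iff)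
qed

lemma abs_lam_le: "\<bar>lam n\<bar> \<le> 1"
proof -
  have "\<bar>(real k - t) / (real k + 1 + t)\<bar> \<le> 1" for k
    using t_pos t_less_1 by (simp add: abs_le_iff divide_simps)
  then show ?thesis unfolding lam_def abs_prod by (intro prod_le_1) auto
qed

text \<open>
  The factor \<open>2\<close> accounts for the modes \<open>n\<close> and \<open>- n\<close>, which are carried by the same pair of vectors.
\<close>

definition mu :: "nat \<Rightarrow> real" where "mu n = (if n = 0 then 1 else sqrt (2 * \<bar>lam n\<bar>))"

lemma mu_pos: "mu n > 0"
  using lam_neg[of "n - 1"] by (cases n) (auto simp: mu_def)

lemma mu_le: "mu n \<le> 2"
  using abs_lam_le[of n] real_sqrt_le_mono[of "2 * \<bar>lam n\<bar>" "2\<^sup>2"] by (auto simp: mu_def simp del: real_sqrt_le_iff)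

text \<open>
  \<open>ev n w\<close> is the vector whose \<open>n\<close>-th Fourier coefficient is \<open>w\<close>, and \<open>cf n x\<close> is the \<open>n\<close>-th
  Fourier coefficient of \<open>x\<close>. Since \<open>ev 0\<close> has rank one, \<open>cf 0\<close> inverts it on real numbers only.
\<close>

definition ev :: "nat \<Rightarrow> complex \<Rightarrow> 'h" where
  "ev n w = (if n = 0 then Re w *\<^sub>R e 0 else mu n *\<^sub>R (Re w *\<^sub>R e (2 * n - 1) + Im w *\<^sub>R e (2 * n)))"

definition cf :: "nat \<Rightarrow> 'h \<Rightarrow> complex" where
  "cf n x = (if n = 0 then of_real (x \<bullet> e 0) else Complex (x \<bullet> e (2 * n - 1)) (x \<bullet> e (2 * n)) / of_real (mu n))"

text \<open>
  The form \<open>lor u\<close> in terms of Fourier coefficients of index \<open>n \<ge> 0\<close>, by \<open>lor_ev\<close>.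
\<close>

definition kap :: "nat \<Rightarrow> real" where "kap n = (if n = 0 then 1 else 2 * lam n)"

lemma mu_sq: "n > 0 \<Longrightarrow> (mu n)\<^sup>2 = - kap n"
  using lam_neg[of "n - 1"] by (cases n) (auto simp: mu_def kap_def)

lemma norm_e: "norm (e n) = 1"
  by (simp add: norm_eq_sqrt_inner orthonormal)

lemma norm_ev_le: "norm (ev n w) \<le> 4 * norm w"
proof (cases "n = 0")
  case True
  then show ?thesis using abs_Re_le_cmod[of w] norm_ge_zero[of w] by (simp add: ev_def norm_e del: norm_ge_zero)
next
  case False
  have "norm (Re w *\<^sub>R e (2 * n - 1) + Im w *\<^sub>R e (2 * n)) \<le> \<bar>Re w\<bar> + \<bar>Im w\<bar>"
    by (rule order_trans[OF norm_triangle_ineq]) (simp add: norm_e)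
  also have "\<dots> \<le> 2 * norm w" using abs_Re_le_cmod[of w] abs_Im_le_cmod[of w] by simp
  finally have "mu n * norm (Re w *\<^sub>R e (2 * n - 1) + Im w *\<^sub>R e (2 * n)) \<le> 2 * (2 * norm w)"
    using mu_le[of n] mu_pos[of n] by (intro mult_mono) auto
  then show ?thesis using False mu_pos[of n] by (simp add: ev_def)
qed

lemma linear_ev: "linear (ev n)"
  by (rule linearI) (auto simp: ev_def algebra_simps)

lemma bounded_linear_cf: "bounded_linear (cf n)"
proof -
  have eq: "cf n = (\<lambda>x. of_real (x \<bullet> e (if n = 0 then 0 else 2 * n - 1)) * (1 / of_real (mu n))
     + of_real (if n = 0 then 0 else x \<bullet> e (2 * n)) * (\<i> / of_real (mu n)))"
    by (auto simp: cf_def fun_eq_iff mu_def complex_eq_iff)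
  show ?thesis unfolding eq
    by (cases "n = 0")
      (simp_all add: bounded_linear_add bounded_linear_mult_const
        bounded_linear_compose[OF bounded_linear_of_real bounded_linear_inner_left] bounded_linear_compose[OF bounded_linear_divide])
qed

lemma cf_ev: "cf m (ev n w) = (if m = n then (if n = 0 then of_real (Re w) else w) else 0)"
proof -
  have idx: "(2 * i - 1 = 2 * j - 1) = (i = j)" "2 * i - 1 \<noteq> 2 * j" "2 * i \<noteq> 2 * j - 1" "2 * i - 1 \<noteq> 0"
    "0 \<noteq> 2 * i - 1" if "i > 0" "j > 0" for i j :: nat
    using that by presburger+
  show ?thesis
  proof (cases "n = 0"; cases "m = 0")
    assume "n = 0" "m = 0"
    then show ?thesis by (simp add: cf_def ev_def orthonormal)
  next
    assume "n = 0" "m \<noteq> 0"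
    then show ?thesis using idx(5)[of m m] by (simp add: cf_def ev_def orthonormal complex_eq_iff)
  next
    assume "n \<noteq> 0" "m = 0"
    then show ?thesis using idx(4)[of n n] by (simp add: cf_def ev_def orthonormal inner_add_left)
  next
    assume nm: "n \<noteq> 0" "m \<noteq> 0"
    then have i: "ev n w \<bullet> e (2 * m - 1) = (if m = n then mu n * Re w else 0)"
        "ev n w \<bullet> e (2 * m) = (if m = n then mu n * Im w else 0)"
      using idx[of n m] by (auto simp: ev_def orthonormal inner_add_left)
    show ?thesis using nm mu_pos[of n] unfolding cf_def i by (simp add: complex_eq_iff)
  qed
qed

lemma cf_total:
  assumes "\<And>n. cf n x = 0" shows "x = 0"
proof -
  have "x \<bullet> e j = 0" for j
  proof (cases "j = 0")
    case True
    then show ?thesis using assms[of 0] by (simp add: cf_def)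
  next
    case False
    define n where "n = (j + 1) div 2"
    have n: "n > 0" "j = 2 * n - 1 \<or> j = 2 * n" using False by (auto simp: n_def)
    have "Complex (x \<bullet> e (2 * n - 1)) (x \<bullet> e (2 * n)) = 0"
      using assms[of n] n(1) mu_pos[of n] by (simp add: cf_def)
    then show ?thesis using n(2) by (auto simp: complex_eq_iff)
  qed
  then have "(\<lambda>y. x \<bullet> y) = (\<lambda>y. 0)"
    by (intro closed_span_eq_if_bounded_linear_agree[OF bounded_linear_inner_right bounded_linear_zero total]) auto
  then have "x \<bullet> x = 0" by metis
  then show ?thesis by simp
qed

lemma cf_eqI: "(\<And>n. cf n x = cf n y) \<Longrightarrow> x = y"
  using cf_total[of "x - y"] linear_diff[OF bounded_linear.linear[OF bounded_linear_cf]] by simp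

text \<open>
  The expansion of the two binomial series in the Poisson kernel. The terms with \<open>k < l\<close> contribute to
  negative Fourier modes and are omitted, being conjugate to those with \<open>l < k\<close>.
\<close>

definition L :: "nat \<Rightarrow> nat \<Rightarrow> complex \<Rightarrow> 'h" where
  "L k l w = (if l \<le> k then (b k * b l) *\<^sub>R ev (k - l) w else 0)"

lemma poly_bounded_L: "poly_bounded L"
  unfolding poly_bounded_def
proof (intro conjI allI exI)
  show "linear (L k l)" for k l
    unfolding L_def by (cases "l \<le> k") (auto intro: linear_compose_scale_right linear_ev linear_zero)
  show "(0::real) \<le> 4" by simp
  fix k l w
  have "norm ((b k * b l) *\<^sub>R ev (k - l) w) \<le> ((real k + 1) * (real l + 1)) * (4 * norm w)"
    using b_ge_1[of k] b_ge_1[of l] b_le[of k] b_le[of l] norm_ev_le[of "k - l" w]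
    unfolding norm_scaleR by (intro mult_mono) (auto simp: abs_mult intro!: mult_mono)
  also have "\<dots> \<le> ((real (k + l) + 1) * (real (k + l) + 1)) * (4 * norm w)"
    by (intro mult_right_mono mult_mono) auto
  also have "\<dots> = 4 * (real (k + l) + 1) ^ 2 * norm w" by (simp only: power2_eq_square mult_ac)
  finally show "norm (L k l w) \<le> 4 * (real (k + l) + 1) ^ 2 * norm w" by (simp add: L_def)
qed

definition F :: "complex \<Rightarrow> 'h" where "F z = (1 - (norm z)\<^sup>2) powr (1 + t) *\<^sub>R psum L z"

lemma cf_hom_part:
  "cf n (hom_part L N z) = (if n \<le> N \<and> even (N - n)
     then of_real (b (n + (N - n) div 2) * b ((N - n) div 2)) * (z ^ (n + (N - n) div 2) * cnj z ^ ((N - n) div 2)) else 0)"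
proof -
  interpret cf: bounded_linear "cf n" by (rule bounded_linear_cf)
  define l where "l = (N - n) div 2"
  have real: "of_real (Re (z ^ k * cnj z ^ k)) = z ^ k * cnj z ^ k" for k
  proof -
    have "z ^ k * cnj z ^ k = of_real (((norm z)\<^sup>2) ^ k)"
      by (simp only: power_mult_distrib[symmetric] complex_norm_square[symmetric] of_real_power)
    then show ?thesis by (simp only: Re_complex_of_real)
  qed
  have "cf n (hom_part L N z) = (\<Sum>k\<le>N. cf n (L k (N - k) (z ^ k * cnj z ^ (N - k))))"
    by (simp add: hom_part_def cf.sum)
  also have "\<dots> = (\<Sum>k\<le>N. if k = n + l \<and> n \<le> N \<and> even (N - n)
      then of_real (b (n + l) * b l) * (z ^ (n + l) * cnj z ^ l) else 0)"
  proof (rule sum.cong)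
    fix k assume k: "k \<in> {..N}"
    show "cf n (L k (N - k) (z ^ k * cnj z ^ (N - k))) = (if k = n + l \<and> n \<le> N \<and> even (N - n)
      then of_real (b (n + l) * b l) * (z ^ (n + l) * cnj z ^ l) else 0)"
    proof (cases "N - k \<le> k \<and> n = k - (N - k)")
      case True
      then have N: "k = n + l" "n \<le> N" "even (N - n)" "N - k = l" using k by (auto simp: l_def)
      have "cf n (ev n (z ^ (n + l) * cnj z ^ l)) = z ^ (n + l) * cnj z ^ l"
        unfolding cf_ev using real[of l] by (cases "n = 0") (simp_all only: if_True if_False add_0 simp_thms)
      then have "cf n (L (n + l) l (z ^ (n + l) * cnj z ^ l)) = of_real (b (n + l) * b l) * (z ^ (n + l) * cnj z ^ l)"
        by (simp add: L_def cf.scaleR scaleR_conv_of_real)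
      then have "cf n (L k (N - k) (z ^ k * cnj z ^ (N - k))) = of_real (b (n + l) * b l) * (z ^ (n + l) * cnj z ^ l)"
        by (simp only: N(1)[symmetric] N(4))
      then show ?thesis using N by simp
    next
      case False
      have "\<not> (k = n + l \<and> n \<le> N \<and> even (N - n))"
      proof
        assume a: "k = n + l \<and> n \<le> N \<and> even (N - n)"
        then have "even (N - n)" by blast
        then have "2 * l = N - n" unfolding l_def by (rule dvd_mult_div_cancel)
        then show False using a False k by auto
      qed
      then show ?thesis using False by (auto simp: L_def cf.scaleR cf_ev cf.zero)
    qed
  qed simp
  also have "\<dots> = (if n \<le> N \<and> even (N - n) then of_real (b (n + l) * b l) * (z ^ (n + l) * cnj z ^ l) else 0)"
  proof (cases "n \<le> N \<and> even (N - n)")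
    case True
    then have "n + l \<le> N" by (auto simp: l_def)
    then show ?thesis using True by (simp add: if_distrib cong: if_cong)
  next
    case False
    then have "(k = n + l \<and> n \<le> N \<and> even (N - n)) = False" for k by blast
    then show ?thesis by (simp only: False if_False sum.neutral_const)
  qed
  finally show ?thesis unfolding l_def .
qed

text \<open>
  Only the homogeneous parts of degree \<open>n + 2 l\<close> have an \<open>n\<close>-th Fourier coefficient; reindexing over
  \<open>l\<close> gives the series of \<open>h n\<close>.
\<close>

lemma cf_F:
  assumes z: "norm z < 1" shows "cf n (F z) = cn n z"
proof -
  interpret cf: bounded_linear "cf n" by (rule bounded_linear_cf)
  have x: "\<bar>(norm z)\<^sup>2\<bar> < 1" by (rule norm_sq_bounds(1)[OF z])
  have s1: "(\<lambda>N. cf n (hom_part L N z)) sums cf n (psum L z)"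
    unfolding psum_def by (intro cf.sums summable_sums summable_hom_part poly_bounded_L z)
  have sm: "strict_mono (\<lambda>l. n + 2 * l)" by (rule strict_monoI) simp
  have z0: "cf n (hom_part L N z) = 0" if "N \<notin> range (\<lambda>l. n + 2 * l)" for N
  proof -
    have "\<not> (n \<le> N \<and> even (N - n))"
    proof
      assume "n \<le> N \<and> even (N - n)"
      then obtain k where "N = n + 2 * k" by (metis evenE le_add_diff_inverse)
      then show False using that by blast
    qed
    then show ?thesis by (simp only: cf_hom_part if_False)
  qed
  have "(\<lambda>l. cf n (hom_part L (n + 2 * l) z)) sums cf n (psum L z)"
    using sums_mono_reindex[OF sm, of "\<lambda>N. cf n (hom_part L N z)"] z0 s1 by simp
  moreover have "cf n (hom_part L (n + 2 * l) z) = of_real (b (n + l) * b l * ((norm z)\<^sup>2) ^ l) * z ^ n" for l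
  proof -
    have "cf n (hom_part L (n + 2 * l) z) = of_real (b (n + l) * b l) * (z ^ (n + l) * cnj z ^ l)"
      by (simp add: cf_hom_part)
    also have "z ^ (n + l) * cnj z ^ l = z ^ n * (z * cnj z) ^ l" by (simp add: power_add power_mult_distrib)
    finally show ?thesis unfolding complex_norm_square[symmetric] by simp
  qed
  ultimately have "(\<lambda>l. of_real (b (n + l) * b l * ((norm z)\<^sup>2) ^ l) * z ^ n) sums cf n (psum L z)" by simp
  moreover have "(\<lambda>l. of_real (b (n + l) * b l * ((norm z)\<^sup>2) ^ l) * z ^ n) sums (of_real (h n ((norm z)\<^sup>2)) * z ^ n)"
    by (intro sums_mult2 sums_of_real h_sums x)
  ultimately have "cf n (psum L z) = of_real (h n ((norm z)\<^sup>2)) * z ^ n" by (rule sums_unique2)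
  then show ?thesis by (simp add: F_def cf.scaleR cn_def scaleR_conv_of_real)
qed

lemma F_0: "F 0 = e 0"
proof (rule cf_eqI)
  fix n
  have "cf n (F 0) = cn n 0" by (rule cf_F) simp
  moreover have "cf n u = (if n = 0 then 1 else 0)"
    by (cases n) (simp_all add: cf_def orthonormal complex_eq_iff)
  ultimately show "cf n (F 0) = cf n u" by (simp only: cn_at_0)
qed

text \<open>
  Grouping by Fourier mode instead of by degree. The sum is identified by its Fourier coefficients, so that the
  double series need not be rearranged.
\<close>

lemma F_sums:
  assumes z: "norm z < 1" shows "(\<lambda>n. ev n (cn n z)) sums F z"
proof -
  obtain M where M: "\<And>n. norm (cn n z) \<le> M * ((real n + 1) * norm z ^ n)" by (rule norm_cn_le[OF z]) (rule that)
  have "\<bar>norm z\<bar> < 1" using z by simp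
  from summable_mult[OF summable_mult[OF summable_poly_times_power[OF this]]]
  have s: "summable (\<lambda>n. 4 * (M * ((real n + 1) ^ 1 * norm z ^ n)))" .
  have "norm (ev n (cn n z)) \<le> 4 * (M * ((real n + 1) ^ 1 * norm z ^ n))" for n
    using norm_ev_le[of n "cn n z"] M[of n] by simp
  from norm_suminf_le_complete(1)[OF this s] have sm: "summable (\<lambda>n. ev n (cn n z))" .
  have "(\<Sum>n. ev n (cn n z)) = F z"
  proof (rule cf_eqI)
    fix m
    interpret cf: bounded_linear "cf m" by (rule bounded_linear_cf)
    have "of_real (Re (cn 0 z)) = cn 0 z" using cnj_cn_0[of z] by (simp add: complex_eq_iff)
    then have "cf m (ev n (cn n z)) = (if n = m then cn m z else 0)" for n by (auto simp: cf_ev)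
    then have "(\<lambda>n. cf m (ev n (cn n z))) = (\<lambda>n. if n = m then cn m z else 0)" by (rule ext)
    then have "(\<lambda>n. cf m (ev n (cn n z))) sums cn m z"
      using sums_single[of m "\<lambda>n. cn m z"] by (simp only:)
    then show "cf m (\<Sum>n. ev n (cn n z)) = cf m (F z)"
      using cf.sums[OF summable_sums[OF sm]] sums_unique2 cf_F[OF z] by fastforce
  qed
  then show ?thesis using summable_sums[OF sm] by simp
qed

lemma lor_ev: "lor u x (ev n w) = kap n * Re (cf n x * cnj w)"
proof (cases "n = 0")
  case True
  then show ?thesis by (simp add: ev_def kap_def cf_def lor.scaleR_right lor_u)
next
  case False
  have l: "lor u x (e j) = - (x \<bullet> e j)" if "j > 0" for j using that by (simp add: lor_eq orthonormal)
  have "kap n * Re (cf n x * cnj w) = - (mu n * (x \<bullet> e (2 * n - 1) * Re w + x \<bullet> e (2 * n) * Im w))"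
  proof -
    have "kap n = - (mu n * mu n)" using False mu_sq[of n] by (simp add: power2_eq_square)
    then show ?thesis using False mu_pos[of n] by (simp add: cf_def divide_simps)
  qed
  then show ?thesis using False
    by (simp add: ev_def lor.scaleR_right lor.add_right l algebra_simps)
qed

lemma lor_sums:
  assumes "norm w < 1"
  shows "(\<lambda>n. kap n * Re (cf n x * cnj (cn n w))) sums lor u x (F w)"
  using bounded_linear.sums[OF lor.bounded_linear_right F_sums[OF assms]] by (simp add: lor_ev)

section \<open>Derivatives of the equivariant map\<close>

lemma smooth_F: "smooth_on F (ball 0 1)"
  unfolding smooth_on_def F_def[abs_def]
  by (intro allI bounded_bilinear.Ck_on_bilinear[OF bounded_bilinear_scaleR] open_ball Ck_on_disc_powr
      Ck_on_psum poly_bounded_L)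

abbreviation DF :: "complex \<Rightarrow> complex \<Rightarrow> 'h" where "DF z v \<equiv> frechet_derivative F (at z) v"

lemma F_deriv:
  assumes "norm z < 1" shows "(F has_derivative DF z) (at z)"
proof -
  have "Ck_on (Suc 0) F (ball 0 1)" using smooth_F by (simp only: smooth_on_def)
  then show ?thesis using assms by (simp add: frechet_derivative_works[symmetric])
qed

lemma DF_differentiable:
  assumes "norm z < 1" shows "(\<lambda>y. DF y v) differentiable (at z)"
proof -
  have "Ck_on (Suc (Suc 0)) F (ball 0 1)" using smooth_F by (simp only: smooth_on_def)
  then show ?thesis using assms by simp
qed

lemma cf_DF:
  assumes z: "norm z < 1" shows "cf n (DF z v) = cA (int n) z * v + cB (int n) z * cnj v"
proof -
  have 1: "((\<lambda>z. cf n (F z)) has_derivative (\<lambda>v. cf n (DF z v))) (at z)"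
    by (rule bounded_linear.has_derivative[OF bounded_linear_cf F_deriv[OF z]])
  have 2: "((\<lambda>z. cf n (F z)) has_derivative (\<lambda>v. cA (int n) z * v + cB (int n) z * cnj v)) (at z)"
    by (rule has_derivative_transform_within_open[OF c_wirtinger[OF z, of "int n", unfolded wirtinger_def], of "ball 0 1"])
       (use z in \<open>auto simp: cf_F c_nat\<close>)
  show ?thesis using has_derivative_unique[OF 1 2] by metis
qed

abbreviation DDF :: "complex \<Rightarrow> complex \<Rightarrow> complex \<Rightarrow> 'h" where
  "DDF z v w \<equiv> frechet_derivative (\<lambda>y. DF y w) (at z) v"

lemma DF_deriv: "norm z < 1 \<Longrightarrow> ((\<lambda>y. DF y w) has_derivative (\<lambda>v. DDF z v w)) (at z)"
  by (rule frechet_derivative_works[THEN iffD1, OF DF_differentiable])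

text \<open>
  The eigenvalue equation in each Fourier coefficient, by \<open>cA_wirtinger\<close> and \<open>cB_wirtinger\<close>. The
  euclidean Laplacian is four times the mixed derivative.
\<close>

lemma laplace_F:
  assumes z: "norm z < 1"
  shows "DDF z 1 1 + DDF z \<i> \<i> = (4 * (t * (t + 1)) / (1 - (norm z)\<^sup>2)\<^sup>2) *\<^sub>R F z"
proof (rule cf_eqI)
  fix n
  interpret cf: bounded_linear "cf n" by (rule bounded_linear_cf)
  define k where "k = of_real (t * (t + 1)) * c (int n) z / (1 - z * cnj z)\<^sup>2"
  obtain A B where A: "wirtinger (cA (int n)) z A k" and B: "wirtinger (cB (int n)) z k B"
    using cA_wirtinger[OF z] cB_wirtinger[OF z] unfolding k_def by blast
  have "cf n (DDF z v w) = (A * v + k * cnj v) * w + (k * v + B * cnj v) * cnj w" for v w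
  proof -
    have 1: "((\<lambda>y. cf n (DF y w)) has_derivative (\<lambda>v. cf n (DDF z v w))) (at z)"
      by (rule bounded_linear.has_derivative[OF bounded_linear_cf DF_deriv[OF z]])
    have "((\<lambda>y. cA (int n) y * w + cB (int n) y * cnj w) has_derivative
        (\<lambda>v. (A * v + k * cnj v) * w + (k * v + B * cnj v) * cnj w)) (at z)"
      using A B unfolding wirtinger_def
      by (intro has_derivative_add has_derivative_mult_left)
    then have 2: "((\<lambda>y. cf n (DF y w)) has_derivative
        (\<lambda>v. (A * v + k * cnj v) * w + (k * v + B * cnj v) * cnj w)) (at z)"
      by (rule has_derivative_transform_within_open[of _ _ _ _ "ball 0 1"]) (use z in \<open>auto simp: cf_DF\<close>)
    show ?thesis using has_derivative_unique[OF 1 2] by metis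
  qed
  then have "cf n (DDF z 1 1 + DDF z \<i> \<i>) = 4 * k" by (simp add: cf.add algebra_simps)
  also have "\<dots> = of_real (4 * (t * (t + 1)) / (1 - (norm z)\<^sup>2)\<^sup>2) * cf n (F z)"
    unfolding k_def one_minus[symmetric] cf_F[OF z] c_nat by simp
  finally show "cf n (DDF z 1 1 + DDF z \<i> \<i>) = cf n ((4 * (t * (t + 1)) / (1 - (norm z)\<^sup>2)\<^sup>2) *\<^sub>R F z)"
    by (simp only: cf.scaleR scaleR_conv_of_real)
qed

section \<open>Invariance of the kernel\<close>

lemma lor_rotate:
  assumes "norm \<omega> = 1" "norm z < 1" "norm w < 1"
  shows "lor u (F (\<omega> * z)) (F (\<omega> * w)) = lor u (F z) (F w)"
proof -
  have o: "\<omega> ^ n * cnj (\<omega> ^ n) = 1" for n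
    using assms(1) by (simp add: power_mult_distrib[symmetric] complex_norm_square[symmetric])
  have "cn n (\<omega> * z) * cnj (cn n (\<omega> * w)) = cn n z * cnj (cn n w)" for n
  proof -
    have "cn n (\<omega> * z) * cnj (cn n (\<omega> * w)) = (\<omega> ^ n * cnj (\<omega> ^ n)) * (cn n z * cnj (cn n w))"
      by (simp add: cn_rotate[OF assms(1)] mult_ac)
    then show ?thesis unfolding o by simp
  qed
  then show ?thesis
    using lor_sums[of "\<omega> * w" "F (\<omega> * z)"] lor_sums[of w "F z"] assms sums_unique2
    by (simp add: cf_F norm_mult)
qed

text \<open>
  In terms of Fourier coefficients, \<open>c_translation\<close> and the recursion \<open>lam_Suc\<close> turn the two series into
  one telescoping series, because \<open>lam\<close> is exactly the sequence of weights for which the infinitesimal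
  translation is skew. The boundary terms \<open>U n\<close> tend to zero since the Fourier coefficients decay
  geometrically.
\<close>

lemma translation_generator_skew:
  assumes z: "norm z < 1" and w: "norm w < 1"
  shows "lor u (DF z (1 - z\<^sup>2)) (F w) + lor u (F z) (DF w (1 - w\<^sup>2)) = 0"
proof -
  define P where "P n z = (of_nat n + of_real t) * c (int n - 1) z - (of_nat n - of_real t) * c (int n + 1) z" for n z
  have P: "cf n (DF z (1 - z\<^sup>2)) = P n z" if "norm z < 1" for n z
    using c_translation[OF that, of "int n"] by (simp add: cf_DF[OF that] P_def)
  define S where "S n = Re (cn n z * cnj (cn (Suc n) w) + cn (Suc n) z * cnj (cn n w))" for n
  define U where "U n = 2 * lam n * (real n - t) * S n" for n
  define T where "T n = kap n * Re (P n z * cnj (cn n w)) + kap n * Re (P n w * cnj (cn n z))" for n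
  have T: "T sums (lor u (DF z (1 - z\<^sup>2)) (F w) + lor u (F z) (DF w (1 - w\<^sup>2)))"
    using sums_add[OF lor_sums[OF w, of "DF z (1 - z\<^sup>2)"] lor_sums[OF z, of "DF w (1 - w\<^sup>2)"]]
    by (simp add: P z w T_def[abs_def] lor_commute[of _ "F z"])
  have cS: "c (int n + 1) x = cn (Suc n) x" for n x using c_nat[of "Suc n"] by (simp add: add.commute)
  \<comment> \<open>For \<open>n = 0\<close> the coefficient of index \<open>- 1\<close> is the conjugate of the one of index \<open>1\<close>, so there is no separate term.\<close>
  have T0: "T 0 = - U 0"
  proof -
    have "c (- 1) x = cnj (cn 1 x)" "c 1 x = cn 1 x" for x by (simp_all add: c_def)
    moreover have "Im (cn 0 x) = 0" for x using cnj_cn_0[of x] by (simp add: complex_eq_iff)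
    ultimately show ?thesis by (simp add: T_def U_def kap_def lam_0 P_def S_def algebra_simps)
  qed
  have TS: "T (Suc n) = U n - U (Suc n)" for n
  proof -
    have cP: "c (int (Suc n) - 1) x = cn n x" for x using c_nat[of n] by simp
    have "Re (P (Suc n) z * cnj (cn (Suc n) w)) + Re (P (Suc n) w * cnj (cn (Suc n) z))
       = (real (Suc n) + t) * S n - (real (Suc n) - t) * S (Suc n)"
      unfolding P_def cS cP S_def by (simp add: algebra_simps del: of_nat_Suc)
    then have "T (Suc n) = 2 * (lam (Suc n) * (real (Suc n) + t)) * S n - 2 * lam (Suc n) * (real (Suc n) - t) * S (Suc n)"
      by (simp add: T_def kap_def distrib_left[symmetric] del: of_nat_Suc) (simp add: algebra_simps)
    moreover have "lam (Suc n) * (real (Suc n) + t) = lam n * (real n - t)" using lam_Suc[of n] by (simp add: add_ac)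
    ultimately show ?thesis by (simp add: U_def)
  qed
  have sumT: "(\<Sum>n<Suc m. T n) = - U m" for m
    by (induction m) (simp_all add: T0 TS)
  have "U \<longlonglongrightarrow> 0"
  proof -
    obtain M where M: "\<And>n. norm (cn n z) \<le> M * ((real n + 1) * norm z ^ n)" by (rule norm_cn_le[OF z]) (rule that)
    obtain M' where M': "\<And>n. norm (cn n w) \<le> M' * ((real n + 1) * norm w ^ n)" by (rule norm_cn_le[OF w]) (rule that)
    have M0: "M \<ge> 0" "M' \<ge> 0" using M[of 0] M'[of 0] by (auto intro: order_trans[OF norm_ge_zero])
    have Mz: "norm (cn k z) \<le> M * ((2 * (real n + 1)) * norm z ^ n)" if "k = n \<or> k = Suc n" for k n
    proof -
      have "(real k + 1) * norm z ^ k \<le> (2 * (real n + 1)) * norm z ^ n"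
        using that z by (intro mult_mono) (auto simp: power_decreasing mult_left_le_one_le)
      then show ?thesis using M[of k] mult_left_mono[OF _ M0(1)] order_trans by blast
    qed
    have Mw: "norm (cn k w) \<le> M' * (2 * (real n + 1))" if "k = n \<or> k = Suc n" for k n
    proof -
      have "(real k + 1) * norm w ^ k \<le> (2 * (real n + 1)) * 1"
        using that w by (intro mult_mono) (auto simp: power_le_one mult_le_one)
      then have "M' * ((real k + 1) * norm w ^ k) \<le> M' * (2 * (real n + 1))"
        using mult_left_mono[OF _ M0(2)] by simp
      then show ?thesis using M'[of k] order_trans by blast
    qed
    have bnd: "\<bar>Re (cn j z * cnj (cn k w))\<bar> \<le> (M * ((2 * (real n + 1)) * norm z ^ n)) * (M' * (2 * (real n + 1)))"
      if "j = n \<or> j = Suc n" "k = n \<or> k = Suc n" for j k n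
    proof -
      have "\<bar>Re (cn j z * cnj (cn k w))\<bar> \<le> norm (cn j z) * norm (cn k w)"
        using abs_Re_le_cmod[of "cn j z * cnj (cn k w)"] by (simp add: norm_mult)
      also have "\<dots> \<le> (M * ((2 * (real n + 1)) * norm z ^ n)) * (M' * (2 * (real n + 1)))"
        using Mz[OF that(1)] Mw[OF that(2)] M0 by (intro mult_mono) auto
      finally show ?thesis .
    qed
    have Ub: "norm (U n) \<le> (16 * M * M') * ((real n + 1) ^ 3 * norm z ^ n)" for n
    proof -
      have "\<bar>S n\<bar> \<le> 2 * ((M * ((2 * (real n + 1)) * norm z ^ n)) * (M' * (2 * (real n + 1))))"
        using bnd[of n n "Suc n"] bnd[of "Suc n" n n] unfolding S_def by (simp add: abs_le_iff)
      moreover have "\<bar>lam n * (real n - t)\<bar> \<le> 1 * (real n + 1)"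
        using abs_lam_le[of n] t_pos t_less_1 unfolding abs_mult by (intro mult_mono) (auto simp: abs_le_iff)
      ultimately have "\<bar>lam n * (real n - t)\<bar> * \<bar>S n\<bar>
         \<le> (1 * (real n + 1)) * (2 * ((M * ((2 * (real n + 1)) * norm z ^ n)) * (M' * (2 * (real n + 1)))))"
        by (intro mult_mono) auto
      also have "\<dots> = (8 * M * M') * ((real n + 1) ^ 3 * norm z ^ n)"
        unfolding power3_eq_cube by algebra
      finally have "\<bar>lam n * (real n - t)\<bar> * \<bar>S n\<bar> \<le> (8 * M * M') * ((real n + 1) ^ 3 * norm z ^ n)" .
      moreover have "norm (U n) = 2 * (\<bar>lam n * (real n - t)\<bar> * \<bar>S n\<bar>)" by (simp add: U_def abs_mult)
      ultimately show ?thesis by linarith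
    qed
    have "\<bar>norm z\<bar> < 1" using z by simp
    from summable_LIMSEQ_zero[OF summable_mult[OF summable_poly_times_power[OF this]]]
    have "(\<lambda>n. (16 * M * M') * ((real n + 1) ^ 3 * norm z ^ n)) \<longlonglongrightarrow> 0" .
    then show ?thesis by (rule Lim_null_comparison[rotated]) (simp add: Ub[unfolded real_norm_def])
  qed
  then have 1: "(\<lambda>m. \<Sum>n<Suc m. T n) \<longlonglongrightarrow> - 0" unfolding sumT by (rule tendsto_minus)
  have 2: "(\<lambda>m. \<Sum>n<Suc m. T n) \<longlonglongrightarrow> lor u (DF z (1 - z\<^sup>2)) (F w) + lor u (F z) (DF w (1 - w\<^sup>2))"
    using T unfolding sums_def by (rule LIMSEQ_Suc)
  show ?thesis using LIMSEQ_unique[OF 2 1] by simp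
qed

definition translate :: "real \<Rightarrow> complex \<Rightarrow> complex" where
  "translate \<tau> z = (z + of_real \<tau>) / (1 + of_real \<tau> * z)"

lemma translate_denom:
  assumes "0 \<le> \<tau>" "\<tau> < 1" "norm (z::complex) < 1" shows "1 + of_real \<tau> * z \<noteq> 0"
proof
  assume "1 + of_real \<tau> * z = 0"
  then have "of_real \<tau> * z = - 1" by (simp add: eq_neg_iff_add_eq_0 add.commute)
  then have "norm (of_real \<tau> * z) = 1" by simp
  moreover have "\<tau> * norm z < 1" using assms mult_strict_mono'[of \<tau> 1 "norm z" 1] by simp
  ultimately show False using assms by (simp add: norm_mult)
qed

lemma norm_translate:
  assumes "0 \<le> \<tau>" "\<tau> < 1" "norm z < 1" shows "norm (translate \<tau> z) < 1"
proof -
  have "(norm (1 + of_real \<tau> * z))\<^sup>2 - (norm (z + of_real \<tau>))\<^sup>2 = (1 - \<tau>\<^sup>2) * (1 - (norm z)\<^sup>2)"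
    by (simp add: cmod_power2) (simp add: power2_eq_square algebra_simps)
  moreover have "(1 - \<tau>\<^sup>2) * (1 - (norm z)\<^sup>2) > 0"
    using assms by (intro mult_pos_pos) (auto simp: abs_square_less_1 power_less_one_iff)
  ultimately have "(norm (z + of_real \<tau>))\<^sup>2 < (norm (1 + of_real \<tau> * z))\<^sup>2" by linarith
  then have "norm (z + of_real \<tau>) < norm (1 + of_real \<tau> * z)" by (rule power2_less_imp_less) simp
  then show ?thesis using translate_denom[OF assms] by (simp add: translate_def norm_divide)
qed

text \<open>
  The curve \<open>\<tau> \<mapsto> translate \<tau> z\<close> follows the vector field \<open>1 - z\<^sup>2\<close> with speed \<open>1 / (1 - \<tau>\<^sup>2)\<close>.
\<close>

lemma F_translate_deriv:
  assumes "0 \<le> \<tau>" "\<tau> < 1" "norm z < 1"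
  shows "((\<lambda>\<tau>. F (translate \<tau> z)) has_derivative
     (\<lambda>\<delta>. (\<delta> / (1 - \<tau>\<^sup>2)) *\<^sub>R DF (translate \<tau> z) (1 - (translate \<tau> z)\<^sup>2))) (at \<tau>)"
proof -
  define d where "d = 1 + of_real \<tau> * z"
  have d: "d \<noteq> 0" using translate_denom[OF assms] by (simp add: d_def)
  have \<tau>: "1 - \<tau>\<^sup>2 \<noteq> 0" using assms by (simp add: power2_eq_1_iff)
  then have \<tau>c: "1 - (complex_of_real \<tau>)\<^sup>2 \<noteq> 0" by (metis of_real_1 of_real_diff of_real_eq_0_iff of_real_power)
  have "((\<lambda>\<tau>. translate \<tau> z) has_derivative (\<lambda>\<delta>. of_real \<delta> * ((1 - z\<^sup>2) / d\<^sup>2))) (at \<tau>)"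
    unfolding translate_def
    by (rule derivative_eq_intros refl translate_denom[OF assms] bounded_linear.has_derivative[OF bounded_linear_of_real])+
       (use d in \<open>auto simp: fun_eq_iff d_def power2_eq_square field_simps\<close>)
  moreover have "(1 - z\<^sup>2) / d\<^sup>2 = (1 - (translate \<tau> z)\<^sup>2) / of_real (1 - \<tau>\<^sup>2)"
  proof -
    have "(1 - (translate \<tau> z)\<^sup>2) = (d\<^sup>2 - (z + of_real \<tau>)\<^sup>2) / d\<^sup>2"
      using d by (simp add: translate_def d_def[symmetric] power_divide diff_divide_distrib)
    also have "d\<^sup>2 - (z + of_real \<tau>)\<^sup>2 = of_real (1 - \<tau>\<^sup>2) * (1 - z\<^sup>2)"
      by (simp add: d_def power2_eq_square algebra_simps)
    finally show ?thesis using \<tau>c d by (simp add: field_simps)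
  qed
  ultimately have D: "((\<lambda>\<tau>. translate \<tau> z) has_derivative (\<lambda>\<delta>. (\<delta> / (1 - \<tau>\<^sup>2)) *\<^sub>R (1 - (translate \<tau> z)\<^sup>2))) (at \<tau>)"
    by (simp add: scaleR_conv_of_real)
  have lin: "linear (DF (translate \<tau> z))" using F_deriv[OF norm_translate[OF assms]] has_derivative_linear by blast
  from has_derivative_compose[OF D F_deriv[OF norm_translate[OF assms]]]
  show ?thesis by (simp only: linear_scale[OF lin])
qed

lemma lor_translate:
  assumes "0 \<le> \<tau>" "\<tau> < 1" and z: "norm z < 1" and w: "norm w < 1"
  shows "lor u (F (translate \<tau> z)) (F (translate \<tau> w)) = lor u (F z) (F w)"
proof (cases "\<tau> = 0")
  case True
  then show ?thesis by (simp add: translate_def)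
next
  case False
  define \<phi> where "\<phi> \<tau> = lor u (F (translate \<tau> z)) (F (translate \<tau> w))" for \<tau>
  have D: "(\<phi> has_real_derivative 0) (at \<sigma>)" if s: "0 \<le> \<sigma>" "\<sigma> < 1" for \<sigma>
  proof -
    have "lor u (F (translate \<sigma> z)) ((\<delta> / (1 - \<sigma>\<^sup>2)) *\<^sub>R DF (translate \<sigma> w) (1 - (translate \<sigma> w)\<^sup>2))
        + lor u ((\<delta> / (1 - \<sigma>\<^sup>2)) *\<^sub>R DF (translate \<sigma> z) (1 - (translate \<sigma> z)\<^sup>2)) (F (translate \<sigma> w)) = 0" for \<delta>
      using translation_generator_skew[OF norm_translate[OF s z] norm_translate[OF s w]]
      by (simp add: lor.scaleR_left lor.scaleR_right distrib_left[symmetric] add.commute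
          del: times_divide_eq_left)
    with lor.FDERIV[OF F_translate_deriv[OF s z] F_translate_deriv[OF s w]] show ?thesis
      by (simp add: \<phi>_def[abs_def] has_field_derivative_def lambda_zero)
  qed
  have "\<phi> \<tau> = \<phi> 0"
  proof (rule DERIV_isconst_end[of 0 \<tau> \<phi>])
    show "0 < \<tau>" using assms False by simp
    show "continuous_on {0..\<tau>} \<phi>"
    proof (intro continuous_at_imp_continuous_on ballI)
      fix x assume "x \<in> {0..\<tau>}"
      then show "isCont \<phi> x" using assms(2) by (intro DERIV_isCont[OF D]) auto
    qed
    show "(\<phi> has_real_derivative 0) (at x)" if "0 < x" "x < \<tau>" for x using D that assms(2) by auto
  qed
  then show ?thesis by (simp add: \<phi>_def translate_def)
qed

end



section \<open>The automorphisms of the disc\<close>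

text \<open>
  The action of \<open>SU(1,1)\<close> on the disc; the pair \<open>(\<alpha>, \<beta>)\<close> is the first row of the matrix.
\<close>

definition mob :: "complex \<Rightarrow> complex \<Rightarrow> complex \<Rightarrow> complex" where
  "mob \<alpha> \<beta> z = (\<alpha> * z + \<beta>) / (cnj \<beta> * z + cnj \<alpha>)"

lemma mob_denom:
  assumes "(norm \<alpha>)\<^sup>2 - (norm \<beta>)\<^sup>2 = 1" "norm z < 1"
  shows "cnj \<beta> * z + cnj \<alpha> \<noteq> 0"
proof
  assume "cnj \<beta> * z + cnj \<alpha> = 0"
  then have "cnj \<alpha> = - (cnj \<beta> * z)" by (simp add: eq_neg_iff_add_eq_0 add.commute)
  then have "norm \<alpha> = norm \<beta> * norm z" by (metis complex_mod_cnj norm_minus_cancel norm_mult)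
  then have "norm \<alpha> \<le> norm \<beta>" using assms(2) by (simp add: mult_left_le)
  then have "(norm \<alpha>)\<^sup>2 \<le> (norm \<beta>)\<^sup>2" by (intro power_mono) auto
  then show False using assms(1) by linarith
qed

lemma norm_mob:
  assumes "(norm \<alpha>)\<^sup>2 - (norm \<beta>)\<^sup>2 = 1" "norm z < 1"
  shows "norm (mob \<alpha> \<beta> z) < 1"
proof -
  have "(norm (cnj \<beta> * z + cnj \<alpha>))\<^sup>2 - (norm (\<alpha> * z + \<beta>))\<^sup>2
      = ((norm \<alpha>)\<^sup>2 - (norm \<beta>)\<^sup>2) * (1 - (norm z)\<^sup>2)"
    by (simp add: cmod_power2) (simp add: power2_eq_square algebra_simps)
  then have "(norm (\<alpha> * z + \<beta>))\<^sup>2 < (norm (cnj \<beta> * z + cnj \<alpha>))\<^sup>2"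
    unfolding assms(1) using disc_sq[OF assms(2)] by simp
  then have "norm (\<alpha> * z + \<beta>) < norm (cnj \<beta> * z + cnj \<alpha>)" by (rule power2_less_imp_less) simp
  then show ?thesis using mob_denom[OF assms] by (simp add: mob_def norm_divide)
qed

lemma mob_mob:
  assumes "(norm \<gamma>)\<^sup>2 - (norm \<delta>)\<^sup>2 = 1" "norm z < 1"
  shows "mob \<alpha> \<beta> (mob \<gamma> \<delta> z) = mob (\<alpha> * \<gamma> + \<beta> * cnj \<delta>) (\<alpha> * \<delta> + \<beta> * cnj \<gamma>) z"
proof -
  define D where "D = cnj \<delta> * z + cnj \<gamma>"
  have D: "D \<noteq> 0" using mob_denom[OF assms] by (simp add: D_def)
  have "\<alpha> * ((\<gamma> * z + \<delta>) / D) + \<beta> = ((\<alpha> * \<gamma> + \<beta> * cnj \<delta>) * z + (\<alpha> * \<delta> + \<beta> * cnj \<gamma>)) / D"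
    using D by (simp add: divide_simps) (simp add: D_def algebra_simps)
  moreover have "cnj \<beta> * ((\<gamma> * z + \<delta>) / D) + cnj \<alpha>
      = (cnj (\<alpha> * \<delta> + \<beta> * cnj \<gamma>) * z + cnj (\<alpha> * \<gamma> + \<beta> * cnj \<delta>)) / D"
    using D by (simp add: divide_simps) (simp add: D_def algebra_simps)
  ultimately show ?thesis unfolding mob_def D_def[symmetric] using D by simp
qed

lemma mob_norm_mult:
  assumes "(norm \<alpha>)\<^sup>2 - (norm \<beta>)\<^sup>2 = 1" "(norm \<gamma>)\<^sup>2 - (norm \<delta>)\<^sup>2 = 1"
  shows "(norm (\<alpha> * \<gamma> + \<beta> * cnj \<delta>))\<^sup>2 - (norm (\<alpha> * \<delta> + \<beta> * cnj \<gamma>))\<^sup>2 = 1"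
proof -
  have "(norm (\<alpha> * \<gamma> + \<beta> * cnj \<delta>))\<^sup>2 - (norm (\<alpha> * \<delta> + \<beta> * cnj \<gamma>))\<^sup>2
     = ((norm \<alpha>)\<^sup>2 - (norm \<beta>)\<^sup>2) * ((norm \<gamma>)\<^sup>2 - (norm \<delta>)\<^sup>2)"
    by (simp add: cmod_power2) (simp add: power2_eq_square algebra_simps)
  then show ?thesis by (simp add: assms)
qed

text \<open>
  A condition on the restriction to the disc only, since \<open>disc_action\<close> is only controlled there.
\<close>

definition is_mob :: "(complex \<Rightarrow> complex) \<Rightarrow> bool" where
  "is_mob \<phi> \<longleftrightarrow> (\<exists>\<alpha> \<beta>. (norm \<alpha>)\<^sup>2 - (norm \<beta>)\<^sup>2 = 1 \<and> (\<forall>z. norm z < 1 \<longrightarrow> \<phi> z = mob \<alpha> \<beta> z))"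

lemma is_mob_mob: "(norm \<alpha>)\<^sup>2 - (norm \<beta>)\<^sup>2 = 1 \<Longrightarrow> is_mob (mob \<alpha> \<beta>)"
  unfolding is_mob_def by blast

lemma is_mob_norm: "is_mob \<phi> \<Longrightarrow> norm z < 1 \<Longrightarrow> norm (\<phi> z) < 1"
  unfolding is_mob_def using norm_mob by metis

lemma is_mob_comp:
  assumes "is_mob \<phi>" "is_mob \<psi>" shows "is_mob (\<lambda>z. \<phi> (\<psi> z))"
proof -
  obtain \<alpha> \<beta> where \<phi>: "(norm \<alpha>)\<^sup>2 - (norm \<beta>)\<^sup>2 = 1" "\<And>z. norm z < 1 \<Longrightarrow> \<phi> z = mob \<alpha> \<beta> z"
    using assms(1) unfolding is_mob_def by blast
  obtain \<gamma> \<delta> where \<psi>: "(norm \<gamma>)\<^sup>2 - (norm \<delta>)\<^sup>2 = 1" "\<And>z. norm z < 1 \<Longrightarrow> \<psi> z = mob \<gamma> \<delta> z"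
    using assms(2) unfolding is_mob_def by blast
  have "\<phi> (\<psi> z) = mob (\<alpha> * \<gamma> + \<beta> * cnj \<delta>) (\<alpha> * \<delta> + \<beta> * cnj \<gamma>) z" if "norm z < 1" for z
    using \<phi>(2)[OF norm_mob[OF \<psi>(1) that]] \<psi>(2)[OF that] mob_mob[OF \<psi>(1) that] by simp
  then show ?thesis using mob_norm_mult[OF \<phi>(1) \<psi>(1)] unfolding is_mob_def by blast
qed

lemma is_mob_inverse:
  assumes "is_mob \<phi>"
  obtains \<psi> where "is_mob \<psi>" "\<And>z. norm z < 1 \<Longrightarrow> \<psi> (\<phi> z) = z" "\<And>z. norm z < 1 \<Longrightarrow> \<phi> (\<psi> z) = z"
proof -
  obtain \<alpha> \<beta> where \<phi>: "(norm \<alpha>)\<^sup>2 - (norm \<beta>)\<^sup>2 = 1" "\<And>z. norm z < 1 \<Longrightarrow> \<phi> z = mob \<alpha> \<beta> z"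
    using assms unfolding is_mob_def by blast
  have i: "(norm (cnj \<alpha>))\<^sup>2 - (norm (- \<beta>))\<^sup>2 = 1" using \<phi>(1) by simp
  have "complex_of_real ((norm \<alpha>)\<^sup>2 - (norm \<beta>)\<^sup>2) = 1" using \<phi>(1) by simp
  then have e: "\<alpha> * cnj \<alpha> - \<beta> * cnj \<beta> = 1" by (simp only: of_real_diff complex_norm_square)
  have one: "mob 1 0 z = z" for z by (simp add: mob_def)
  have "mob (cnj \<alpha>) (- \<beta>) (\<phi> z) = z" if "norm z < 1" for z
    using \<phi>(2)[OF that] mob_mob[OF \<phi>(1) that, of "cnj \<alpha>" "- \<beta>"] e one[of z] by (simp add: mult.commute)
  moreover have "\<phi> (mob (cnj \<alpha>) (- \<beta>) z) = z" if "norm z < 1" for z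
    using \<phi>(2)[OF norm_mob[OF i that]] mob_mob[OF i that, of \<alpha> \<beta>] e one[of z] by (simp add: mult.commute)
  ultimately show thesis using that is_mob_mob[OF i] by blast
qed

lemma is_mob_rotate:
  assumes "norm \<omega> = 1" shows "is_mob (\<lambda>z. \<omega> * z)"
proof -
  have "norm (csqrt \<omega>) ^ 2 = 1" using assms by (metis norm_power power2_csqrt)
  then have n: "norm (csqrt \<omega>) = 1" by (simp add: power2_eq_1_iff)
  then have c: "csqrt \<omega> * cnj (csqrt \<omega>) = 1" by (simp add: complex_norm_square[symmetric])
  then have c0: "cnj (csqrt \<omega>) \<noteq> 0" by (metis mult_zero_right zero_neq_one)
  have "csqrt \<omega> * csqrt \<omega> = \<omega>" by (metis power2_csqrt power2_eq_square)
  then have "csqrt \<omega> = \<omega> * cnj (csqrt \<omega>)" using c by (metis mult.assoc mult.right_neutral)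
  then have "csqrt \<omega> / cnj (csqrt \<omega>) = \<omega>" using c0 by (simp only: divide_eq_eq if_False if_True simp_thms)
  then have "\<omega> * z = mob (csqrt \<omega>) 0 z" for z
    unfolding mob_def by (simp only: complex_cnj_zero mult_zero_left add_0_left add_0_right times_divide_eq_left[symmetric])
  then show ?thesis unfolding is_mob_def using n by (intro exI[of _ "csqrt \<omega>"] exI[of _ 0]) simp
qed

lemma is_mob_transitive:
  assumes "norm z < 1" obtains \<phi> where "is_mob \<phi>" "\<phi> 0 = z"
proof -
  define r where "r = 1 / sqrt (1 - (norm z)\<^sup>2)"
  have y: "1 - (norm z)\<^sup>2 > 0" by (rule disc_sq[OF assms])
  then have r: "r > 0" "r\<^sup>2 * (1 - (norm z)\<^sup>2) = 1" by (auto simp: r_def power_divide)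
  have "(norm (complex_of_real r))\<^sup>2 - (norm (of_real r * z))\<^sup>2 = 1"
    using r(2) by (simp add: norm_mult power_mult_distrib algebra_simps)
  from is_mob_mob[OF this] show thesis by (rule that) (use r(1) in \<open>simp add: mob_def\<close>)
qed

text \<open>
  The first row of the conjugate of a matrix by the Cayley transform.
\<close>

definition conj_alpha :: "real^2^2 \<Rightarrow> complex" where "conj_alpha A = Complex ((A$1$1 + A$2$2) / 2) ((A$1$2 - A$2$1) / 2)"
definition conj_beta :: "real^2^2 \<Rightarrow> complex" where "conj_beta A = Complex ((A$1$1 - A$2$2) / 2) (- (A$1$2 + A$2$1) / 2)"

lemma conj_alpha_beta_det: "(norm (conj_alpha A))\<^sup>2 - (norm (conj_beta A))\<^sup>2 = det A"
  unfolding conj_alpha_def conj_beta_def cmod_power2 det_2 by (simp add: power2_eq_square field_simps)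

lemma inv_cayley:
  assumes "norm w < 1"
  defines "\<tau> \<equiv> \<i> * (1 + w) / (1 - w)"
  shows "inv_into {z. 0 < Im z} cayley w = \<tau>" "0 < Im \<tau>"
proof -
  have w1: "1 - w \<noteq> 0" using assms by auto
  have "Im \<tau> = (1 - (norm w)\<^sup>2) / (norm (1 - w))\<^sup>2"
    unfolding \<tau>_def Im_divide cmod_power2 by (simp add: power2_eq_square algebra_simps)
  then show im: "0 < Im \<tau>" using disc_sq[OF assms(1)] w1 by simp
  have inj: "inj_on cayley {z. 0 < Im z}"
  proof (rule inj_onI)
    fix x y assume xy: "x \<in> {z. 0 < Im z}" "y \<in> {z. 0 < Im z}" "cayley x = cayley y"
    have "x + \<i> \<noteq> 0" "y + \<i> \<noteq> 0" using xy(1,2) by (auto simp: complex_eq_iff)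
    then have "(x - \<i>) * (y + \<i>) = (y - \<i>) * (x + \<i>)" using xy(3) by (simp add: cayley_def frac_eq_eq)
    then have "2 * \<i> * x = 2 * \<i> * y" by (simp add: algebra_simps)
    then show "x = y" by simp
  qed
  have "\<tau> - \<i> = 2 * \<i> * w / (1 - w)" "\<tau> + \<i> = 2 * \<i> / (1 - w)"
    using w1 by (simp_all add: \<tau>_def divide_simps) (simp_all add: algebra_simps)
  then have "cayley \<tau> = w" using w1 by (simp add: cayley_def)
  then show "inv_into {z. 0 < Im z} cayley w = \<tau>" using inj im by (intro inv_into_f_eq) auto
qed

lemma disc_action_eq_mob:
  assumes A: "det A = 1" and w: "norm w < 1"
  shows "disc_action A w = mob (conj_alpha A) (conj_beta A) w"
proof -
  define \<tau> where "\<tau> = \<i> * (1 + w) / (1 - w)"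
  have \<tau>: "inv_into {z. 0 < Im z} cayley w = \<tau>" "0 < Im \<tau>" using inv_cayley[OF w] by (simp_all add: \<tau>_def)
  have w1: "1 - w \<noteq> 0" using w by auto
  then have \<tau>w: "\<tau> * (1 - w) = \<i> * (1 + w)" by (simp add: \<tau>_def)
  define n d where "n = of_real (A$1$1) * \<tau> + of_real (A$1$2)" and "d = of_real (A$2$1) * \<tau> + of_real (A$2$2)"
  have d: "d \<noteq> 0"
  proof
    assume "d = 0"
    then have "A$2$1 * Im \<tau> = 0" "A$2$1 * Re \<tau> + A$2$2 = 0" by (auto simp: d_def complex_eq_iff)
    then have "A$2$1 = 0" "A$2$2 = 0" using \<tau>(2) by auto
    then show False using A by (simp add: det_2)
  qed
  have "disc_action A w = (n / d - \<i>) / (n / d + \<i>)"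
    by (simp add: disc_action_def \<tau>(1) homography_def cayley_def n_def d_def)
  also have "\<dots> = (n - \<i> * d) / (n + \<i> * d)"
  proof -
    have "n / d - \<i> = (n - \<i> * d) / d" "n / d + \<i> = (n + \<i> * d) / d" using d by (simp_all add: field_simps)
    then show ?thesis using d by simp
  qed
  also have "n - \<i> * d = (2 * \<i>) * (conj_alpha A * w + conj_beta A) / (1 - w)"
  proof -
    have "(n - \<i> * d) * (1 - w) = (of_real (A$1$1) - \<i> * of_real (A$2$1)) * (\<tau> * (1 - w))
        + (of_real (A$1$2) - \<i> * of_real (A$2$2)) * (1 - w)" by (simp add: n_def d_def algebra_simps)
    also have "\<dots> = (2 * \<i>) * (conj_alpha A * w + conj_beta A)"
      unfolding \<tau>w by (simp add: complex_eq_iff conj_alpha_def conj_beta_def field_simps)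
    finally have "(n - \<i> * d) * (1 - w) = (2 * \<i>) * (conj_alpha A * w + conj_beta A)" .
    then show ?thesis using w1 by (simp add: eq_divide_eq)
  qed
  also have "n + \<i> * d = (2 * \<i>) * (cnj (conj_beta A) * w + cnj (conj_alpha A)) / (1 - w)"
  proof -
    have "(n + \<i> * d) * (1 - w) = (of_real (A$1$1) + \<i> * of_real (A$2$1)) * (\<tau> * (1 - w))
        + (of_real (A$1$2) + \<i> * of_real (A$2$2)) * (1 - w)" by (simp add: n_def d_def algebra_simps)
    also have "\<dots> = (2 * \<i>) * (cnj (conj_beta A) * w + cnj (conj_alpha A))"
      unfolding \<tau>w by (simp add: complex_eq_iff conj_alpha_def conj_beta_def field_simps)
    finally have "(n + \<i> * d) * (1 - w) = (2 * \<i>) * (cnj (conj_beta A) * w + cnj (conj_alpha A))" .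
    then show ?thesis using w1 by (simp add: eq_divide_eq)
  qed
  finally show ?thesis using w1 by (simp add: mob_def)
qed

lemma is_mob_disc_action: "det A = 1 \<Longrightarrow> is_mob (disc_action A)"
  unfolding is_mob_def using conj_alpha_beta_det[of A] disc_action_eq_mob by metis

lemma disc_action_mult:
  assumes "det A = 1" "det B = 1" "norm w < 1"
  shows "disc_action (A ** B) w = disc_action A (disc_action B w)"
proof -
  have B: "(norm (conj_alpha B))\<^sup>2 - (norm (conj_beta B))\<^sup>2 = 1" using assms by (simp add: conj_alpha_beta_det)
  have "det (A ** B) = 1" using assms by (simp add: det_mul)
  moreover have "conj_alpha (A ** B) = conj_alpha A * conj_alpha B + conj_beta A * cnj (conj_beta B)" "conj_beta (A ** B) = conj_alpha A * conj_beta B + conj_beta A * cnj (conj_alpha B)"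
    by (simp_all add: complex_eq_iff conj_alpha_def conj_beta_def matrix_matrix_mult_def sum_2 field_simps)
  ultimately show ?thesis
    using disc_action_eq_mob assms mob_mob[OF B assms(3)] norm_mob[OF B assms(3)] by simp
qed

lemma disc_action_minus: "disc_action (- A) w = disc_action A w"
proof -
  have "homography (- A) z = homography A z" for z
  proof -
    have "homography (- A) z = (- (of_real (A$1$1) * z + of_real (A$1$2))) / (- (of_real (A$2$1) * z + of_real (A$2$2)))"
      by (simp add: homography_def algebra_simps)
    then show ?thesis unfolding homography_def by (simp only: minus_divide_divide)
  qed
  then show ?thesis by (simp add: disc_action_def)
qed

lemma is_mob_disc_action_ex:
  assumes "is_mob \<phi>" obtains A where "det A = 1" "\<And>z. norm z < 1 \<Longrightarrow> disc_action A z = \<phi> z"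
proof -
  obtain \<alpha> \<beta> where \<phi>: "(norm \<alpha>)\<^sup>2 - (norm \<beta>)\<^sup>2 = 1" "\<And>z. norm z < 1 \<Longrightarrow> \<phi> z = mob \<alpha> \<beta> z"
    using assms unfolding is_mob_def by blast
  define A :: "real^2^2" where "A = vector [vector [Re \<alpha> + Re \<beta>, Im \<alpha> - Im \<beta>], vector [- Im \<alpha> - Im \<beta>, Re \<alpha> - Re \<beta>]]"
  have ab: "conj_alpha A = \<alpha>" "conj_beta A = \<beta>" by (simp_all add: A_def conj_alpha_def conj_beta_def complex_eq_iff)
  then have "det A = 1" using conj_alpha_beta_det[of A] \<phi>(1) by simp
  then show thesis using that disc_action_eq_mob ab \<phi>(2) by metis
qed

lemma carrier_PSL2R: "carrier PSL2R = {{A, - A} |A. det A = 1}"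
proof -
  have "(- mat 1 :: real^2^2) ** A = - A" for A :: "real^2^2"
    by (simp add: vec_eq_iff matrix_matrix_mult_def mat_def sum_2 forall_2)
  then show ?thesis
    unfolding PSL2R_def FactGroup_def RCOSETS_def r_coset_def SL2R_def
    by (auto simp: insert_commute)
qed

lemma mult_PSL2R: "g \<otimes>\<^bsub>PSL2R\<^esub> h = {A ** B |A B. A \<in> g \<and> B \<in> h}"
  unfolding PSL2R_def FactGroup_def set_mult_def SL2R_def by auto

section \<open>The representation\<close>

context model
begin

text \<open>
  The Cartan decomposition: with polar coordinates for \<open>\<alpha>\<close> and \<open>\<beta>\<close>, every automorphism is a translation
  along the real axis between two rotations.
\<close>

lemma lor_mob:
  assumes m: "is_mob \<phi>" and z: "norm z < 1" and w: "norm w < 1"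
  shows "lor u (F (\<phi> z)) (F (\<phi> w)) = lor u (F z) (F w)"
proof -
  obtain \<alpha> \<beta> where \<phi>: "(norm \<alpha>)\<^sup>2 - (norm \<beta>)\<^sup>2 = 1" "\<And>z. norm z < 1 \<Longrightarrow> \<phi> z = mob \<alpha> \<beta> z"
    using m unfolding is_mob_def by blast
  define p q where "p = norm \<alpha>" and "q = norm \<beta>"
  have pq: "p\<^sup>2 = 1 + q\<^sup>2" "q \<ge> 0" "p \<ge> 0" using \<phi>(1) by (simp_all add: p_def q_def)
  then have p: "p > 0" by (metis add_pos_nonneg less_eq_real_def power_zero_numeral zero_le_power2 zero_less_one less_irrefl)
  have "q\<^sup>2 < p\<^sup>2" using pq(1) by simp
  then have qp: "q < p" using p by (auto intro: power2_less_imp_less)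
  define s where "s = \<alpha> / of_real p"
  \<comment> \<open>If \<open>\<beta> = 0\<close> the automorphism is a rotation, and any phase may be chosen.\<close>
  define s' where "s' = (if \<beta> = 0 then 1 else \<beta> / of_real q)"
  have s: "norm s = 1" "\<alpha> = of_real p * s" using p by (auto simp: s_def norm_divide p_def)
  have s': "norm s' = 1" "\<beta> = of_real q * s'" by (auto simp: s'_def norm_divide q_def)
  have ss: "s * cnj s = 1" "s' * cnj s' = 1" using s s' by (simp_all add: complex_norm_square[symmetric])
  have dec: "\<phi> x = (s * s') * translate (q / p) ((s * cnj s') * x)" if x: "norm x < 1" for x
  proof -
    have "translate (q / p) ((s * cnj s') * x) = (of_real p * s * cnj s' * x + of_real q) / (of_real p + of_real q * s * cnj s' * x)"
      using p by (simp add: translate_def divide_simps) (simp add: algebra_simps)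
    moreover have "of_real p * s * cnj s' * x + of_real q = cnj s' * (\<alpha> * x + \<beta>)"
      using ss(2) by (simp add: s(2) s'(2) algebra_simps)
    moreover have "of_real p + of_real q * s * cnj s' * x = s * (cnj \<beta> * x + cnj \<alpha>)"
      using ss(1) by (simp add: s(2) s'(2) algebra_simps)
    moreover have "s \<noteq> 0" using s(1) by auto
    ultimately have "(s * s') * translate (q / p) ((s * cnj s') * x)
        = ((s' * cnj s') * (s * (\<alpha> * x + \<beta>))) / (s * (cnj \<beta> * x + cnj \<alpha>))" by (simp add: mult_ac)
    then show ?thesis using \<open>s \<noteq> 0\<close> unfolding ss(2) by (simp add: \<phi>(2)[OF x] mob_def)
  qed
  have n1: "norm (s * s') = 1" "norm (s * cnj s') = 1" using s s' by (simp_all add: norm_mult)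
  have nx: "norm ((s * cnj s') * x) < 1" if "norm x < 1" for x using n1(2) that unfolding norm_mult[of _ x] by simp
  have \<tau>: "0 \<le> q / p" "q / p < 1" using p pq qp by auto
  show ?thesis
    unfolding dec[OF z] dec[OF w]
    using lor_rotate[OF n1(1) norm_translate[OF \<tau> nx[OF z]] norm_translate[OF \<tau> nx[OF w]]]
      lor_translate[OF \<tau> nx[OF z] nx[OF w]] lor_rotate[OF n1(2) z w] by simp
qed

lemma lor_F_F: assumes "norm z < 1" shows "lor u (F z) (F z) = 1"
proof -
  obtain \<phi> where "is_mob \<phi>" "\<phi> 0 = z" using is_mob_transitive[OF assms] by metis
  then have "lor u (F z) (F z) = lor u (F 0) (F 0)" using lor_mob[of \<phi> 0 0] by simp
  then show ?thesis by (simp add: F_0 lor_u orthonormal)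
qed

lemma F_in_hinf: assumes z: "norm z < 1" shows "F z \<in> hinf u"
proof -
  have "of_real (F z \<bullet> e 0) = cn 0 z" using cf_F[OF z, of 0] by (simp add: cf_def)
  then have "complex_of_real (F z \<bullet> e 0) = of_real ((1 - (norm z)\<^sup>2) powr (1 + t) * h 0 ((norm z)\<^sup>2))"
    by (simp add: cn_def)
  then have "F z \<bullet> e 0 = (1 - (norm z)\<^sup>2) powr (1 + t) * h 0 ((norm z)\<^sup>2)" by (simp only: of_real_eq_iff)
  moreover have "h 0 ((norm z)\<^sup>2) * (1 - (norm z)\<^sup>2) powr (1 + t) \<ge> 1"
    using norm_sq_bounds(1)[OF z] by (intro h_ge) auto
  ultimately show ?thesis by (simp add: hinf_iff lor_F_F[OF z] mult.commute)
qed

text \<open>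
  The closed span \<open>V\<close> contains the homogeneous parts of the power series of \<open>F\<close> at the origin. The part of
  degree \<open>n\<close> is a nonzero multiple of \<open>ev n (z ^ n)\<close> plus modes of smaller index, so \<open>V\<close> contains all
  modes by induction.
\<close>

lemma dense_F: "closure (span (F ` ball 0 1)) = UNIV"
proof -
  define V where "V = closure (span (F ` ball 0 1))"
  have V: "subspace V" "closed V" unfolding V_def by (simp_all add: closure_subspace)
  have "psum L z \<in> V" if "norm z < 1" for z
  proof -
    have "F z \<in> V" unfolding V_def using that by (intro subsetD[OF closure_subset] span_base) auto
    then have "inverse ((1 - (norm z)\<^sup>2) powr (1 + t)) *\<^sub>R F z \<in> V" by (rule subspace_scale[OF V(1)])
    then show ?thesis using disc_sq[OF that] by (simp add: F_def)
  qed
  note hp = hom_part_in_closed_subspace[OF poly_bounded_L V this]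
  have evV: "ev n w \<in> V" for n w
  proof (induction n arbitrary: w rule: less_induct)
    case (less n)
    have key: "ev n (z ^ n) \<in> V" if z: "norm z < 1" for z
    proof -
      have "hom_part L n z = (\<Sum>k<n. L k (n - k) (z ^ k * cnj z ^ (n - k))) + L n 0 (z ^ n)"
        by (simp add: hom_part_def lessThan_Suc_atMost[symmetric])
      moreover have "(\<Sum>k<n. L k (n - k) (z ^ k * cnj z ^ (n - k))) \<in> V"
      proof (rule subspace_sum[OF V(1)])
        fix k assume "k \<in> {..<n}"
        then have "k - (n - k) < n" by auto
        then show "L k (n - k) (z ^ k * cnj z ^ (n - k)) \<in> V"
          unfolding L_def by (auto intro!: subspace_scale[OF V(1)] less.IH subspace_0[OF V(1)])
      qed
      ultimately have "L n 0 (z ^ n) \<in> V"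
        using hp[OF _ z, of n] subspace_diff[OF V(1)] by (metis add_diff_cancel_left')
      then have "(b n * b 0) *\<^sub>R ev n (z ^ n) \<in> V" by (simp add: L_def)
      then have "inverse (b n) *\<^sub>R ((b n * b 0) *\<^sub>R ev n (z ^ n)) \<in> V"
        by (rule subspace_scale[OF V(1)])
      then show ?thesis using b_ge_1[of n] by (simp add: b_0)
    qed
    show "ev n w \<in> V"
    proof (cases "n = 0")
      case True
      have "ev 0 w = Re w *\<^sub>R ev 0 1" by (simp add: ev_def)
      then show ?thesis using key[of 0] subspace_scale[OF V(1)] True by simp
    next
      case False
      \<comment> \<open>An \<open>n\<close>-th root of a positive multiple of \<open>w\<close>, inside the disc.\<close>
      define z where "z = rcis (1 / 2) (Arg w / real n)"
      have "z ^ n = rcis ((1 / 2) ^ n) (Arg w)" using False by (simp add: z_def DeMoivre2)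
      then have "(norm w * 2 ^ n) *\<^sub>R z ^ n = rcis (norm w) (Arg w)"
        by (simp add: rcis_def scaleR_conv_of_real power_divide)
      then have "ev n w = (norm w * 2 ^ n) *\<^sub>R ev n (z ^ n)"
        using linear_scale[OF linear_ev, of n "norm w * 2 ^ n" "z ^ n"] by (simp add: rcis_cmod_Arg)
      moreover have "norm z < 1" by (simp add: z_def)
      ultimately show ?thesis using key subspace_scale[OF V(1)] by simp
    qed
  qed
  have "e j \<in> V" for j
  proof (cases "j = 0")
    case True
    then show ?thesis using evV[of 0 1] by (simp add: ev_def)
  next
    case False
    define n where "n = (j + 1) div 2"
    have n: "n > 0" "j = 2 * n - 1 \<or> j = 2 * n" using False by (auto simp: n_def)
    have "e (2 * n - 1) = ev n (of_real (1 / mu n))" "e (2 * n) = ev n (\<i> * of_real (1 / mu n))"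
      using n(1) mu_pos[of n] by (simp_all add: ev_def)
    then show ?thesis using n(2) evV by metis
  qed
  then have "span (range e) \<subseteq> V" by (intro span_minimal V) auto
  then have "closure (span (range e)) \<subseteq> V" by (rule closure_minimal[OF _ V(2)])
  then show ?thesis using total by (auto simp: V_def)
qed

lemma F_eq_u: assumes "norm z < 1" "F z = e 0" shows "z = 0"
proof -
  have "cn 1 z = 0" using cf_F[OF assms(1), of 1] assms(2) by (simp add: cf_def orthonormal complex_eq_iff)
  then show ?thesis using norm_cn_ge[OF assms(1)] by simp
qed

text \<open>
  By equivariance \<open>z\<close> may be moved to the origin, where \<open>F_eq_u\<close> applies: points of the hyperboloid at
  distance zero coincide.
\<close>

lemma lor_F_eq_1:
  assumes z: "norm z < 1" and w: "norm w < 1" and eq: "lor u (F z) (F w) = 1"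
  shows "z = w"
proof -
  obtain \<phi> where \<phi>: "is_mob \<phi>" "\<phi> 0 = z" using is_mob_transitive[OF z] by metis
  obtain \<psi> where \<psi>: "is_mob \<psi>" "\<And>z. norm z < 1 \<Longrightarrow> \<psi> (\<phi> z) = z" "\<And>z. norm z < 1 \<Longrightarrow> \<phi> (\<psi> z) = z"
    using is_mob_inverse[OF \<phi>(1)] by metis
  have z0: "\<psi> z = 0" using \<psi>(2)[of 0] \<phi>(2) by simp
  have nw: "norm (\<psi> w) < 1" by (rule is_mob_norm[OF \<psi>(1) w])
  have "lor u u (F (\<psi> w)) = 1" using lor_mob[OF \<psi>(1) z w] eq by (simp add: z0 F_0)
  then have "F (\<psi> w) \<bullet> e 0 = 1" by (simp add: lor_commute[of _ "e 0"] lor_u)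
  then have "lor u (F (\<psi> w) - e 0) (F (\<psi> w) - e 0) = 0"
    by (simp add: lor.diff_left lor.diff_right lor_F_F[OF nw] lor_u lor_commute[of _ "e 0"] u_dot_u inner_diff_left)
  moreover have "lor u (F (\<psi> w) - e 0) u = 0" using \<open>F (\<psi> w) \<bullet> e 0 = 1\<close>
    by (simp add: lor_u inner_diff_left u_dot_u)
  ultimately have "F (\<psi> w) - e 0 = 0" by (intro spacelike_if_orthogonal[OF u_in_hinf]) auto
  then have "\<psi> w = 0" using F_eq_u[OF nw] by simp
  then show ?thesis using \<psi>(3)[OF w] \<phi>(2) by simp
qed

lemma inj_F: "inj_on F (ball 0 1)"
  by (rule inj_onI) (use lor_F_eq_1 lor_F_F in force)

text \<open>
  The operator of the representation attached to an automorphism \<open>\<phi>\<close> of the disc. It is determined by its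
  values on the image of \<open>F\<close>, by \<open>opr_unique\<close>, which makes the assignment multiplicative.
\<close>

definition opr :: "(complex \<Rightarrow> complex) \<Rightarrow> 'h \<Rightarrow> 'h" where
  "opr \<phi> = (SOME T. bounded_linear T \<and> (\<forall>z\<in>ball 0 1. T (F z) = F (\<phi> z)) \<and> (\<forall>x y. lor u (T x) (T y) = lor u x y))"

lemma opr_props:
  assumes \<phi>: "is_mob \<phi>"
  shows "bounded_linear (opr \<phi>)" "norm z < 1 \<Longrightarrow> opr \<phi> (F z) = F (\<phi> z)"
    "lor u (opr \<phi> x) (opr \<phi> y) = lor u x y"
proof -
  obtain \<psi> where \<psi>: "is_mob \<psi>" "\<And>z. norm z < 1 \<Longrightarrow> \<psi> (\<phi> z) = z" "\<And>z. norm z < 1 \<Longrightarrow> \<phi> (\<psi> z) = z"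
    using is_mob_inverse[OF \<phi>] by metis
  define k where "k x = F (\<phi> (inv_into (ball 0 1) F x))" for x
  have k: "k (F z) = F (\<phi> z)" if "norm z < 1" for z
    using that inv_into_f_f[OF inj_F, of z] by (simp add: k_def)
  have "k ` F ` ball 0 1 = F ` ball 0 1"
  proof (rule equalityI; rule subsetI)
    fix x assume "x \<in> k ` F ` ball 0 1"
    then show "x \<in> F ` ball 0 1" using is_mob_norm[OF \<phi>] by (auto simp: k)
  next
    fix x assume "x \<in> F ` ball 0 1"
    then obtain z where z: "norm z < 1" "x = F z" by auto
    then have "x = k (F (\<psi> z))" using \<psi>(3) is_mob_norm[OF \<psi>(1)] by (simp add: k)
    then show "x \<in> k ` F ` ball 0 1" using is_mob_norm[OF \<psi>(1) z(1)] by auto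
  qed
  moreover have "lor u (k x) (k y) = lor u x y" if "x \<in> F ` ball 0 1" "y \<in> F ` ball 0 1" for x y
    using that lor_mob[OF \<phi>] by (auto simp: k)
  moreover have "e 0 \<in> F ` ball 0 1" by (rule image_eqI[of _ _ 0]) (simp_all add: F_0)
  ultimately obtain T where T: "bounded_linear T" "\<And>x. x \<in> F ` ball 0 1 \<Longrightarrow> T x = k x"
      "\<And>x y. lor u (T x) (T y) = lor u x y"
    using lorentz_extension[OF dense_F, of k] by metis
  have "\<exists>T. bounded_linear T \<and> (\<forall>z\<in>ball 0 1. T (F z) = F (\<phi> z)) \<and> (\<forall>x y. lor u (T x) (T y) = lor u x y)"
    by (rule exI[of _ T]) (use T k in auto)
  from someI_ex[OF this] show "bounded_linear (opr \<phi>)" "norm z < 1 \<Longrightarrow> opr \<phi> (F z) = F (\<phi> z)"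
    "lor u (opr \<phi> x) (opr \<phi> y) = lor u x y" unfolding opr_def by auto
qed

lemma opr_unique:
  assumes "is_mob \<phi>" "bounded_linear T" "\<And>z. norm z < 1 \<Longrightarrow> T (F z) = F (\<phi> z)"
  shows "opr \<phi> = T"
  by (rule closed_span_eq_if_bounded_linear_agree[OF opr_props(1)[OF assms(1)] assms(2) dense_F])
     (use opr_props(2)[OF assms(1)] assms(3) in auto)

lemma opr_comp:
  assumes "is_mob \<phi>" "is_mob \<psi>" shows "opr (\<lambda>z. \<phi> (\<psi> z)) = (\<lambda>x. opr \<phi> (opr \<psi> x))"
  by (rule opr_unique[OF is_mob_comp[OF assms] bounded_linear_compose[OF opr_props(1) opr_props(1)]])
     (use assms is_mob_norm opr_props(2) in auto)

lemma opr_cong: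
  assumes "is_mob \<phi>" "is_mob \<psi>" "\<And>z. norm z < 1 \<Longrightarrow> \<phi> z = \<psi> z" shows "opr \<phi> = opr \<psi>"
  by (rule opr_unique[OF assms(1) opr_props(1)[OF assms(2)]]) (use assms opr_props(2) in auto)

lemma opr_id:
  assumes "is_mob \<phi>" "\<And>z. norm z < 1 \<Longrightarrow> \<phi> z = z" shows "opr \<phi> = (\<lambda>x. x)"
  by (rule opr_unique[OF assms(1) bounded_linear_ident]) (use assms in auto)

lemma opr_inverse:
  assumes "is_mob \<phi>"
  obtains \<psi> where "is_mob \<psi>" "\<And>x. opr \<psi> (opr \<phi> x) = x" "\<And>x. opr \<phi> (opr \<psi> x) = x"
    "\<And>z. norm z < 1 \<Longrightarrow> \<phi> (\<psi> z) = z"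
proof -
  obtain \<psi> where \<psi>: "is_mob \<psi>" "\<And>z. norm z < 1 \<Longrightarrow> \<psi> (\<phi> z) = z" "\<And>z. norm z < 1 \<Longrightarrow> \<phi> (\<psi> z) = z"
    using is_mob_inverse[OF assms] by metis
  have "opr \<psi> (opr \<phi> x) = x" for x
    using opr_comp[OF \<psi>(1) assms] opr_id[OF is_mob_comp[OF \<psi>(1) assms] \<psi>(2)] by metis
  moreover have "opr \<phi> (opr \<psi> x) = x" for x
    using opr_comp[OF assms \<psi>(1)] opr_id[OF is_mob_comp[OF assms \<psi>(1)] \<psi>(3)] by metis
  ultimately show thesis using that \<psi>(1,3) by blast
qed

text \<open>
  An operator preserving \<open>lor u\<close> could exchange the two sheets. The image of \<open>x\<close> lies on the sheet of \<open>u\<close>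
  because \<open>u\<close> is the image of a point of the same sheet as \<open>x\<close>.
\<close>

lemma opr_hinf:
  assumes "is_mob \<phi>" "x \<in> hinf u" shows "opr \<phi> x \<in> hinf u"
proof -
  obtain \<psi> where \<psi>: "is_mob \<psi>" "\<And>z. norm z < 1 \<Longrightarrow> \<phi> (\<psi> z) = z"
    using is_mob_inverse[OF assms(1)] by metis
  have n: "norm (\<psi> 0) < 1" using is_mob_norm[OF \<psi>(1)] by simp
  have "opr \<phi> x \<bullet> e 0 = lor u (opr \<phi> x) (opr \<phi> (F (\<psi> 0)))"
    using opr_props(2)[OF assms(1) n] \<psi>(2)[of 0] by (simp add: F_0 lor_u)
  also have "\<dots> = lor u x (F (\<psi> 0))" by (rule opr_props(3)[OF assms(1)])
  also have "\<dots> \<ge> 1" by (rule lor_ge_1[OF assms(2) F_in_hinf[OF n]])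
  finally show ?thesis using assms(2) by (simp add: hinf_iff opr_props(3)[OF assms(1)])
qed

lemma opr_bij: assumes "is_mob \<phi>" shows "bij_betw (opr \<phi>) (hinf u) (hinf u)"
proof -
  obtain \<psi> where "is_mob \<psi>" "\<And>x. opr \<psi> (opr \<phi> x) = x" "\<And>x. opr \<phi> (opr \<psi> x) = x"
    using opr_inverse[OF assms] by metis
  then show ?thesis by (intro bij_betwI[where g = "opr \<psi>"]) (auto simp: opr_hinf assms)
qed

definition rho :: "(real^2^2) set \<Rightarrow> 'h \<Rightarrow> 'h" where
  "rho g = restrict (opr (disc_action (SOME A. A \<in> g))) (hinf u)"

lemma PSL_dets: "g \<in> carrier PSL2R \<Longrightarrow> A \<in> g \<Longrightarrow> det A = 1"
proof -
  have "det (- A) = det A" for A :: "real^2^2" by (simp add: det_2)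
  then show "g \<in> carrier PSL2R \<Longrightarrow> A \<in> g \<Longrightarrow> det A = 1" by (auto simp: carrier_PSL2R)
qed

text \<open>
  The two representatives \<open>A\<close> and \<open>- A\<close> of an element act in the same way on the disc.
\<close>

lemma rho_eq:
  assumes "g \<in> carrier PSL2R" "A \<in> g"
  shows "rho g = restrict (opr (disc_action A)) (hinf u)"
proof -
  define B where "B = (SOME A. A \<in> g)"
  have B: "B \<in> g" using assms(2) unfolding B_def by (rule someI)
  then have "B = A \<or> B = - A" using assms by (auto simp: carrier_PSL2R)
  then have "opr (disc_action B) = opr (disc_action A)"
    using PSL_dets[OF assms(1)] assms(2) B by (intro opr_cong is_mob_disc_action) (auto simp: disc_action_minus)
  then show ?thesis by (simp add: rho_def B_def)
qed

lemma rho_opr: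
  assumes "is_mob \<phi>" obtains g where "g \<in> carrier PSL2R" "rho g = restrict (opr \<phi>) (hinf u)"
proof -
  obtain A where A: "det A = 1" "\<And>z. norm z < 1 \<Longrightarrow> disc_action A z = \<phi> z"
    using is_mob_disc_action_ex[OF assms] by metis
  have g: "{A, - A} \<in> carrier PSL2R" using A(1) by (auto simp: carrier_PSL2R)
  have "rho {A, - A} = restrict (opr (disc_action A)) (hinf u)" by (rule rho_eq[OF g]) simp
  then show thesis using that[OF g] opr_cong[OF is_mob_disc_action[OF A(1)] assms A(2)] by simp
qed

lemma rho_carrier_opr:
  assumes "g \<in> carrier PSL2R"
  obtains \<phi> where "is_mob \<phi>" "rho g = restrict (opr \<phi>) (hinf u)"
proof -
  obtain A where "A \<in> g" using assms by (auto simp: carrier_PSL2R)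
  then show thesis using that rho_eq[OF assms] is_mob_disc_action PSL_dets[OF assms] by blast
qed

lemma rho_carrier:
  assumes g: "g \<in> carrier PSL2R" shows "rho g \<in> carrier (isom_group u)"
proof -
  obtain \<phi> where \<phi>: "is_mob \<phi>" "rho g = restrict (opr \<phi>) (hinf u)" using rho_carrier_opr[OF g] by metis
  have "bij_betw (rho g) (hinf u) (hinf u)"
    unfolding \<phi>(2) using opr_bij[OF \<phi>(1)] by (simp cong: bij_betw_cong)
  then show ?thesis
    using \<phi> by (auto simp: isom_group_def Bij_def opr_props(3) intro!: lor_isometry_hdist)
qed

lemma rho_hom: "rho \<in> hom PSL2R (isom_group u)"
  unfolding hom_def
proof (intro CollectI conjI ballI funcsetI rho_carrier)
  fix g g' assume g: "g \<in> carrier PSL2R" "g' \<in> carrier PSL2R"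
  define C where "C = (SOME A. A \<in> g \<otimes>\<^bsub>PSL2R\<^esub> g')"
  have "g \<noteq> {}" "g' \<noteq> {}" using g by (auto simp: carrier_PSL2R)
  then have "g \<otimes>\<^bsub>PSL2R\<^esub> g' \<noteq> {}" by (auto simp: mult_PSL2R)
  then have "C \<in> g \<otimes>\<^bsub>PSL2R\<^esub> g'" unfolding C_def by (simp add: some_in_eq)
  then obtain A B where AB: "A \<in> g" "B \<in> g'" "C = A ** B" by (auto simp: mult_PSL2R)
  have d: "det A = 1" "det B = 1" using PSL_dets g AB by auto
  then have dC: "det C = 1" using AB(3) by (simp add: det_mul)
  have "opr (disc_action C) = opr (\<lambda>z. disc_action A (disc_action B z))"
    by (rule opr_cong[OF is_mob_disc_action[OF dC]
          is_mob_comp[OF is_mob_disc_action[OF d(1)] is_mob_disc_action[OF d(2)]]])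
       (simp add: AB(3) disc_action_mult[OF d])
  then have C: "opr (disc_action C) = (\<lambda>x. opr (disc_action A) (opr (disc_action B) x))"
    using opr_comp[OF is_mob_disc_action[OF d(1)] is_mob_disc_action[OF d(2)]] by simp
  have Bij: "rho g \<in> Bij (hinf u)" "rho g' \<in> Bij (hinf u)"
    using rho_carrier[OF g(1)] rho_carrier[OF g(2)] by (auto simp: isom_group_def)
  have "rho (g \<otimes>\<^bsub>PSL2R\<^esub> g') = restrict (opr (disc_action C)) (hinf u)" by (simp add: rho_def C_def)
  also have "\<dots> = compose (hinf u) (rho g) (rho g')"
    using opr_hinf[OF is_mob_disc_action[OF d(2)]]
    by (auto simp: fun_eq_iff compose_def C rho_eq[OF g(1) AB(1)] rho_eq[OF g(2) AB(2)])
  finally show "rho (g \<otimes>\<^bsub>PSL2R\<^esub> g') = rho g \<otimes>\<^bsub>isom_group u\<^esub> rho g'"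
    using Bij by (simp add: isom_group_def BijGroup_def)
qed

lemma rho_equivariant: "equivariant rho F"
  unfolding equivariant_def
proof (intro ballI)
  fix g A and z :: complex assume g: "g \<in> carrier PSL2R" "A \<in> g" "z \<in> unit_disc"
  then show "F (disc_action A z) = rho g (F z)"
    using opr_props(2)[OF is_mob_disc_action[OF PSL_dets[OF g(1,2)]], of z]
    by (simp add: rho_eq[OF g(1,2)] F_in_hinf)
qed

end



section \<open>Irreducibility\<close>

context model
begin

definition rot :: "real \<Rightarrow> 'h \<Rightarrow> 'h" where "rot a = opr (\<lambda>z. cis a * z)"

lemma is_mob_cis: "is_mob (\<lambda>z. cis a * z)"
  by (rule is_mob_rotate) simp

lemma bounded_linear_rot: "bounded_linear (rot a)"
  unfolding rot_def by (rule opr_props(1)[OF is_mob_cis])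

lemma cf_rot: "cf n (rot a x) = cis (real n * a) * cf n x"
proof -
  have "(\<lambda>x. cf n (rot a x)) = (\<lambda>x. cis (real n * a) * cf n x)"
  proof (rule closed_span_eq_if_bounded_linear_agree[OF _ _ dense_F])
    show "bounded_linear (\<lambda>x. cf n (rot a x))"
      by (rule bounded_linear_compose[OF bounded_linear_cf bounded_linear_rot])
    show "bounded_linear (\<lambda>x. cis (real n * a) * cf n x)"
      by (rule bounded_linear_const_mult[OF bounded_linear_cf])
    fix x assume "x \<in> F ` ball 0 1"
    then obtain z where z: "norm z < 1" "x = F z" by auto
    have z': "norm (cis a * z) < 1" using z(1) by (simp add: norm_mult)
    have "cn n (cis a * z) = cis a ^ n * cn n z" by (rule cn_rotate) simp
    then show "cf n (rot a x) = cis (real n * a) * cf n x"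
      unfolding rot_def z(2) opr_props(2)[OF is_mob_cis z(1)] cf_F[OF z(1)] cf_F[OF z'] Complex.DeMoivre .
  qed
  then show ?thesis by metis
qed

lemma rot_dot_u: "rot a x \<bullet> e 0 = x \<bullet> e 0"
  using cf_rot[of 0 a x] by (simp add: cf_def)

lemma norm_rot: "norm (rot a x) = norm x"
proof -
  have "lor u (rot a x) (rot a x) = lor u x x"
    unfolding rot_def by (rule opr_props(3)[OF is_mob_cis])
  then have "(norm (rot a x))\<^sup>2 = (norm x)\<^sup>2" by (simp add: norm_sq_lor rot_dot_u)
  then show ?thesis by (simp add: power2_eq_iff_nonneg)
qed

lemma eq_multiple_of_u:
  assumes "\<And>n. n > 0 \<Longrightarrow> cf n x = 0" shows "x = (x \<bullet> e 0) *\<^sub>R e 0"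
proof (rule cf_eqI)
  fix n
  interpret cf: bounded_linear "cf n" by (rule bounded_linear_cf)
  show "cf n x = cf n ((x \<bullet> e 0) *\<^sub>R e 0)"
    using assms[of n] by (cases n) (simp_all add: cf.scaleR, simp_all add: cf_def orthonormal scaleR_conv_of_real complex_eq_iff)
qed

lemma rot_fixed:
  assumes "\<And>a. rot a x = x" shows "x = (x \<bullet> e 0) *\<^sub>R e 0"
proof (rule eq_multiple_of_u)
  fix n :: nat assume n: "n > 0"
  have "cf n x = cis (real n * (pi / real n)) * cf n x" using cf_rot[of n "pi / real n" x] assms by simp
  then have "cf n x = - cf n x" using n by simp
  then show "cf n x = 0" by simp
qed

text \<open>
  Averages over the cyclic groups of rotations of order \<open>2 ^ m\<close>: the step from \<open>m\<close> to \<open>m + 1\<close> removes the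
  Fourier modes whose index is divisible by \<open>2 ^ m\<close> but not by \<open>2 ^ (m + 1)\<close>.
\<close>

primrec avg :: "nat \<Rightarrow> 'h \<Rightarrow> 'h" where
  "avg 0 x = x"
| "avg (Suc m) x = (1 / 2) *\<^sub>R (avg m x + rot (pi / 2 ^ m) (avg m x))"

lemma linear_avg: "linear (avg m)"
proof (induction m)
  case 0
  have "avg 0 = (\<lambda>x. x)" by (simp add: fun_eq_iff)
  then show ?case by (simp add: linear_ident)
next
  case (Suc m)
  have eq: "avg (Suc m) = (\<lambda>x. (1 / 2) *\<^sub>R (avg m x + (rot (pi / 2 ^ m) \<circ> avg m) x))" by (simp add: fun_eq_iff)
  show ?case unfolding eq
    by (intro linear_compose_scale_right linear_compose_add Suc linear_compose bounded_linear.linear[OF bounded_linear_rot])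
qed

lemma norm_avg: "norm (avg m x) \<le> norm x"
proof (induction m)
  case (Suc m)
  have "norm (avg m x + rot (pi / 2 ^ m) (avg m x)) \<le> 2 * norm (avg m x)"
    by (rule order_trans[OF norm_triangle_ineq]) (simp add: norm_rot)
  then show ?case using Suc by simp
qed simp

lemma cf_avg_Suc: "cf n (avg (Suc m) x) = (1 + cis (real n * (pi / 2 ^ m))) * cf n (avg m x) / 2"
proof -
  interpret cf: bounded_linear "cf n" by (rule bounded_linear_cf)
  show ?thesis by (simp add: cf.scaleR cf.add cf_rot scaleR_conv_of_real distrib_right)
qed

lemma cf_avg_0: "cf 0 (avg m x) = cf 0 x"
  by (induction m) (simp_all add: cf_avg_Suc del: avg.simps(2))

lemma cf_avg_zero: "cf n x = 0 \<Longrightarrow> cf n (avg m x) = 0"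
  by (induction m) (simp_all add: cf_avg_Suc del: avg.simps(2))

lemma cf_avg: "\<not> 2 ^ m dvd n \<Longrightarrow> cf n (avg m x) = 0"
proof (induction m)
  case (Suc m)
  show ?case
  proof (cases "2 ^ m dvd n")
    case True
    then obtain q where q: "n = 2 ^ m * q" by (auto elim: dvdE)
    then have "odd q" using Suc.prems by auto
    then obtain j where j: "q = 2 * j + 1" by (auto elim: oddE)
    have "real n * (pi / 2 ^ m) = pi + real j * (2 * pi)" by (simp add: q j field_simps)
    then have "cis (real n * (pi / 2 ^ m)) = - cis (real j * (2 * pi))" by (simp add: cis_mult[symmetric])
    also have "cis (real j * (2 * pi)) = 1" by (simp only: Complex.DeMoivre[symmetric] cis_2pi power_one)
    finally show ?thesis by (simp add: cf_avg_Suc del: avg.simps(2))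
  next
    case False
    then show ?thesis using Suc.IH by (simp add: cf_avg_Suc del: avg.simps(2))
  qed
qed simp

lemma cf_eventually_zero:
  assumes "y \<in> span (range e)" shows "\<exists>N. \<forall>n>N. cf n y = 0"
  using assms
proof (induction rule: span_induct_alt)
  case base
  show ?case using linear_0[OF bounded_linear.linear[OF bounded_linear_cf]] by blast
next
  case (step c x y)
  then obtain j N where x: "x = e j" and N: "\<forall>n>N. cf n y = 0" by auto
  have "cf n (c *\<^sub>R x + y) = 0" if n: "n > max N (Suc j)" for n
  proof -
    interpret cf: bounded_linear "cf n" by (rule bounded_linear_cf)
    have "j \<noteq> 2 * n - 1" "j \<noteq> 2 * n" using n by auto
    then have "cf n x = 0" using n by (simp add: x cf_def orthonormal complex_eq_iff)
    then show ?thesis using n N by (simp add: cf.add cf.scaleR)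
  qed
  then show ?case by blast
qed

text \<open>
  A vector with finitely many Fourier modes is mapped to its \<open>u\<close>-component as soon as \<open>2 ^ m\<close> exceeds their
  indices. The averages are contractions, so density of these vectors suffices.
\<close>

lemma avg_tendsto: "(\<lambda>m. avg m x) \<longlonglongrightarrow> (x \<bullet> e 0) *\<^sub>R e 0"
proof (rule LIMSEQ_I)
  fix \<epsilon> :: real assume \<epsilon>: "\<epsilon> > 0"
  have "x \<in> closure (span (range e))" using total by simp
  then obtain y where y: "y \<in> span (range e)" "dist y x < \<epsilon> / 2"
    unfolding closure_approachable using \<epsilon> by (metis half_gt_zero)
  obtain N where N: "\<And>n. n > N \<Longrightarrow> cf n y = 0" using cf_eventually_zero[OF y(1)] by blast
  have avgy: "avg m y = (y \<bullet> e 0) *\<^sub>R e 0" if m: "m \<ge> Suc N" for m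
  proof -
    have "cf n (avg m y) = 0" if n: "n > 0" for n
    proof (cases "2 ^ m dvd n")
      case True
      then have "2 ^ m \<le> n" using n by (simp add: dvd_imp_le)
      moreover have "m < 2 ^ m" by (rule less_exp)
      ultimately have "n > N" using m by linarith
      then show ?thesis using N cf_avg_zero by blast
    next
      case False
      then show ?thesis by (rule cf_avg)
    qed
    then have "avg m y = (avg m y \<bullet> e 0) *\<^sub>R e 0" by (rule eq_multiple_of_u)
    moreover have "avg m y \<bullet> e 0 = y \<bullet> e 0" using cf_avg_0[of m y] by (simp add: cf_def)
    ultimately show ?thesis by simp
  qed
  have "norm (avg m x - (x \<bullet> e 0) *\<^sub>R e 0) < \<epsilon>" if m: "m \<ge> Suc N" for m
  proof -
    have "avg m x - (x \<bullet> e 0) *\<^sub>R e 0 = avg m (x - y) - ((x - y) \<bullet> e 0) *\<^sub>R e 0"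
      by (simp add: linear_diff[OF linear_avg] avgy[OF m] inner_diff_left scaleR_left_diff_distrib)
    also have "norm \<dots> \<le> norm (avg m (x - y)) + \<bar>(x - y) \<bullet> e 0\<bar>"
      by (rule order_trans[OF norm_triangle_ineq4]) (simp add: norm_e)
    also have "\<dots> \<le> norm (x - y) + norm (x - y)"
      using norm_avg[of m "x - y"] Cauchy_Schwarz_ineq2[of "x - y" "e 0"] by (simp add: norm_e)
    also have "\<dots> < \<epsilon>" using y(2) by (simp add: dist_norm norm_minus_commute)
    finally show ?thesis .
  qed
  then show "\<exists>no. \<forall>n\<ge>no. norm (avg n x - (x \<bullet> e 0) *\<^sub>R e 0) < \<epsilon>" by blast
qed

text \<open>
  The averages of \<open>x\<close> over rotations stay in \<open>W\<close> and converge to a nonzero multiple of \<open>u\<close>; the orbit of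
  \<open>u\<close> is the image of \<open>F\<close>, which is total.
\<close>

lemma invariant_subspace_eq_UNIV:
  assumes W: "subspace W" "closed W" and inv: "\<And>\<phi> x. is_mob \<phi> \<Longrightarrow> x \<in> W \<Longrightarrow> opr \<phi> x \<in> W"
    and x: "x \<in> W" "x \<in> hinf u"
  shows "W = UNIV"
proof -
  have rotW: "rot a y \<in> W" if "y \<in> W" for a y
    unfolding rot_def by (rule inv[OF is_mob_cis that])
  have "avg m x \<in> W" for m
    by (induction m) (auto intro!: subspace_scale[OF W(1)] subspace_add[OF W(1)] rotW x)
  then have "(x \<bullet> e 0) *\<^sub>R e 0 \<in> W" using closed_sequentially[OF W(2) _ avg_tendsto] by blast
  then have "inverse (x \<bullet> e 0) *\<^sub>R ((x \<bullet> e 0) *\<^sub>R e 0) \<in> W" by (rule subspace_scale[OF W(1)])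
  then have uW: "e 0 \<in> W" using x(2) by (simp add: hinf_iff)
  have "F z \<in> W" if z: "norm z < 1" for z
  proof -
    obtain \<phi> where \<phi>: "is_mob \<phi>" "\<phi> 0 = z" using is_mob_transitive[OF z] by metis
    have "opr \<phi> (F 0) \<in> W" using inv[OF \<phi>(1) uW] by (simp add: F_0)
    then show ?thesis using opr_props(2)[OF \<phi>(1), of 0] \<phi>(2) by simp
  qed
  then have "span (F ` ball 0 1) \<subseteq> W" by (intro span_minimal W) auto
  then have "closure (span (F ` ball 0 1)) \<subseteq> W" by (rule closure_minimal[OF _ W(2)])
  then show ?thesis using dense_F by auto
qed

lemma rho_invariant_opr:
  assumes T: "T \<subseteq> hinf u" and inv: "\<And>g. g \<in> carrier PSL2R \<Longrightarrow> rho g ` T = T"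
    and \<phi>: "is_mob \<phi>" "x \<in> T"
  shows "opr \<phi> x \<in> T"
proof -
  obtain g where g: "g \<in> carrier PSL2R" "rho g = restrict (opr \<phi>) (hinf u)" using rho_opr[OF \<phi>(1)] by metis
  have "rho g x \<in> T" using inv[OF g(1)] \<phi>(2) by blast
  then show ?thesis using g(2) \<phi>(2) T by auto
qed

lemma rho_irreducible:
  assumes T: "closed_totally_geodesic u T" and inv: "\<And>g. g \<in> carrier PSL2R \<Longrightarrow> rho g ` T = T"
  shows "T = hinf u"
proof -
  obtain W where W: "T \<noteq> {}" "subspace W" "closed W" "T = hinf u \<inter> W"
    using T unfolding closed_totally_geodesic_def by blast
  define V where "V = closure (span T)"
  have V: "subspace V" "closed V" unfolding V_def by (simp_all add: closure_subspace)
  have sub: "span T \<subseteq> V" unfolding V_def by (rule closure_subset)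
  have VW: "V \<subseteq> W" unfolding V_def using W by (intro closure_minimal span_minimal) auto
  have "opr \<phi> y \<in> V" if \<phi>: "is_mob \<phi>" and y: "y \<in> V" for \<phi> y
  proof -
    interpret o: bounded_linear "opr \<phi>" by (rule opr_props(1)[OF \<phi>])
    have "opr \<phi> ` span T = span (opr \<phi> ` T)" by (rule linear_span_image[OF o.linear_axioms, symmetric])
    also have "\<dots> \<subseteq> span T"
      using rho_invariant_opr[OF _ inv \<phi>] W(4) by (intro span_mono) auto
    finally have "opr \<phi> ` span T \<subseteq> V" using sub by blast
    then have "opr \<phi> ` closure (span T) \<subseteq> V"
      by (intro image_closure_subset[OF linear_continuous_on[OF opr_props(1)[OF \<phi>]] V(2)])
    then show ?thesis using y by (auto simp: V_def)
  qed
  moreover obtain x where x: "x \<in> T" using W(1) by blast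
  have "x \<in> V" "x \<in> hinf u" using sub span_base[OF x] x W(4) by auto
  ultimately have "V = UNIV" using invariant_subspace_eq_UNIV[OF V] by blast
  then show ?thesis using VW W(4) by blast
qed

section \<open>Non-elementarity\<close>

text \<open>
  With the coefficients of the hyperbolic plane, the difference of both sides is orthogonal to \<open>\<gamma> 0\<close> and has
  square zero, hence vanishes. The set \<open>I\<close> covers lines and rays.
\<close>

lemma geodesic_in_plane:
  assumes I: "0 \<in> I" "1 \<in> I" "s \<in> I" and g: "\<And>s. s \<in> I \<Longrightarrow> \<gamma> s \<in> hinf u"
    "\<And>s t. s \<in> I \<Longrightarrow> t \<in> I \<Longrightarrow> hdist u (\<gamma> s) (\<gamma> t) = \<bar>s - t\<bar>"
  shows "\<gamma> s = (sinh (1 - s) / sinh 1) *\<^sub>R \<gamma> 0 + (sinh s / sinh 1) *\<^sub>R \<gamma> 1"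
proof -
  define a b where "a = sinh (1 - s) / sinh 1" and "b = sinh s / sinh 1"
  have sh: "sinh (1::real) \<noteq> 0" by simp
  have l: "lor u (\<gamma> s) (\<gamma> t) = cosh (s - t)" if "s \<in> I" "t \<in> I" for s t
    by (rule lor_eq_cosh[OF g(1)[OF that(1)] g(1)[OF that(2)] g(2)[OF that]])
  have i1: "a + b * cosh 1 = cosh s" "a * cosh 1 + b = cosh (1 - s)"
  proof -
    have "sinh (1 - s) + sinh s * cosh 1 = sinh 1 * cosh s" by (simp add: sinh_diff)
    then show "a + b * cosh 1 = cosh s" using sh by (simp add: a_def b_def divide_simps mult.commute)
    have "sinh (1 - s) * cosh 1 + sinh s = sinh 1 * cosh (1 - s)"
      using sinh_diff[of 1 "1 - s"] by (simp add: mult.commute)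
    then show "a * cosh 1 + b = cosh (1 - s)" using sh by (simp add: a_def b_def divide_simps mult.commute)
  qed
  have i2: "a * cosh s + b * cosh (1 - s) = 1"
  proof -
    have "sinh (1 - s) * cosh s + sinh s * cosh (1 - s) = sinh ((1 - s) + s)"
      unfolding sinh_add by (simp add: mult.commute)
    then show ?thesis using sh by (simp add: a_def b_def divide_simps)
  qed
  define x where "x = \<gamma> s - a *\<^sub>R \<gamma> 0 - b *\<^sub>R \<gamma> 1"
  have c: "cosh (- r) = cosh r" "cosh (s - 1) = cosh (1 - s)" for r :: real
    using cosh_minus[of "1 - s"] by simp_all
  have x0: "lor u x (\<gamma> 0) = 0"
    using i1 by (simp add: x_def lor.diff_left lor.scaleR_left l I)
  have x1: "lor u x (\<gamma> 1) = 0"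
    using i1 by (simp add: x_def lor.diff_left lor.scaleR_left l I c)
  have xs: "lor u x (\<gamma> s) = 0"
    using i2 by (simp add: x_def lor.diff_left lor.scaleR_left l I c)
  have "lor u x x = 0"
    by (subst (2) x_def) (simp add: lor.diff_right lor.scaleR_right x0 x1 xs)
  then have "x = 0" using x0 by (intro spacelike_if_orthogonal[OF g(1)[OF I(1)]]) auto
  then show ?thesis by (simp add: x_def a_def b_def algebra_simps)
qed

text \<open>
  A point fixed by all rotations is \<open>u = F 0\<close>, which is moved by any automorphism moving the origin.
\<close>

lemma no_fixed_point:
  assumes "x \<in> hinf u" shows "\<exists>g\<in>carrier PSL2R. rho g x \<noteq> x"
proof (rule ccontr)
  assume "\<not> ?thesis"
  then have fix_: "opr \<phi> x = x" if "is_mob \<phi>" for \<phi>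
    using rho_opr[OF that] assms by (metis restrict_apply')
  have x: "x = (x \<bullet> e 0) *\<^sub>R e 0" by (rule rot_fixed) (simp add: rot_def fix_ is_mob_cis)
  have "lor u ((x \<bullet> e 0) *\<^sub>R e 0) ((x \<bullet> e 0) *\<^sub>R e 0) = (x \<bullet> e 0)\<^sup>2"
    by (simp add: lor.scaleR_left lor.scaleR_right lor_u u_dot_u power2_eq_square)
  then have "lor u x x = (x \<bullet> e 0)\<^sup>2" unfolding x[symmetric] .
  then have "x \<bullet> e 0 = 1 \<or> x \<bullet> e 0 = - 1" "x \<bullet> e 0 > 0" using assms by (auto simp: hinf_iff power2_eq_1_iff)
  then have "x \<bullet> e 0 = 1" by linarith
  then have xu: "x = F 0" using x by (simp add: F_0)
  obtain \<phi> where \<phi>: "is_mob \<phi>" "\<phi> 0 = 1 / 2" using is_mob_transitive[of "1/2"] by auto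
  have "F (1 / 2) = e 0" using fix_[OF \<phi>(1)] opr_props(2)[OF \<phi>(1), of 0] \<phi>(2) xu by (simp add: F_0)
  then show False using F_eq_u[of "1 / 2"] by simp
qed

text \<open>
  The plane spanned by an invariant line would be a closed invariant subspace of finite dimension.
\<close>

lemma no_invariant_line:
  assumes inf: "infinite_dimensional (UNIV :: 'h set)" and L: "geodesic_line u \<Lambda>"
  shows "\<exists>g\<in>carrier PSL2R. rho g ` \<Lambda> \<noteq> \<Lambda>"
proof (rule ccontr)
  assume "\<not> ?thesis"
  then have inv: "rho g ` \<Lambda> = \<Lambda>" if "g \<in> carrier PSL2R" for g using that by blast
  obtain \<gamma> where \<gamma>: "range \<gamma> = \<Lambda>" "\<Lambda> \<subseteq> hinf u" "\<And>s t. hdist u (\<gamma> s) (\<gamma> t) = \<bar>s - t\<bar>"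
    using L unfolding geodesic_line_def by blast
  define W where "W = span {\<gamma> 0, \<gamma> 1}"
  have W: "subspace W" "closed W" unfolding W_def by (simp_all add: span_finite_closed)
  have LW: "\<Lambda> \<subseteq> W"
  proof
    fix x assume "x \<in> \<Lambda>"
    then obtain s where "x = \<gamma> s" using \<gamma>(1) by blast
    then have "x = (sinh (1 - s) / sinh 1) *\<^sub>R \<gamma> 0 + (sinh s / sinh 1) *\<^sub>R \<gamma> 1"
      using geodesic_in_plane[of UNIV s \<gamma>] \<gamma> by blast
    then show "x \<in> W" unfolding W_def by (simp add: span_add span_scale span_base)
  qed
  have "opr \<phi> x \<in> W" if \<phi>: "is_mob \<phi>" and x: "x \<in> W" for \<phi> x
  proof -
    interpret o: bounded_linear "opr \<phi>" by (rule opr_props(1)[OF \<phi>])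
    have "opr \<phi> ` {\<gamma> 0, \<gamma> 1} \<subseteq> W" using rho_invariant_opr[OF \<gamma>(2) inv \<phi>] \<gamma>(1) LW by blast
    then have "span (opr \<phi> ` {\<gamma> 0, \<gamma> 1}) \<subseteq> W" by (intro span_minimal W)
    then have "opr \<phi> ` W \<subseteq> W" unfolding W_def linear_span_image[OF o.linear_axioms] .
    then show ?thesis using x by blast
  qed
  moreover have "\<gamma> 0 \<in> W" "\<gamma> 0 \<in> hinf u" using \<gamma>(1,2) LW by auto
  ultimately have "W = UNIV" using invariant_subspace_eq_UNIV[OF W] by blast
  then show False using inf unfolding infinite_dimensional_def W_def
    by (metis finite.emptyI finite.insertI order_refl)
qed

text \<open>
  A ray, rescaled by \<open>exp (- s)\<close>, converges to a nonzero null vector \<open>l\<close>. If a rotation fixes the class of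
  the ray, the distance between the ray and its image is bounded, which forces the limits to be orthogonal and
  hence proportional; they have the same \<open>u\<close>-component, so \<open>l\<close> is fixed. Being fixed by all rotations,
  \<open>l\<close> is a multiple of \<open>u\<close>, which is not null.
\<close>

lemma no_fixed_boundary_point:
  assumes \<xi>: "\<xi> \<in> boundary_at_infinity u"
  shows "\<exists>g\<in>carrier PSL2R. boundary_map u (rho g) \<xi> \<noteq> \<xi>"
proof (rule ccontr)
  assume "\<not> ?thesis"
  then have inv: "boundary_map u (rho g) \<xi> = \<xi>" if "g \<in> carrier PSL2R" for g using that by blast
  obtain r where r: "geodesic_ray u r" "\<xi> = asymptotic u `` {r}"
    using \<xi> unfolding boundary_at_infinity_def quotient_def by blast
  have rh: "r s \<in> hinf u" if "s \<ge> 0" for s using r(1) that by (simp add: geodesic_ray_def)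
  have rd: "hdist u (r s) (r s') = \<bar>s - s'\<bar>" if "s \<ge> 0" "s' \<ge> 0" for s s'
    using r(1) that by (simp add: geodesic_ray_def)
  have refl: "(q, q) \<in> asymptotic u" if "geodesic_ray u q" for q
    using that unfolding asymptotic_def geodesic_ray_def by auto
  have asy: "\<exists>C. \<forall>s\<ge>0. hdist u (r s) (rot a (r s)) \<le> C" for a
  proof -
    obtain g where g: "g \<in> carrier PSL2R" "rho g = restrict (rot a) (hinf u)"
      using rho_opr[OF is_mob_cis] unfolding rot_def by metis
    have rg: "(rho g \<circ> r) s = rot a (r s)" if "s \<ge> 0" for s using rh[OF that] by (simp add: g(2))
    have "geodesic_ray u (rho g \<circ> r)"
      unfolding geodesic_ray_def
    proof (intro conjI allI impI)
      fix s :: real assume s: "s \<ge> 0"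
      show "(rho g \<circ> r) s \<in> hinf u"
        unfolding rg[OF s] rot_def by (rule opr_hinf[OF is_mob_cis rh[OF s]])
      fix s' :: real assume s': "s' \<ge> 0"
      have "lor u (rot a (r s)) (rot a (r s')) = lor u (r s) (r s')"
        unfolding rot_def by (rule opr_props(3)[OF is_mob_cis])
      then show "hdist u ((rho g \<circ> r) s) ((rho g \<circ> r) s') = \<bar>s - s'\<bar>"
        unfolding rg[OF s] rg[OF s'] using lor_isometry_hdist rd[OF s s'] by metis
    qed
    then have "rho g \<circ> r \<in> boundary_map u (rho g) \<xi>"
      using refl refl[OF r(1)] r(2) unfolding boundary_map_def by blast
    then have "rho g \<circ> r \<in> \<xi>" using inv[OF g(1)] by simp
    then have "(r, rho g \<circ> r) \<in> asymptotic u" unfolding r(2) by blast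
    then show ?thesis unfolding asymptotic_def using rg by (auto simp del: comp_apply)
  qed
  define q where "q n = exp (- real n) *\<^sub>R r (real n)" for n :: nat
  define l where "l = (- exp (- 1) / (2 * sinh 1)) *\<^sub>R r 0 + (1 / (2 * sinh 1)) *\<^sub>R r 1"
  have e2: "(\<lambda>n. exp (- 2 :: real) ^ n) \<longlonglongrightarrow> 0" by (rule LIMSEQ_power_zero) simp
  have e2': "exp (- real n) * exp (- real n) = exp (- 2) ^ n" for n
    by (simp add: exp_add[symmetric] exp_of_nat_mult[symmetric])
  have ee: "exp (- real n) * exp (real n) = 1" for n by (simp add: exp_add[symmetric])
  have q_eq: "q n = ((exp 1 * exp (- 2) ^ n - exp (- 1)) / (2 * sinh 1)) *\<^sub>R r 0 + ((1 - exp (- 2) ^ n) / (2 * sinh 1)) *\<^sub>R r 1" for n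
  proof -
    have "r (real n) = (sinh (1 - real n) / sinh 1) *\<^sub>R r 0 + (sinh (real n) / sinh 1) *\<^sub>R r 1"
      by (rule geodesic_in_plane[of "{0..}"]) (auto simp: rh rd)
    then have "q n = ((exp (- real n) * sinh (1 - real n)) / sinh 1) *\<^sub>R r 0 + ((exp (- real n) * sinh (real n)) / sinh 1) *\<^sub>R r 1"
      by (simp add: q_def scaleR_right_distrib)
    moreover have A: "exp (- real n) * sinh (real n) = (1 - exp (- 2) ^ n) / 2"
      using ee[of n] e2'[of n] by (simp add: sinh_def algebra_simps)
    moreover have B: "exp (- real n) * sinh (1 - real n) = (exp 1 * exp (- 2) ^ n - exp (- 1)) / 2"
    proof -
      have "exp (1 - real n) = exp 1 * exp (- real n)" "exp (- (1 - real n)) = exp (- 1) * exp (real n)"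
        by (simp_all add: exp_add[symmetric])
      then have "exp (- real n) * sinh (1 - real n)
          = (exp 1 * (exp (- real n) * exp (- real n)) - exp (- 1) * (exp (- real n) * exp (real n))) / 2"
        by (simp add: sinh_def algebra_simps)
      then show ?thesis unfolding ee e2' by simp
    qed
    ultimately show ?thesis unfolding A B by simp
  qed
  have "q \<longlonglongrightarrow> ((exp 1 * 0 - exp (- 1)) / (2 * sinh 1)) *\<^sub>R r 0 + ((1 - 0) / (2 * sinh 1)) *\<^sub>R r 1"
    unfolding q_eq[abs_def] by (intro tendsto_intros e2) auto
  then have ql: "q \<longlonglongrightarrow> l" by (simp add: l_def)
  have null: "lor u l (rot a l) = 0" for a
  proof -
    obtain C where C: "\<And>s. s \<ge> 0 \<Longrightarrow> hdist u (r s) (rot a (r s)) \<le> C" using asy by blast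
    have rl: "rot a (q n) = exp (- real n) *\<^sub>R rot a (r (real n))" for n
      unfolding q_def using linear_scale[OF bounded_linear.linear[OF bounded_linear_rot]] by blast
    have b: "norm (lor u (q n) (rot a (q n))) \<le> exp (- 2) ^ n * cosh C" for n
    proof -
      have h: "rot a (r (real n)) \<in> hinf u" unfolding rot_def by (rule opr_hinf[OF is_mob_cis rh]) simp
      define k where "k = lor u (r (real n)) (rot a (r (real n)))"
      have k: "k \<ge> 1" unfolding k_def by (rule lor_ge_1[OF rh h]) simp
      have "arcosh k \<le> C" using C[of "real n"] by (simp add: hdist_def k_def)
      then have "cosh (arcosh k) \<le> cosh C"
        using arcosh_nonneg_real[OF k] by (subst cosh_real_nonneg_le_iff) auto
      then have "k \<le> cosh C" using k by simp
      moreover have "lor u (q n) (rot a (q n)) = exp (- 2) ^ n * k"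
        unfolding rl by (simp add: q_def lor.scaleR_left lor.scaleR_right k_def e2'[symmetric])
      ultimately show ?thesis using k by (simp add: abs_mult mult_left_mono)
    qed
    have "(\<lambda>n. exp (- 2 :: real) ^ n * cosh C) \<longlonglongrightarrow> 0" by (rule tendsto_mult_left_zero[OF e2])
    then have lim0: "(\<lambda>n. lor u (q n) (rot a (q n))) \<longlonglongrightarrow> 0"
      by (rule Lim_null_comparison[rotated]) (rule always_eventually, rule allI, rule b)
    have "(\<lambda>n. lor u (q n) (rot a (q n))) \<longlonglongrightarrow> lor u l (rot a l)"
      by (rule lor.tendsto[OF ql bounded_linear.tendsto[OF bounded_linear_rot ql]])
    from LIMSEQ_unique[OF this lim0] show ?thesis .
  qed
  have rot0: "rot 0 x = x" for x by (rule cf_eqI) (simp add: cf_rot)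
  have ll: "lor u l l = 0" using null[of 0] by (simp add: rot0)
  have rr: "lor u (rot a l) (rot a l) = 0" for a
    using ll opr_props(3)[OF is_mob_cis] unfolding rot_def by simp
  have l0: "l \<noteq> 0"
  proof
    assume "l = 0"
    moreover have "lor u l (r 0) = (cosh 1 - exp (- 1)) / (2 * sinh 1)"
      using lor_eq_cosh[OF rh rh rd, of 0 0] lor_eq_cosh[OF rh rh rd, of 1 0]
      unfolding l_def lor.add_left lor.scaleR_left by (simp add: diff_divide_distrib)
    moreover have "cosh (1::real) - exp (- 1) = sinh 1" by (simp add: cosh_def sinh_def field_simps)
    ultimately show False by (simp add: lor.zero_left)
  qed
  have lu: "l \<bullet> e 0 \<noteq> 0" using norm_sq_lor[of l] ll l0 by auto
  have "rot a l = l" for a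
  proof -
    have "(rot a l \<bullet> e 0) *\<^sub>R l = (l \<bullet> e 0) *\<^sub>R rot a l"
      by (rule null_vectors_proportional[OF ll rr null])
    then show ?thesis using lu by (simp add: rot_dot_u)
  qed
  then have l: "l = (l \<bullet> e 0) *\<^sub>R e 0" by (rule rot_fixed)
  have "lor u ((l \<bullet> e 0) *\<^sub>R e 0) ((l \<bullet> e 0) *\<^sub>R e 0) = (l \<bullet> e 0)\<^sup>2"
    by (simp add: lor.scaleR_left lor.scaleR_right lor_u u_dot_u power2_eq_square)
  then have "lor u l l = (l \<bullet> e 0)\<^sup>2" unfolding l[symmetric] .
  then show False using ll lu by simp
qed

lemma rho_non_elementary:
  assumes "infinite_dimensional (UNIV :: 'h set)"
  shows "\<not> elementary u PSL2R rho"
proof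
  assume "elementary u PSL2R rho"
  then consider \<Lambda> where "geodesic_line u \<Lambda>" "\<forall>g\<in>carrier PSL2R. rho g ` \<Lambda> = \<Lambda>"
    | x where "x \<in> hinf u" "\<forall>g\<in>carrier PSL2R. rho g x = x"
    | \<xi> where "\<xi> \<in> boundary_at_infinity u" "\<forall>g\<in>carrier PSL2R. boundary_map u (rho g) \<xi> = \<xi>"
    unfolding elementary_def by (elim disjE exE bexE conjE) auto
  then show False
  proof cases
    case 1
    then show False using no_invariant_line[OF assms] by blast
  next
    case 2
    then show False using no_fixed_point by blast
  next
    case 3
    then show False using no_fixed_boundary_point by blast
  qed
qed

end



section \<open>Conformal metrics on the disc\<close>

text \<open>
  The columns of an orthogonal matrix are orthonormal if its rows are.
\<close>

lemma orthonormal_pair_rows: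
  fixes p q r s k :: real
  assumes "k * (p\<^sup>2 + q\<^sup>2) = 1" "k * (r\<^sup>2 + s\<^sup>2) = 1" "p * r + q * s = 0"
  shows "k * (p\<^sup>2 + r\<^sup>2) = 1" "k * (q\<^sup>2 + s\<^sup>2) = 1" "p * q + r * s = 0"
proof -
  define c where "c = k * (p * s - q * r)"
  have "r = - c * q"
  proof -
    have "- c * q = k * (p\<^sup>2 + q\<^sup>2) * r - k * p * (p * r + q * s)"
      by (simp add: c_def power2_eq_square algebra_simps)
    then show ?thesis using assms by simp
  qed
  moreover have "s = c * p"
  proof -
    have "c * p = k * (p\<^sup>2 + q\<^sup>2) * s - k * q * (p * r + q * s)"
      by (simp add: c_def power2_eq_square algebra_simps)
    then show ?thesis using assms by simp
  qed
  ultimately have rs: "r = - c * q" "s = c * p" by auto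
  have "c\<^sup>2 * (k * (p\<^sup>2 + q\<^sup>2)) = 1" using assms(2) by (simp add: rs power_mult_distrib algebra_simps)
  then have c: "c\<^sup>2 = 1" using assms(1) by simp
  show "k * (p\<^sup>2 + r\<^sup>2) = 1" "k * (q\<^sup>2 + s\<^sup>2) = 1"
    using assms(1) by (simp_all add: rs power_mult_distrib c add.commute)
  have "p * q + r * s = p * q * (1 - c\<^sup>2)" by (simp add: rs power2_eq_square algebra_simps)
  then show "p * q + r * s = 0" by (simp add: c)
qed

text \<open>
  The trace is defined with an arbitrary orthonormal frame. Here it is computed in the frame of rescaled
  standard vectors, independence of the frame being \<open>orthonormal_pair_rows\<close>.
\<close>

lemma metric_trace_conformal:
  fixes Q :: "complex \<Rightarrow> complex \<Rightarrow> 'b::real_vector"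
  assumes g: "\<And>v w. g x v w = k * (v \<bullet> w)" and k: "k > 0" and Q: "bilinear Q"
  shows "metric_trace g x Q = (1 / k) *\<^sub>R (Q 1 1 + Q \<i> \<i>)"
proof -
  define E where "E = (SOME E. orthonormal_frame_at g x E)"
  define j :: real where "j = 1 / sqrt k"
  have jj: "j * j * k = 1" "j \<noteq> 0" using k by (simp_all add: j_def)
  have "orthonormal_frame_at g x {of_real j, of_real j * \<i>}"
  proof -
    have ne: "complex_of_real j \<noteq> of_real j * \<i>" using jj(2) by (simp add: complex_eq_iff)
    have "g x (of_real j) (of_real j) = 1" "g x (of_real j * \<i>) (of_real j * \<i>) = 1"
      "g x (of_real j) (of_real j * \<i>) = 0" "g x (of_real j * \<i>) (of_real j) = 0"
      using jj(1) by (simp_all add: g inner_complex_def mult_ac)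
    with ne show ?thesis unfolding orthonormal_frame_at_def by auto
  qed
  then have E: "orthonormal_frame_at g x E" unfolding E_def by (rule someI)
  then have "card E = 2" by (simp add: orthonormal_frame_at_def)
  then obtain a b where ab: "E = {a, b}" "a \<noteq> b" by (auto simp: card_2_iff)
  have o: "k * ((Re a)\<^sup>2 + (Im a)\<^sup>2) = 1" "k * ((Re b)\<^sup>2 + (Im b)\<^sup>2) = 1" "Re a * Re b + Im a * Im b = 0"
    using E ab k unfolding orthonormal_frame_at_def
    by (auto simp: g inner_complex_def power2_eq_square)
  note r = orthonormal_pair_rows[OF o]
  have lin: "linear (Q v)" "linear (\<lambda>v. Q v w)" for v w using Q by (auto simp: bilinear_def)
  have ex: "Q v v = (Re v)\<^sup>2 *\<^sub>R Q 1 1 + (Re v * Im v) *\<^sub>R (Q 1 \<i> + Q \<i> 1) + (Im v)\<^sup>2 *\<^sub>R Q \<i> \<i>" for v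
  proof -
    have v: "v = Re v *\<^sub>R 1 + Im v *\<^sub>R \<i>" by (simp add: complex_eq_iff)
    have "Q v v = Q (Re v *\<^sub>R 1 + Im v *\<^sub>R \<i>) (Re v *\<^sub>R 1 + Im v *\<^sub>R \<i>)" using v by simp
    also have "\<dots> = Re v *\<^sub>R (Re v *\<^sub>R Q 1 1 + Im v *\<^sub>R Q 1 \<i>) + Im v *\<^sub>R (Re v *\<^sub>R Q \<i> 1 + Im v *\<^sub>R Q \<i> \<i>)"
      by (simp only: linear_add[OF lin(1)] linear_add[OF lin(2)] linear_scale[OF lin(1)] linear_scale[OF lin(2)])
        (simp add: algebra_simps)
    finally show ?thesis by (simp add: power2_eq_square algebra_simps)
  qed
  have "metric_trace g x Q = Q a a + Q b b" using ab by (simp add: metric_trace_def E_def[symmetric])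
  also have "\<dots> = ((Re a)\<^sup>2 + (Re b)\<^sup>2) *\<^sub>R Q 1 1 + (Re a * Im a + Re b * Im b) *\<^sub>R (Q 1 \<i> + Q \<i> 1)
      + ((Im a)\<^sup>2 + (Im b)\<^sup>2) *\<^sub>R Q \<i> \<i>"
    by (simp add: ex[of a] ex[of b] scaleR_left_distrib)
  also have "(Re a)\<^sup>2 + (Re b)\<^sup>2 = 1 / k" using r(1) k by (simp add: field_simps)
  also have "(Im a)\<^sup>2 + (Im b)\<^sup>2 = 1 / k" using r(2) k by (simp add: field_simps)
  finally show ?thesis by (simp add: r(3) scaleR_right_distrib)
qed

text \<open>
  The Christoffel symbols of the hyperbolic metric and of its constant multiples.
\<close>

definition conf_christoffel :: "complex \<Rightarrow> complex \<Rightarrow> complex \<Rightarrow> complex" where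
  "conf_christoffel x v w = (2 / (1 - (norm x)\<^sup>2)) *\<^sub>R ((x \<bullet> v) *\<^sub>R w + (x \<bullet> w) *\<^sub>R v - (v \<bullet> w) *\<^sub>R x)"

lemma conf_metric_deriv:
  assumes g: "\<And>y v w. norm y < 1 \<Longrightarrow> g y v w = C * disc_metric y v w" and x: "norm x < 1"
  shows "frechet_derivative (\<lambda>y. g y v w) (at x) h = 16 * C * (v \<bullet> w) * (x \<bullet> h) / (1 - (norm x)\<^sup>2) ^ 3"
proof -
  have y: "1 - (norm x)\<^sup>2 > 0" by (rule disc_sq[OF x])
  have "((\<lambda>y. (4 * C * (v \<bullet> w)) * (1 - (norm y)\<^sup>2) powr (- 2)) has_derivative
     (\<lambda>h. (4 * C * (v \<bullet> w)) * ((- 2 * (- 2)) * ((x \<bullet> h) * (1 - (norm x)\<^sup>2) powr (- 2 - 1))))) (at x)"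
    by (intro has_derivative_mult_right has_derivative_disc_powr x)
  then have "((\<lambda>y. g y v w) has_derivative
     (\<lambda>h. (4 * C * (v \<bullet> w)) * ((- 2 * (- 2)) * ((x \<bullet> h) * (1 - (norm x)\<^sup>2) powr (- 2 - 1))))) (at x)"
  proof (rule has_derivative_transform_within_open[of _ _ _ _ "ball 0 1"])
    fix y :: complex assume "y \<in> ball 0 1"
    then have y: "norm y < 1" by simp
    show "4 * C * (v \<bullet> w) * (1 - (norm y)\<^sup>2) powr - 2 = g y v w"
      unfolding g[OF y] using disc_sq[OF y] by (simp add: disc_metric_def powr_minus powr_numeral divide_inverse)
  qed (use x in auto)
  from frechet_derivative_at[OF this, symmetric] have "frechet_derivative (\<lambda>y. g y v w) (at x) h
     = 16 * C * (v \<bullet> w) * (x \<bullet> h) * (1 - (norm x)\<^sup>2) powr (- 3)" by simp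
  also have "(1 - (norm x)\<^sup>2) powr (- 3) = 1 / (1 - (norm x)\<^sup>2) ^ 3"
    using y by (simp add: powr_minus powr_numeral divide_inverse)
  finally show ?thesis by simp
qed

lemma christoffel_conf:
  assumes g: "\<And>y v w. norm y < 1 \<Longrightarrow> g y v w = C * disc_metric y v w" and C: "C > 0" and x: "norm x < 1"
  shows "christoffel g x v w = conf_christoffel x v w"
  unfolding christoffel_def
proof (rule the_equality)
  define Y where "Y = 1 - (norm x)\<^sup>2"
  have Y: "Y > 0" unfolding Y_def by (rule disc_sq[OF x])
  have dm: "frechet_derivative (\<lambda>y. g y v w) (at x) h = 16 * C * (v \<bullet> w) * (x \<bullet> h) / (1 - (norm x)\<^sup>2) ^ 3" for v w h
    by (rule conf_metric_deriv) (use g x in auto)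
  have key: "2 * g x (conf_christoffel x v w) z = frechet_derivative (\<lambda>y. g y w z) (at x) v +
      frechet_derivative (\<lambda>y. g y v z) (at x) w - frechet_derivative (\<lambda>y. g y v w) (at x) z" for z
  proof -
    define m where "m = (x \<bullet> v) * (w \<bullet> z) + (x \<bullet> w) * (v \<bullet> z) - (v \<bullet> w) * (x \<bullet> z)"
    have cz: "conf_christoffel x v w \<bullet> z = (2 / Y) * m"
      by (simp add: conf_christoffel_def Y_def m_def inner_diff_left inner_add_left)
    have "g x (conf_christoffel x v w) z = C * (4 * (conf_christoffel x v w \<bullet> z) / Y\<^sup>2)"
      by (simp add: g[OF x] disc_metric_def Y_def)
    then have "2 * g x (conf_christoffel x v w) z
        = 16 * C * m / Y ^ 3"
      unfolding cz by (simp add: power2_eq_square power3_eq_cube)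
    then show ?thesis
      by (simp add: dm Y_def[symmetric] m_def diff_divide_distrib add_divide_distrib
          algebra_simps inner_commute)
  qed
  then show "\<forall>z. 2 * g x (conf_christoffel x v w) z = frechet_derivative (\<lambda>y. g y w z) (at x) v +
      frechet_derivative (\<lambda>y. g y v z) (at x) w - frechet_derivative (\<lambda>y. g y v w) (at x) z" by blast
  fix c assume c: "\<forall>z. 2 * g x c z = frechet_derivative (\<lambda>y. g y w z) (at x) v +
      frechet_derivative (\<lambda>y. g y v z) (at x) w - frechet_derivative (\<lambda>y. g y v w) (at x) z"
  have "c \<bullet> z = conf_christoffel x v w \<bullet> z" for z
  proof -
    have "g x c z = g x (conf_christoffel x v w) z" using c key[of z] by (metis mult_cancel_left zero_neq_numeral)
    then show ?thesis using C Y by (simp add: g[OF x] disc_metric_def Y_def[symmetric])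
  qed
  then show "c = conf_christoffel x v w" using vector_eq_rdot by blast
qed

lemma bilinear_conf_christoffel: "bilinear (conf_christoffel x)"
  unfolding bilinear_def conf_christoffel_def
  by (intro conjI allI linear_compose_scale_right)
     (auto intro!: linearI simp: inner_add_left inner_add_right algebra_simps)

text \<open>
  This is the conformal invariance of harmonicity in dimension two: the Laplacian on a surface has no
  first order terms in conformal coordinates.
\<close>

lemma conf_christoffel_trace: "conf_christoffel x 1 1 + conf_christoffel x \<i> \<i> = 0"
  by (simp add: conf_christoffel_def complex_eq_iff inner_complex_def algebra_simps)

lemma gauss_curvature_conf:
  assumes g: "\<And>y v w. norm y < 1 \<Longrightarrow> g y v w = C * disc_metric y v w" and C: "C > 0" and x: "norm x < 1"
  shows "gauss_curvature g x = - 1 / C"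
proof -
  define Y where "Y = 1 - (norm x)\<^sup>2"
  have Y: "Y > 0" unfolding Y_def by (rule disc_sq[OF x])
  have Y': "Y = 1 - ((Re x)\<^sup>2 + (Im x)\<^sup>2)" by (simp add: Y_def cmod_power2)
  have chr: "christoffel g y v w = conf_christoffel y v w" if "norm y < 1" for y v w
    by (rule christoffel_conf) (use g C that in auto)
  have ii: "conf_christoffel y \<i> \<i> = (2 / (1 - (norm y)\<^sup>2)) *\<^sub>R (- cnj y)"
    and oi: "conf_christoffel y 1 \<i> = (2 / (1 - (norm y)\<^sup>2)) *\<^sub>R (\<i> * cnj y)" for y
    by (simp_all add: conf_christoffel_def complex_eq_iff inner_complex_def)
  have D: "((\<lambda>y. 2 / (1 - (norm y)\<^sup>2)) has_derivative (\<lambda>h. 4 * (x \<bullet> h) / Y\<^sup>2)) (at x)"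
  proof -
    have "1 - (norm x)\<^sup>2 \<noteq> 0" using Y by (simp add: Y_def)
    from DERIV_inverse[OF this]
    have "(inverse has_real_derivative - (inverse Y ^ 2)) (at (1 - (norm x)\<^sup>2))"
      by (simp add: Y_def numeral_2_eq_2)
    from has_derivative_mult_right[OF has_derivative_compose[OF has_derivative_norm_sq this[unfolded has_field_derivative_def]], of 2]
    have "((\<lambda>y. 2 * inverse (1 - (norm y)\<^sup>2)) has_derivative (\<lambda>h. 2 * (- (inverse Y ^ 2) * (- 2 * (x \<bullet> h))))) (at x)" .
    then show ?thesis by (simp add: divide_inverse power_inverse mult_ac)
  qed
  have D1: "frechet_derivative (\<lambda>y. christoffel g y \<i> \<i>) (at x) 1 = (4 * Re x / Y\<^sup>2) *\<^sub>R (- cnj x) + (2 / Y) *\<^sub>R (- 1)"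
  proof -
    have "((\<lambda>y. (2 / (1 - (norm y)\<^sup>2)) *\<^sub>R (- cnj y)) has_derivative
        (\<lambda>h. (2 / (1 - (norm x)\<^sup>2)) *\<^sub>R (- cnj h) + (4 * (x \<bullet> h) / Y\<^sup>2) *\<^sub>R (- cnj x))) (at x)"
      by (intro has_derivative_scaleR D has_derivative_minus bounded_linear_imp_has_derivative bounded_linear_cnj)
    then have "((\<lambda>y. christoffel g y \<i> \<i>) has_derivative
        (\<lambda>h. (2 / (1 - (norm x)\<^sup>2)) *\<^sub>R (- cnj h) + (4 * (x \<bullet> h) / Y\<^sup>2) *\<^sub>R (- cnj x))) (at x)"
      by (rule has_derivative_transform_within_open[of _ _ _ _ "ball 0 1"]) (use x in \<open>auto simp: chr ii\<close>)
    from frechet_derivative_at[OF this, symmetric] show ?thesis by (simp add: Y_def[symmetric] inner_complex_def)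
  qed
  have D2: "frechet_derivative (\<lambda>y. christoffel g y 1 \<i>) (at x) \<i> = (4 * Im x / Y\<^sup>2) *\<^sub>R (\<i> * cnj x) + (2 / Y) *\<^sub>R 1"
  proof -
    have "((\<lambda>y. (2 / (1 - (norm y)\<^sup>2)) *\<^sub>R (\<i> * cnj y)) has_derivative
        (\<lambda>h. (2 / (1 - (norm x)\<^sup>2)) *\<^sub>R (\<i> * cnj h) + (4 * (x \<bullet> h) / Y\<^sup>2) *\<^sub>R (\<i> * cnj x))) (at x)"
      by (intro has_derivative_scaleR D has_derivative_mult_right bounded_linear_imp_has_derivative bounded_linear_cnj)
    then have "((\<lambda>y. christoffel g y 1 \<i>) has_derivative
        (\<lambda>h. (2 / (1 - (norm x)\<^sup>2)) *\<^sub>R (\<i> * cnj h) + (4 * (x \<bullet> h) / Y\<^sup>2) *\<^sub>R (\<i> * cnj x))) (at x)"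
      by (rule has_derivative_transform_within_open[of _ _ _ _ "ball 0 1"]) (use x in \<open>auto simp: chr oi\<close>)
    from frechet_derivative_at[OF this, symmetric] show ?thesis by (simp add: Y_def[symmetric] inner_complex_def)
  qed
  have R1: "Re (conf_christoffel x 1 (conf_christoffel x \<i> \<i>)) = (2 / Y)\<^sup>2 * ((Im x)\<^sup>2 - (Re x)\<^sup>2)"
    unfolding ii unfolding conf_christoffel_def Y_def[symmetric]
    by (simp add: inner_complex_def power2_eq_square algebra_simps)
  have R2: "Re (conf_christoffel x \<i> (conf_christoffel x 1 \<i>)) = (2 / Y)\<^sup>2 * ((Im x)\<^sup>2 - (Re x)\<^sup>2)"
    unfolding oi unfolding conf_christoffel_def Y_def[symmetric]
    by (simp add: inner_complex_def power2_eq_square algebra_simps)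
  have "Re (curvature_tensor g x 1 \<i> \<i>) = - (4 * ((Re x)\<^sup>2 + (Im x)\<^sup>2) / Y\<^sup>2 + 4 / Y)"
    unfolding curvature_tensor_def D1 D2 chr[OF x]
    by (simp add: R1 R2 power2_eq_square add_divide_distrib algebra_simps)
  also have "\<dots> = - 4 / Y\<^sup>2" using Y unfolding Y' by (simp add: divide_simps power2_eq_square)
  finally have R: "Re (curvature_tensor g x 1 \<i> \<i>) = - 4 / Y\<^sup>2" .
  have gx: "g x v w = (4 * C / Y\<^sup>2) * (v \<bullet> w)" for v w by (simp add: g[OF x] disc_metric_def Y_def)
  have "gauss_curvature g x = (4 * C / Y\<^sup>2) * (- 4 / Y\<^sup>2) / ((4 * C / Y\<^sup>2) * (4 * C / Y\<^sup>2))"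
    unfolding gauss_curvature_def sectional_curvature_def gx by (simp add: inner_complex_def R)
  also have "\<dots> = - 1 / C" using C Y by (simp add: divide_simps)
  finally show ?thesis .
qed

section \<open>Conformality, harmonicity and minimality\<close>

lemma is_mob_deriv:
  assumes "is_mob \<phi>" "norm z < 1" obtains d where "(\<phi> has_field_derivative d) (at z)"
proof -
  obtain \<alpha> \<beta> where \<phi>: "(norm \<alpha>)\<^sup>2 - (norm \<beta>)\<^sup>2 = 1" "\<And>z. norm z < 1 \<Longrightarrow> \<phi> z = mob \<alpha> \<beta> z"
    using assms(1) unfolding is_mob_def by blast
  have "\<exists>d. (mob \<alpha> \<beta> has_field_derivative d) (at z)"
    unfolding mob_def
    by (rule exI) (rule derivative_eq_intros refl mob_denom[OF \<phi>(1) assms(2)])+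
  then obtain d where "(mob \<alpha> \<beta> has_field_derivative d) (at z)" by blast
  then have "(\<phi> has_field_derivative d) (at z)"
    by (rule has_field_derivative_transform_within_open[of _ _ _ "ball 0 1"]) (use assms(2) \<phi>(2) in auto)
  then show thesis by (rule that)
qed

text \<open>
  Conjugate the rotation by a right angle about the origin. Its derivative at the fixed point is conjugated by
  a complex number, that is, unchanged.
\<close>

lemma is_mob_stabilizer:
  assumes z: "norm z < 1"
  obtains \<phi> where "is_mob \<phi>" "\<phi> z = z" "(\<phi> has_field_derivative \<i>) (at z)"
proof -
  obtain \<phi> where \<phi>: "is_mob \<phi>" "\<phi> 0 = z" using is_mob_transitive[OF z] by metis
  obtain \<psi> where \<psi>: "is_mob \<psi>" "\<And>z. norm z < 1 \<Longrightarrow> \<psi> (\<phi> z) = z" "\<And>z. norm z < 1 \<Longrightarrow> \<phi> (\<psi> z) = z"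
    using is_mob_inverse[OF \<phi>(1)] by metis
  have \<psi>z: "\<psi> z = 0" using \<psi>(2)[of 0] \<phi>(2) by simp
  have m: "is_mob (\<lambda>w. \<i> * \<psi> w)" by (rule is_mob_comp[OF is_mob_rotate \<psi>(1)]) simp
  obtain p where p: "(\<phi> has_field_derivative p) (at 0)" using is_mob_deriv[OF \<phi>(1), of 0] by auto
  obtain q where q: "(\<psi> has_field_derivative q) (at z)" using is_mob_deriv[OF \<psi>(1) z] by auto
  have "((\<lambda>w. \<phi> (\<psi> w)) has_field_derivative p * q) (at z)"
    using DERIV_chain2[of \<phi> p \<psi> z q] p q \<psi>z by simp
  moreover have "((\<lambda>w. \<phi> (\<psi> w)) has_field_derivative 1) (at z)"
    by (rule has_field_derivative_transform_within_open[OF DERIV_ident, of "ball 0 1"]) (use z \<psi>(3) in auto)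
  ultimately have pq: "p * q = 1" by (rule DERIV_unique)
  have "((\<lambda>w. \<i> * \<psi> w) has_field_derivative \<i> * q) (at z)" by (intro DERIV_cmult q)
  then have "((\<lambda>w. \<phi> (\<i> * \<psi> w)) has_field_derivative p * (\<i> * q)) (at z)"
    using DERIV_chain2[of \<phi> p "\<lambda>w. \<i> * \<psi> w" z "\<i> * q"] p \<psi>z by simp
  moreover have "p * (\<i> * q) = \<i>" using pq by (simp add: mult.left_commute)
  ultimately show thesis using that[OF is_mob_comp[OF \<phi>(1) m]] \<psi>z \<phi>(2) by simp
qed

context model
begin

lemma linear_DF: "norm z < 1 \<Longrightarrow> linear (DF z)"
  using F_deriv has_derivative_linear by blast

lemma bilinear_DDF:
  assumes z: "norm z < 1" shows "bilinear (DDF z)"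
  unfolding bilinear_def
proof (intro conjI allI)
  show "linear (\<lambda>v. DDF z v w)" for w using DF_deriv[OF z] has_derivative_linear by blast
  show "linear (DDF z v)" for v
  proof (rule linearI)
    fix w w' and r :: real
    have "((\<lambda>y. DF y (w + w')) has_derivative (\<lambda>v. DDF z v w + DDF z v w')) (at z)"
      by (rule has_derivative_transform_within_open[OF has_derivative_add[OF DF_deriv[OF z] DF_deriv[OF z]], of "ball 0 1"])
         (use z in \<open>auto simp: linear_add[OF linear_DF]\<close>)
    from fun_cong[OF has_derivative_unique[OF DF_deriv[OF z] this], of v]
    show "DDF z v (w + w') = DDF z v w + DDF z v w'" .
    have "((\<lambda>y. DF y (r *\<^sub>R w)) has_derivative (\<lambda>v. r *\<^sub>R DDF z v w)) (at z)"
      by (rule has_derivative_transform_within_open[OF has_derivative_scaleR_right[OF DF_deriv[OF z]], of "ball 0 1"])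
         (use z in \<open>auto simp: linear_scale[OF linear_DF]\<close>)
    from fun_cong[OF has_derivative_unique[OF DF_deriv[OF z] this], of v]
    show "DDF z v (r *\<^sub>R w) = r *\<^sub>R DDF z v w" .
  qed
qed

lemma lor_F_DF:
  assumes z: "norm z < 1" shows "lor u (F z) (DF z v) = 0"
proof -
  have 1: "((\<lambda>y. lor u (F y) (F y)) has_derivative
      (\<lambda>v. lor u (F z) (DF z v) + lor u (DF z v) (F z))) (at z)"
    by (rule lor.FDERIV[OF F_deriv[OF z] F_deriv[OF z]])
  have 2: "((\<lambda>y. lor u (F y) (F y)) has_derivative (\<lambda>v. 0)) (at z)"
    by (rule has_derivative_transform_within_open[OF has_derivative_const[of 1], of "ball 0 1"])
       (use z in \<open>auto simp: lor_F_F\<close>)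
  have "lor u (F z) (DF z v) + lor u (DF z v) (F z) = 0"
    using fun_cong[OF has_derivative_unique[OF 1 2], of v] by simp
  then show ?thesis by (simp add: lor_commute[of _ "DF z v"])
qed

lemma lor_F_DDF:
  assumes z: "norm z < 1" shows "lor u (F z) (DDF z v w) = - lor u (DF z v) (DF z w)"
proof -
  have 1: "((\<lambda>y. lor u (F y) (DF y w)) has_derivative
      (\<lambda>v. lor u (F z) (DDF z v w) + lor u (DF z v) (DF z w))) (at z)"
    by (rule lor.FDERIV[OF F_deriv[OF z] DF_deriv[OF z]])
  have 2: "((\<lambda>y. lor u (F y) (DF y w)) has_derivative (\<lambda>v. 0)) (at z)"
    by (rule has_derivative_transform_within_open[OF has_derivative_const[of 0], of "ball 0 1"])
       (use z in \<open>auto simp: lor_F_DF\<close>)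
  have "lor u (F z) (DDF z v w) + lor u (DF z v) (DF z w) = 0"
    using fun_cong[OF has_derivative_unique[OF 1 2], of v] by simp
  then show ?thesis by simp
qed

text \<open>
  The density of the induced metric with respect to the euclidean metric.
\<close>

definition conf_factor :: "complex \<Rightarrow> real" where "conf_factor z = 2 * (t * (t + 1)) / (1 - (norm z)\<^sup>2)\<^sup>2"

lemma conf_factor_pos: "norm z < 1 \<Longrightarrow> conf_factor z > 0"
  using disc_sq[of z] t_pos by (simp add: conf_factor_def)

text \<open>
  The stabilizer element of order four makes the form invariant under multiplication by \<open>\<i>\<close>, which leaves
  only multiples of the euclidean metric. Its trace is \<open>lor u\<close> of \<open>F\<close> and its Laplacian, by differentiating
  \<open>lor u (F z) (F z) = 1\<close> twice, and so is given by the eigenvalue.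
\<close>

lemma induced_metric_F:
  assumes z: "norm z < 1" shows "induced_metric u F z v w = conf_factor z * (v \<bullet> w)"
proof -
  define I where "I v w = - lor u (DF z v) (DF z w)" for v w
  have lin: "linear (DF z)" by (rule linear_DF[OF z])
  obtain \<phi> where \<phi>: "is_mob \<phi>" "\<phi> z = z" "(\<phi> has_field_derivative \<i>) (at z)" using is_mob_stabilizer[OF z] by metis
  have i: "DF z (\<i> * v) = opr \<phi> (DF z v)" for v
  proof -
    have "(F has_derivative DF z) (at (\<phi> z))" using F_deriv[OF z] \<phi>(2) by simp
    from has_derivative_compose[OF \<phi>(3)[unfolded has_field_derivative_def] this]
    have 1: "((\<lambda>y. F (\<phi> y)) has_derivative (\<lambda>v. DF z (\<i> * v))) (at z)" .
    have 2: "((\<lambda>y. F (\<phi> y)) has_derivative (\<lambda>v. opr \<phi> (DF z v))) (at z)"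
      by (rule has_derivative_transform_within_open[OF bounded_linear.has_derivative[OF opr_props(1)[OF \<phi>(1)] F_deriv[OF z]], of "ball 0 1"])
         (use z in \<open>auto simp: opr_props(2)[OF \<phi>(1)]\<close>)
    show ?thesis using fun_cong[OF has_derivative_unique[OF 1 2], of v] by simp
  qed
  have Ii: "I (\<i> * v) (\<i> * w) = I v w" for v w by (simp add: I_def i opr_props(3)[OF \<phi>(1)])
  have sym: "I v w = I w v" for v w by (simp add: I_def lor_commute)
  have I1: "I \<i> \<i> = I 1 1" using Ii[of 1 1] by simp
  have "I 1 \<i> = I \<i> (- 1)" using Ii[of 1 \<i>] by simp
  also have "\<dots> = - I \<i> 1" by (simp add: I_def linear_neg[OF lin] lor.minus_right)
  finally have I0: "I 1 \<i> = 0" "I \<i> 1 = 0" using sym[of 1 \<i>] by auto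
  have "I 1 1 + I \<i> \<i> = lor u (F z) (DDF z 1 1 + DDF z \<i> \<i>)"
    by (simp add: lor.add_right lor_F_DDF[OF z] I_def)
  also have "\<dots> = 2 * conf_factor z" unfolding laplace_F[OF z] by (simp add: lor.scaleR_right lor_F_F[OF z] conf_factor_def)
  finally have I2: "I 1 1 = conf_factor z" using I1 by simp
  have ex: "DF z v = Re v *\<^sub>R DF z 1 + Im v *\<^sub>R DF z \<i>" for v
  proof -
    have "v = Re v *\<^sub>R 1 + Im v *\<^sub>R \<i>" by (simp add: complex_eq_iff)
    then have "DF z v = DF z (Re v *\<^sub>R 1 + Im v *\<^sub>R \<i>)" by simp
    then show ?thesis by (simp only: linear_add[OF lin] linear_scale[OF lin])
  qed
  have "I v w = Re v * Re w * I 1 1 + Re v * Im w * I 1 \<i> + Im v * Re w * I \<i> 1 + Im v * Im w * I \<i> \<i>"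
    unfolding I_def ex[of v] ex[of w]
    by (simp add: lor.add_left lor.add_right lor.scaleR_left lor.scaleR_right algebra_simps)
  also have "\<dots> = conf_factor z * (v \<bullet> w)" by (simp add: I0 I1 I2 inner_complex_def algebra_simps)
  finally show ?thesis by (simp add: induced_metric_def hmetric_def I_def)
qed

lemma induced_metric_F_conf:
  "norm z < 1 \<Longrightarrow> induced_metric u F z v w = (t * (t + 1) / 2) * disc_metric z v w"
  by (simp add: induced_metric_F conf_factor_def disc_metric_def)

text \<open>
  The second derivative of \<open>F\<close> projected to the tangent space of the hyperboloid.
\<close>

definition hess :: "complex \<Rightarrow> complex \<Rightarrow> complex \<Rightarrow> 'h" where
  "hess z v w = pullback_conn u F (\<lambda>y. DF y w) z v"

lemma hess_eq: "hess z v w = DDF z v w - lor u (F z) (DDF z v w) *\<^sub>R F z"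
  by (simp add: hess_def pullback_conn_def)

lemma bilinear_hess:
  assumes z: "norm z < 1" shows "bilinear (hess z)"
proof -
  have lin: "linear (DDF z v)" "linear (\<lambda>v. DDF z v w)" for v w using bilinear_DDF[OF z] by (auto simp: bilinear_def)
  show ?thesis unfolding bilinear_def
    by (auto intro!: linearI simp: hess_eq linear_add[OF lin(1)] linear_add[OF lin(2)] linear_scale[OF lin(1)]
        linear_scale[OF lin(2)] lor.add_right lor.scaleR_right algebra_simps)
qed

text \<open>
  The Laplacian of \<open>F\<close> is a multiple of \<open>F\<close>, hence normal to the hyperboloid.
\<close>

lemma hess_trace: assumes z: "norm z < 1" shows "hess z 1 1 + hess z \<i> \<i> = 0"
proof -
  have "hess z 1 1 + hess z \<i> \<i> = (DDF z 1 1 + DDF z \<i> \<i>) - lor u (F z) (DDF z 1 1 + DDF z \<i> \<i>) *\<^sub>R F z"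
    by (simp add: hess_eq lor.add_right scaleR_left_distrib)
  then show ?thesis unfolding laplace_F[OF z] by (simp add: lor.scaleR_right lor_F_F[OF z])
qed

lemma harmonic_F: "harmonic_map u disc_metric unit_disc F"
  unfolding harmonic_map_def
proof (intro conjI ballI)
  show "F ` unit_disc \<subseteq> hinf u" using F_in_hinf by auto
  show "smooth_on F unit_disc" by (rule smooth_F)
  fix z :: complex assume "z \<in> unit_disc"
  then have z: "norm z < 1" by simp
  have Y: "1 - (norm z)\<^sup>2 > 0" by (rule disc_sq[OF z])
  have nab: "nabla_df u disc_metric F z v w = hess z v w - DF z (conf_christoffel z v w)" for v w
    using christoffel_conf[of disc_metric 1 z v w] z by (simp add: nabla_df_def hess_def)
  have lin: "linear (DF z)" by (rule linear_DF[OF z])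
  have "bilinear (nabla_df u disc_metric F z)"
    using bilinear_hess[OF z] bilinear_conf_christoffel[of z] unfolding bilinear_def nab
    by (auto intro!: linear_compose_sub linear_compose[unfolded o_def, OF _ lin])
  then have "tension_field u disc_metric F z = (1 / (4 / (1 - (norm z)\<^sup>2)\<^sup>2)) *\<^sub>R
      (nabla_df u disc_metric F z 1 1 + nabla_df u disc_metric F z \<i> \<i>)"
    unfolding tension_field_def using Y
    by (intro metric_trace_conformal) (simp_all add: disc_metric_def)
  also have "nabla_df u disc_metric F z 1 1 + nabla_df u disc_metric F z \<i> \<i>
      = (hess z 1 1 + hess z \<i> \<i>) - DF z (conf_christoffel z 1 1 + conf_christoffel z \<i> \<i>)"
    unfolding nab linear_add[OF lin] by simp
  also have "\<dots> = 0" unfolding hess_trace[OF z] conf_christoffel_trace by (simp add: linear_0[OF lin])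
  finally show "tension_field u disc_metric F z = 0" by simp
qed

text \<open>
  The frame of the induced metric is a rescaled standard frame because \<open>F\<close> is conformal, so the trace of the
  second fundamental form is a multiple of the normal part of \<open>hess_trace\<close>.
\<close>

lemma mean_curvature_F:
  assumes z: "norm z < 1" shows "mean_curvature u F z = 0"
proof -
  have k: "conf_factor z > 0" by (rule conf_factor_pos[OF z])
  have lin: "linear (DF z)" by (rule linear_DF[OF z])
  \<comment> \<open>The preimage of the tangential part of \<open>a\<close>.\<close>
  define c where "c a = (1 / conf_factor z) *\<^sub>R Complex (hmetric u a (DF z 1)) (hmetric u a (DF z \<i>))" for a
  have cz: "induced_metric u F z (c a) w = hmetric u a (DF z w)" for a w
  proof -
    have "w = Re w *\<^sub>R 1 + Im w *\<^sub>R \<i>" by (simp add: complex_eq_iff)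
    then have "DF z w = DF z (Re w *\<^sub>R 1 + Im w *\<^sub>R \<i>)" by simp
    then have "DF z w = Re w *\<^sub>R DF z 1 + Im w *\<^sub>R DF z \<i>" by (simp only: linear_add[OF lin] linear_scale[OF lin])
    then show ?thesis using k
      by (simp add: induced_metric_F[OF z] c_def inner_complex_def hmetric_def lor.add_right lor.scaleR_right field_simps)
  qed
  have np: "normal_part u F z a = a - DF z (c a)" for a
  proof -
    have "(THE c. \<forall>w. induced_metric u F z c w = hmetric u a (DF z w)) = c a"
    proof (rule the_equality)
      show "\<forall>w. induced_metric u F z (c a) w = hmetric u a (DF z w)" using cz by blast
      fix c' assume "\<forall>w. induced_metric u F z c' w = hmetric u a (DF z w)"
      then have "conf_factor z * (c' \<bullet> w) = conf_factor z * (c a \<bullet> w)" for w using cz[of a w] by (simp add: induced_metric_F[OF z])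
      then have "c' \<bullet> w = c a \<bullet> w" for w using k by simp
      then show "c' = c a" using vector_eq_rdot by blast
    qed
    then show ?thesis by (simp add: normal_part_def)
  qed
  have linc: "linear c"
    unfolding c_def
    by (intro linear_compose_scale_right linearI)
       (simp_all add: hmetric_def lor.add_left lor.scaleR_left complex_eq_iff)
  have linn: "linear (normal_part u F z)"
    unfolding np[abs_def] by (intro linear_compose_sub linear_ident linear_compose[unfolded o_def, OF linc lin])
  have sff: "second_fundamental_form u F z v w = normal_part u F z (hess z v w)" for v w
    by (simp add: second_fundamental_form_def hess_def)
  have "bilinear (second_fundamental_form u F z)"
    using bilinear_hess[OF z] unfolding bilinear_def sff
    by (auto intro!: linear_compose[unfolded o_def, OF _ linn])
  then have "metric_trace (induced_metric u F) z (second_fundamental_form u F z)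
     = (1 / conf_factor z) *\<^sub>R (second_fundamental_form u F z 1 1 + second_fundamental_form u F z \<i> \<i>)"
    by (intro metric_trace_conformal k induced_metric_F[OF z])
  also have "\<dots> = 0" unfolding sff linear_add[OF linn, symmetric] hess_trace[OF z] by (simp add: linear_0[OF linn])
  finally show ?thesis by (simp add: mean_curvature_def)
qed

text \<open>
  Continuity of the inverse at \<open>F z\<close> is reduced to \<open>z = 0\<close> by equivariance. There the first Fourier
  coefficient of \<open>F w\<close> bounds \<open>w\<close>, by \<open>norm_cn_ge\<close>; in particular no sequence that tends to the
  boundary of the disc has image converging to \<open>F 0\<close>.
\<close>

lemma homeomorphism_F: "homeomorphism (ball 0 1) (F ` ball 0 1) F (inv_into (ball 0 1) F)"
proof (rule homeomorphismI)
  show "continuous_on (ball 0 1) F"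
    by (intro continuous_at_imp_continuous_on ballI has_derivative_continuous[OF F_deriv]) simp
  show "continuous_on (F ` ball 0 1) (inv_into (ball 0 1) F)"
    unfolding continuous_on_def
  proof
    fix x assume "x \<in> F ` ball 0 1"
    then obtain z where z: "norm z < 1" "x = F z" by auto
    obtain \<phi> where \<phi>: "is_mob \<phi>" "\<phi> 0 = z" using is_mob_transitive[OF z(1)] by metis
    obtain \<psi> where \<psi>: "is_mob \<psi>" "\<And>z. norm z < 1 \<Longrightarrow> \<psi> (\<phi> z) = z" "\<And>z. norm z < 1 \<Longrightarrow> \<phi> (\<psi> z) = z"
      using is_mob_inverse[OF \<phi>(1)] by metis
    have \<psi>z: "\<psi> z = 0" using \<psi>(2)[of 0] \<phi>(2) by simp
    let ?i = "inv_into (ball 0 1) F"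
    have i: "?i (F w) = w" if "norm w < 1" for w using that inj_F by simp
    have bl: "bounded_linear (\<lambda>y. cf 1 (opr \<psi> y))"
      by (rule bounded_linear_compose[OF bounded_linear_cf opr_props(1)[OF \<psi>(1)]])
    have "((\<lambda>y. cf 1 (opr \<psi> y)) \<longlongrightarrow> cf 1 (opr \<psi> x)) (at x within F ` ball 0 1)"
      by (rule bounded_linear.tendsto[OF bl tendsto_ident_at])
    moreover have "cf 1 (opr \<psi> x) = 0"
      using opr_props(2)[OF \<psi>(1) z(1)] by (simp add: z(2) \<psi>z cf_F cn_at_0)
    ultimately have "((\<lambda>y. norm (cf 1 (opr \<psi> y))) \<longlongrightarrow> 0) (at x within F ` ball 0 1)"
      using tendsto_norm_zero by metis
    moreover have "norm (\<psi> (?i y)) \<le> norm (cf 1 (opr \<psi> y))" if y: "y \<in> F ` ball 0 1" for y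
    proof -
      obtain w where w: "norm w < 1" "y = F w" using y by auto
      have n: "norm (\<psi> w) < 1" by (rule is_mob_norm[OF \<psi>(1) w(1)])
      show ?thesis unfolding w(2) i[OF w(1)] opr_props(2)[OF \<psi>(1) w(1)] cf_F[OF n] by (rule norm_cn_ge[OF n])
    qed
    then have "\<forall>\<^sub>F y in at x within F ` ball 0 1. norm (\<psi> (?i y)) \<le> norm (cf 1 (opr \<psi> y))"
      by (simp add: eventually_at_filter)
    ultimately have lim: "((\<lambda>y. \<psi> (?i y)) \<longlongrightarrow> 0) (at x within F ` ball 0 1)"
      by (rule Lim_null_comparison[rotated])
    obtain d where d: "(\<phi> has_field_derivative d) (at 0)" using is_mob_deriv[OF \<phi>(1), of 0] by auto
    have "((\<lambda>y. \<phi> (\<psi> (?i y))) \<longlongrightarrow> \<phi> 0) (at x within F ` ball 0 1)"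
      by (rule isCont_tendsto_compose[OF DERIV_isCont[OF d] lim])
    moreover have "\<phi> (\<psi> (?i y)) = ?i y" if "y \<in> F ` ball 0 1" for y
      using that \<psi>(3) i by auto
    then have "\<forall>\<^sub>F y in at x within F ` ball 0 1. \<phi> (\<psi> (?i y)) = ?i y"
      by (simp add: eventually_at_filter)
    ultimately show "(?i \<longlongrightarrow> ?i x) (at x within F ` ball 0 1)"
      unfolding \<phi>(2) z(2) i[OF z(1)]
      by (rule Lim_transform_eventually)
  qed
  show "F ` ball 0 1 \<subseteq> F ` ball 0 1" by simp
  show "inv_into (ball 0 1) F ` F ` ball 0 1 \<subseteq> ball 0 1" by (auto simp: inj_F)
  show "inv_into (ball 0 1) F (F x) = x" if "x \<in> ball 0 1" for x by (rule inv_into_f_f[OF inj_F that])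
  show "F (inv_into (ball 0 1) F y) = y" if "y \<in> F ` ball 0 1" for y by (rule f_inv_into_f[OF that])
qed

lemma minimal_F: "minimal_surface_of_curvature u (- 2 / (t * (t + 1))) (F ` unit_disc)"
  unfolding minimal_surface_of_curvature_def
proof (intro conjI ballI)
  show "F ` unit_disc \<subseteq> hinf u" using F_in_hinf by auto
  fix p assume p: "p \<in> F ` unit_disc"
  have inj: "inj (DF z)" if z: "norm z < 1" for z
  proof (rule linear_injective_0[OF linear_DF[OF z], THEN iffD2], intro allI impI)
    fix v assume "DF z v = 0"
    then have "induced_metric u F z v v = 0" by (simp add: induced_metric_def hmetric_def lor.zero_left)
    then show "v = 0" using conf_factor_pos[OF z] by (simp add: induced_metric_F[OF z])
  qed
  have "surface_parametrization u (F ` unit_disc) unit_disc F"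
    unfolding surface_parametrization_def
    using smooth_F inj homeomorphism_F by auto
  moreover have "mean_curvature u F z = 0 \<and> gauss_curvature (induced_metric u F) z = - 2 / (t * (t + 1))"
    if "z \<in> unit_disc" for z
  proof -
    have z: "norm z < 1" using that by simp
    have "gauss_curvature (induced_metric u F) z = - 1 / (t * (t + 1) / 2)"
    proof (rule gauss_curvature_conf[OF induced_metric_F_conf _ z])
      show "t * (t + 1) / 2 > 0" using t_pos by (intro half_gt_zero mult_pos_pos) auto
    qed
    then show ?thesis using mean_curvature_F[OF z] by simp
  qed
  ultimately show "\<exists>U \<phi>. surface_parametrization u (F ` unit_disc) U \<phi> \<and> p \<in> \<phi> ` U \<and>
     (\<forall>z\<in>U. mean_curvature u \<phi> z = 0 \<and> gauss_curvature (induced_metric u \<phi>) z = - 2 / (t * (t + 1)))"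
    using p by blast
qed

end

section \<open>The family of representations\<close>

theorem theorem2:
  fixes u :: "'h::{real_inner, complete_space}"
  assumes "separable_space (euclidean :: 'h topology)"
    and "infinite_dimensional (UNIV :: 'h set)"
    and "norm u = 1"
  shows "\<exists>\<rho> :: real \<Rightarrow> (real^2^2) set \<Rightarrow> 'h \<Rightarrow> 'h. \<forall>t\<in>{0<..<1}.
           \<rho> t \<in> hom PSL2R (isom_group u) \<and>
           \<not> elementary u PSL2R (\<rho> t) \<and>
           \<not> (\<exists>T. closed_totally_geodesic u T \<and> T \<noteq> hinf u \<and>
                   (\<forall>g\<in>carrier PSL2R. \<rho> t g ` T = T)) \<and>
           (\<exists>f. equivariant (\<rho> t) f \<and>
                harmonic_map u disc_metric unit_disc f \<and>
                minimal_surface_of_curvature u (- 2 / (t * (t + 1))) (f ` unit_disc))"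
proof -
  obtain e :: "nat \<Rightarrow> 'h" where e: "e 0 = u" "\<And>i j. e i \<bullet> e j = (if i = j then 1 else 0)"
    "closure (span (range e)) = UNIV"
    using orthonormal_sequence_exists[OF assms] by metis
  show ?thesis
  proof (intro exI[of _ "\<lambda>t. model.rho t e"] ballI)
    fix t :: real assume "t \<in> {0<..<1}"
    then interpret model t e using e by unfold_locales auto
    show "model.rho t e \<in> hom PSL2R (isom_group u) \<and>
       \<not> elementary u PSL2R (model.rho t e) \<and>
       \<not> (\<exists>T. closed_totally_geodesic u T \<and> T \<noteq> hinf u \<and> (\<forall>g\<in>carrier PSL2R. model.rho t e g ` T = T)) \<and>
       (\<exists>f. equivariant (model.rho t e) f \<and> harmonic_map u disc_metric unit_disc f \<and>
          minimal_surface_of_curvature u (- 2 / (t * (t + 1))) (f ` unit_disc))"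
      using rho_hom rho_non_elementary[OF assms(2)] rho_irreducible rho_equivariant harmonic_F minimal_F
      unfolding e(1) by blast
  qed
qed

end
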